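(* Let $K$ be a differentially closed field of characteristic zero. If $\varphi\colon G\to H$ is a dominant homomorphism of differential algebraic groups over $K$, then $\varphi$ is an open surjective map.
   Context: $K$ is a field with a finite set $\Delta$ of pairwise commuting derivations which is differentially closed: every finite system of differential polynomial equations and inequations over $K$ that has a solution in some differential extension field of $K$ has a solution in $K$. $K\{y_1,\dots,y_n\}$ is the ring of differential polynomials over $K$. A differential algebraic variety is a set $V(\mathfrak a)\subseteq K^n$ of common zeros of a differential ideal $\mathfrak a\subseteq K\{y_1,\dots,y_n\}$; it carries the topology (Kolchin topology) whose closed subsets are the zero sets of differential polynomials. A regular function on $X\subseteq K^n$ is a function $X\to K$ which, in a neighborhood of each point of $X$, equals a quotient $P/Q$ of differential polynomials with $Q$ nowhere zero on that neighborhood. A morphism $X\to Y\subseteq K^m$ is a map whose $m$ coordinate functions are regular functions on $X$. A differential algebraic group is a differential algebraic variety with a group structure for which multiplication $G\times G\to G$ and inversion $G\to G$ are morphisms (for $G\subseteq K^n$, the product $G\times G$ is viewed as a differential algebraic variety in $K^{2n}$). A homomorphism of differential algebraic groups is a group homomorphism that is also a morphism; it is dominant if its image is dense. A map is open if it takes open sets to open sets. *)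

theory Defs
  imports
    "HOL-Library.Poly_Mapping"
    "HOL-Algebra.Weak_Morphisms"
    "HOL-Algebra.Subrings"
    "HOL-Analysis.Abstract_Topology"
begin

section \<open>Differential fields and differential polynomials\<close>

text \<open>The finite set of derivations is given by a list \<open>ds\<close> enumerating it.\<close>

definition derivation :: "('a::ring \<Rightarrow> 'a) \<Rightarrow> bool" where
  "derivation d \<longleftrightarrow> (\<forall>a b. d (a + b) = d a + d b) \<and> (\<forall>a b. d (a * b) = d a * b + a * d b)"

definition differential_field :: "('a::field \<Rightarrow> 'a) list \<Rightarrow> bool" where
  "differential_field ds \<longleftrightarrow>
     (\<forall>d\<in>set ds. derivation d) \<and> (\<forall>d\<in>set ds. \<forall>d'\<in>set ds. \<forall>a. d (d' a) = d' (d a))"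

text \<open>
  The pair \<open>(i, \<theta>)\<close> stands for the derivative \<open>\<theta> y\<^sub>i\<close> of the \<open>i\<close>-th differential indeterminate
  (counted from \<open>0\<close>), where \<open>\<theta>\<close> maps \<open>j\<close> to the exponent of the \<open>j\<close>-th derivation.
  Differential polynomials are polynomials in these variables.
\<close>

type_synonym dvar = "nat \<times> (nat \<Rightarrow>\<^sub>0 nat)"
type_synonym 'a dpoly = "(dvar \<Rightarrow>\<^sub>0 nat) \<Rightarrow>\<^sub>0 'a"

definition dpolys :: "('a::zero \<Rightarrow> 'a) list \<Rightarrow> nat \<Rightarrow> 'a dpoly set" where
  "dpolys ds n =
     {p. \<forall>M\<in>Poly_Mapping.keys p. \<forall>v\<in>Poly_Mapping.keys M.
        fst v < n \<and> Poly_Mapping.keys (snd v) \<subseteq> {..<length ds}}"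

definition dop :: "('a \<Rightarrow> 'a) list \<Rightarrow> (nat \<Rightarrow>\<^sub>0 nat) \<Rightarrow> 'a \<Rightarrow> 'a" where
  "dop ds \<theta> = foldr (\<lambda>j. (ds ! j) ^^ Poly_Mapping.lookup \<theta> j) [0..<length ds]"

definition dmonom_eval :: "('a::comm_ring_1 \<Rightarrow> 'a) list \<Rightarrow> (dvar \<Rightarrow>\<^sub>0 nat) \<Rightarrow> 'a list \<Rightarrow> 'a" where
  "dmonom_eval ds M x =
     (\<Prod>v\<in>Poly_Mapping.keys M. dop ds (snd v) (x ! fst v) ^ Poly_Mapping.lookup M v)"

definition dpoly_eval :: "('a::comm_ring_1 \<Rightarrow> 'a) list \<Rightarrow> 'a dpoly \<Rightarrow> 'a list \<Rightarrow> 'a" where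
  "dpoly_eval ds p x =
     (\<Sum>M\<in>Poly_Mapping.keys p. Poly_Mapping.lookup p M * dmonom_eval ds M x)"

text \<open>
  The derivation extending the \<open>j\<close>-th derivation of the coefficients and taking \<open>\<theta> y\<^sub>i\<close> to
  \<open>\<partial>\<^sub>j \<theta> y\<^sub>i\<close>; the inner sum is the Leibniz rule for the monomial \<open>M\<close>.
\<close>

definition dpoly_deriv :: "('a::comm_ring_1 \<Rightarrow> 'a) list \<Rightarrow> nat \<Rightarrow> 'a dpoly \<Rightarrow> 'a dpoly" where
  "dpoly_deriv ds j p =
     (\<Sum>M\<in>Poly_Mapping.keys p.
        Poly_Mapping.single M ((ds ! j) (Poly_Mapping.lookup p M)) +
        (\<Sum>v\<in>Poly_Mapping.keys M.
           Poly_Mapping.single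
             (M - Poly_Mapping.single v 1 +
                Poly_Mapping.single (fst v, snd v + Poly_Mapping.single j 1) 1)
             (of_nat (Poly_Mapping.lookup M v) * Poly_Mapping.lookup p M)))"

definition differential_ideal :: "('a::comm_ring_1 \<Rightarrow> 'a) list \<Rightarrow> nat \<Rightarrow> 'a dpoly set \<Rightarrow> bool" where
  "differential_ideal ds n I \<longleftrightarrow>
     I \<subseteq> dpolys ds n \<and> 0 \<in> I \<and>
     (\<forall>p\<in>I. \<forall>q\<in>I. p + q \<in> I) \<and>
     (\<forall>p\<in>dpolys ds n. \<forall>q\<in>I. p * q \<in> I) \<and>
     (\<forall>j<length ds. \<forall>p\<in>I. dpoly_deriv ds j p \<in> I)"


section \<open>Differentially closed fields\<close>

text \<open>
  Differential fields other than the ambient one are ring records, so that one can quantify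
  over them.
\<close>

definition derivation_on :: "('b, 'c) ring_scheme \<Rightarrow> ('b \<Rightarrow> 'b) \<Rightarrow> bool" where
  "derivation_on L d \<longleftrightarrow>
     d \<in> carrier L \<rightarrow> carrier L \<and>
     (\<forall>a\<in>carrier L. \<forall>b\<in>carrier L. d (a \<oplus>\<^bsub>L\<^esub> b) = d a \<oplus>\<^bsub>L\<^esub> d b) \<and>
     (\<forall>a\<in>carrier L. \<forall>b\<in>carrier L. d (a \<otimes>\<^bsub>L\<^esub> b) = d a \<otimes>\<^bsub>L\<^esub> b \<oplus>\<^bsub>L\<^esub> a \<otimes>\<^bsub>L\<^esub> d b)"

definition differential_field_on :: "('b, 'c) ring_scheme \<Rightarrow> ('b \<Rightarrow> 'b) list \<Rightarrow> bool" where
  "differential_field_on L es \<longleftrightarrow>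
     field L \<and> (\<forall>d\<in>set es. derivation_on L d) \<and>
     (\<forall>d\<in>set es. \<forall>d'\<in>set es. \<forall>a\<in>carrier L. d (d' a) = d' (d a))"

definition field_record :: "'a::field ring" where
  "field_record = \<lparr>carrier = UNIV, monoid.mult = (*), one = 1, zero = 0, add = (+)\<rparr>"

definition differential_extension ::
  "('a::field \<Rightarrow> 'a) list \<Rightarrow> ('b, 'c) ring_scheme \<Rightarrow> ('b \<Rightarrow> 'b) list \<Rightarrow> ('a \<Rightarrow> 'b) \<Rightarrow> bool" where
  "differential_extension ds L es e \<longleftrightarrow>
     differential_field_on L es \<and> length es = length ds \<and>
     e \<in> ring_hom field_record L \<and>
     (\<forall>j<length ds. \<forall>a. e ((ds ! j) a) = (es ! j) (e a))"

definition dpoly_eval_on ::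
  "('b, 'c) ring_scheme \<Rightarrow> ('b \<Rightarrow> 'b) list \<Rightarrow> ('a::zero \<Rightarrow> 'b) \<Rightarrow> 'a dpoly \<Rightarrow> 'b list \<Rightarrow> 'b" where
  "dpoly_eval_on L es e p x =
     (\<Oplus>\<^bsub>L\<^esub>M\<in>Poly_Mapping.keys p. e (Poly_Mapping.lookup p M) \<otimes>\<^bsub>L\<^esub>
        (\<Otimes>\<^bsub>L\<^esub>v\<in>Poly_Mapping.keys M. dop es (snd v) (x ! fst v) [^]\<^bsub>L\<^esub> Poly_Mapping.lookup M v))"

definition solution ::
  "('a::field \<Rightarrow> 'a) list \<Rightarrow> nat \<Rightarrow> 'a dpoly set \<Rightarrow> 'a dpoly set \<Rightarrow> 'a list \<Rightarrow> bool" where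
  "solution ds n E N x \<longleftrightarrow>
     length x = n \<and> (\<forall>p\<in>E. dpoly_eval ds p x = 0) \<and> (\<forall>q\<in>N. dpoly_eval ds q x \<noteq> 0)"

definition solution_on ::
  "('b, 'c) ring_scheme \<Rightarrow> ('b \<Rightarrow> 'b) list \<Rightarrow> ('a::zero \<Rightarrow> 'b) \<Rightarrow>
     nat \<Rightarrow> 'a dpoly set \<Rightarrow> 'a dpoly set \<Rightarrow> 'b list \<Rightarrow> bool" where
  "solution_on L es e n E N x \<longleftrightarrow>
     length x = n \<and> set x \<subseteq> carrier L \<and>
     (\<forall>p\<in>E. dpoly_eval_on L es e p x = \<zero>\<^bsub>L\<^esub>) \<and> (\<forall>q\<in>N. dpoly_eval_on L es e q x \<noteq> \<zero>\<^bsub>L\<^esub>)"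

text \<open>
  A formula cannot quantify over the type of the extension field. Here the elements of the
  extension are taken from the type of the ground field. This loses nothing in characteristic
  zero, since a solution generates a differential extension field of the same cardinality as
  the ground field: \<open>differentially_closed_imp_solution\<close> below yields solutions from extensions
  over any type.
\<close>

definition differentially_closed :: "('a::field_char_0 \<Rightarrow> 'a) list \<Rightarrow> bool" where
  "differentially_closed ds \<longleftrightarrow>
     (\<forall>n E N. finite E \<and> finite N \<and> E \<subseteq> dpolys ds n \<and> N \<subseteq> dpolys ds n \<and>
        (\<exists>(L :: 'a ring) es e x. differential_extension ds L es e \<and> solution_on L es e n E N x) \<longrightarrow>
        (\<exists>x. solution ds n E N x))"


section \<open>The Kolchin topology\<close>

definition zero_set :: "('a::comm_ring_1 \<Rightarrow> 'a) list \<Rightarrow> nat \<Rightarrow> 'a dpoly set \<Rightarrow> 'a list set" where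
  "zero_set ds n E = {x. length x = n \<and> (\<forall>p\<in>E. dpoly_eval ds p x = 0)}"

definition differential_variety :: "('a::comm_ring_1 \<Rightarrow> 'a) list \<Rightarrow> nat \<Rightarrow> 'a list set \<Rightarrow> bool" where
  "differential_variety ds n X \<longleftrightarrow> (\<exists>I. differential_ideal ds n I \<and> X = zero_set ds n I)"

definition kolchin_space :: "('a::comm_ring_1 \<Rightarrow> 'a) list \<Rightarrow> nat \<Rightarrow> 'a list topology" where
  "kolchin_space ds n =
     topology (\<lambda>U. \<exists>E\<subseteq>dpolys ds n. U = {x. length x = n} - zero_set ds n E)"

definition kolchin :: "('a::comm_ring_1 \<Rightarrow> 'a) list \<Rightarrow> nat \<Rightarrow> 'a list set \<Rightarrow> 'a list topology" where
  "kolchin ds n X = subtopology (kolchin_space ds n) X"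


section \<open>Morphisms and differential algebraic groups\<close>

definition regular_function ::
  "('a::field \<Rightarrow> 'a) list \<Rightarrow> nat \<Rightarrow> 'a list set \<Rightarrow> ('a list \<Rightarrow> 'a) \<Rightarrow> bool" where
  "regular_function ds n X f \<longleftrightarrow>
     (\<forall>x\<in>X. \<exists>U. openin (kolchin ds n X) U \<and> x \<in> U \<and>
        (\<exists>P\<in>dpolys ds n. \<exists>Q\<in>dpolys ds n.
           \<forall>y\<in>U. dpoly_eval ds Q y \<noteq> 0 \<and> f y = dpoly_eval ds P y / dpoly_eval ds Q y))"

definition differential_morphism ::
  "('a::field \<Rightarrow> 'a) list \<Rightarrow> nat \<Rightarrow> 'a list set \<Rightarrow> nat \<Rightarrow> 'a list set \<Rightarrow> ('a list \<Rightarrow> 'a list) \<Rightarrow> bool" where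
  "differential_morphism ds n X m Y f \<longleftrightarrow>
     Y \<subseteq> {y. length y = m} \<and> f \<in> X \<rightarrow> Y \<and> (\<forall>i<m. regular_function ds n X (\<lambda>x. f x ! i))"

text \<open>\<open>x @ y\<close> is the point of \<open>K\<^sup>2\<^sup>n\<close> corresponding to a pair of points \<open>x\<close>, \<open>y\<close> of \<open>K\<^sup>n\<close>.\<close>

definition differential_algebraic_group ::
  "('a::field \<Rightarrow> 'a) list \<Rightarrow> nat \<Rightarrow> 'a list monoid \<Rightarrow> bool" where
  "differential_algebraic_group ds n G \<longleftrightarrow>
     group G \<and> differential_variety ds n (carrier G) \<and>
     differential_morphism ds (2 * n) {x @ y |x y. x \<in> carrier G \<and> y \<in> carrier G}
       n (carrier G) (\<lambda>z. take n z \<otimes>\<^bsub>G\<^esub> drop n z) \<and>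
     differential_morphism ds n (carrier G) n (carrier G) (\<lambda>x. inv\<^bsub>G\<^esub> x)"

definition differential_group_hom ::
  "('a::field \<Rightarrow> 'a) list \<Rightarrow> nat \<Rightarrow> 'a list monoid \<Rightarrow> nat \<Rightarrow> 'a list monoid \<Rightarrow>
     ('a list \<Rightarrow> 'a list) \<Rightarrow> bool" where
  "differential_group_hom ds n G m H \<phi> \<longleftrightarrow>
     \<phi> \<in> hom G H \<and> differential_morphism ds n (carrier G) m (carrier H) \<phi>"

definition dominant ::
  "('a::field \<Rightarrow> 'a) list \<Rightarrow> 'a list set \<Rightarrow> nat \<Rightarrow> 'a list set \<Rightarrow> ('a list \<Rightarrow> 'a list) \<Rightarrow> bool" where
  "dominant ds X m Y \<phi> \<longleftrightarrow> kolchin ds m Y closure_of (\<phi> ` X) = Y"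


section \<open>Basic facts\<close>

lemma dmonom_eval_superset:
  assumes "finite V" "Poly_Mapping.keys M \<subseteq> V"
  shows "dmonom_eval ds M x = (\<Prod>v\<in>V. dop ds (snd v) (x ! fst v) ^ Poly_Mapping.lookup M v)"
  unfolding dmonom_eval_def using assms
  by (intro prod.mono_neutral_left) (auto simp: in_keys_iff)

lemma dpoly_eval_superset:
  assumes "finite S" "Poly_Mapping.keys p \<subseteq> S"
  shows "dpoly_eval ds p x = (\<Sum>M\<in>S. Poly_Mapping.lookup p M * dmonom_eval ds M x)"
  unfolding dpoly_eval_def using assms
  by (intro sum.mono_neutral_left) (auto simp: in_keys_iff)

lemma dmonom_eval_add: "dmonom_eval ds (M + N) x = dmonom_eval ds M x * dmonom_eval ds N x"
proof -
  let ?V = "Poly_Mapping.keys M \<union> Poly_Mapping.keys N"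
  have "Poly_Mapping.keys (M + N) \<subseteq> ?V"
    by (rule keys_add)
  then show ?thesis
    by (simp add: dmonom_eval_superset[of ?V] lookup_add power_add prod.distrib)
qed

lemma dpoly_eval_add: "dpoly_eval ds (p + q) x = dpoly_eval ds p x + dpoly_eval ds q x"
proof -
  let ?S = "Poly_Mapping.keys p \<union> Poly_Mapping.keys q"
  have "Poly_Mapping.keys (p + q) \<subseteq> ?S"
    by (rule keys_add)
  then show ?thesis
    by (simp add: dpoly_eval_superset[of ?S] lookup_add distrib_right sum.distrib)
qed

lemma dpoly_eval_zero [simp]: "dpoly_eval ds 0 x = 0"
  by (simp add: dpoly_eval_def)

lemma dpoly_eval_one [simp]: "dpoly_eval ds 1 x = 1"
  by (simp add: dpoly_eval_def dmonom_eval_def)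

lemma dpoly_eval_single [simp]: "dpoly_eval ds (Poly_Mapping.single M c) x = c * dmonom_eval ds M x"
  by (simp add: dpoly_eval_def)

lemma dpoly_eval_sum: "dpoly_eval ds (\<Sum>i\<in>A. f i) x = (\<Sum>i\<in>A. dpoly_eval ds (f i) x)"
  by (induction A rule: infinite_finite_induct) (simp_all add: dpoly_eval_add)

lemma dpoly_sum_single:
  "(\<Sum>M\<in>Poly_Mapping.keys p. Poly_Mapping.single M (Poly_Mapping.lookup p M)) = p"
proof (rule poly_mapping_eqI)
  fix k
  show "Poly_Mapping.lookup (\<Sum>M\<in>Poly_Mapping.keys p. Poly_Mapping.single M (Poly_Mapping.lookup p M)) k =
    Poly_Mapping.lookup p k"
    by (cases "k \<in> Poly_Mapping.keys p")
      (auto simp: lookup_sum lookup_single when_def in_keys_iff)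
qed

lemma dpoly_eval_mult: "dpoly_eval ds (p * q) x = dpoly_eval ds p x * dpoly_eval ds q x"
proof -
  let ?s = "\<lambda>p M. Poly_Mapping.single M (Poly_Mapping.lookup p M)"
  have "p * q = (\<Sum>M\<in>Poly_Mapping.keys p. ?s p M) * (\<Sum>N\<in>Poly_Mapping.keys q. ?s q N)"
    by (simp only: dpoly_sum_single)
  also have "\<dots> = (\<Sum>M\<in>Poly_Mapping.keys p. \<Sum>N\<in>Poly_Mapping.keys q.
      Poly_Mapping.single (M + N) (Poly_Mapping.lookup p M * Poly_Mapping.lookup q N))"
    by (simp add: sum_product mult_single)
  finally show ?thesis
    by (simp add: dpoly_eval_sum dmonom_eval_add dpoly_eval_def[of ds p] dpoly_eval_def[of ds q]
        sum_product mult_ac)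
qed

lemma dpolys_mult:
  assumes "p \<in> dpolys ds n" "q \<in> dpolys ds n"
  shows "p * q \<in> dpolys ds n"
proof -
  have "fst v < n \<and> Poly_Mapping.keys (snd v) \<subseteq> {..<length ds}"
    if M: "M \<in> Poly_Mapping.keys (p * q)" and v: "v \<in> Poly_Mapping.keys M" for M v
  proof -
    from M obtain A B where AB: "M = A + B" "A \<in> Poly_Mapping.keys p" "B \<in> Poly_Mapping.keys q"
      using keys_mult[of p q] by blast
    with v have "v \<in> Poly_Mapping.keys A \<or> v \<in> Poly_Mapping.keys B"
      using keys_add[of A B] by blast
    with AB assms show ?thesis
      unfolding dpolys_def by blast
  qed
  then show ?thesis
    unfolding dpolys_def by blast
qed

lemma istopology_kolchin_space:
  fixes ds :: "('a::field \<Rightarrow> 'a) list"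
  shows "istopology (\<lambda>U. \<exists>E\<subseteq>dpolys ds n. U = {x. length x = n} - zero_set ds n E)"
proof -
  have inter: "\<exists>E\<subseteq>dpolys ds n.
      ({x. length x = n} - zero_set ds n E1) \<inter> ({x. length x = n} - zero_set ds n E2) =
      {x. length x = n} - zero_set ds n E"
    if "E1 \<subseteq> dpolys ds n" "E2 \<subseteq> dpolys ds n" for E1 E2
  proof (intro exI conjI)
    show "(\<lambda>(p, q). p * q) ` (E1 \<times> E2) \<subseteq> dpolys ds n"
      using that by (auto intro!: dpolys_mult)
    show "({x. length x = n} - zero_set ds n E1) \<inter> ({x. length x = n} - zero_set ds n E2) =
      {x. length x = n} - zero_set ds n ((\<lambda>(p, q). p * q) ` (E1 \<times> E2))"
      by (auto simp: zero_set_def dpoly_eval_mult)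
  qed
  have union: "\<exists>E\<subseteq>dpolys ds n. \<Union>\<U> = {x. length x = n} - zero_set ds n E"
    if "\<forall>U\<in>\<U>. \<exists>E\<subseteq>dpolys ds n. U = {x. length x = n} - zero_set ds n E" for \<U>
  proof (intro exI conjI)
    let ?E = "\<Union>{E. E \<subseteq> dpolys ds n \<and> {x. length x = n} - zero_set ds n E \<in> \<U>}"
    show "?E \<subseteq> dpolys ds n"
      by blast
    show "\<Union>\<U> = {x. length x = n} - zero_set ds n ?E"
    proof (intro equalityI subsetI)
      fix x assume "x \<in> \<Union>\<U>"
      then obtain U where U: "U \<in> \<U>" "x \<in> U" by blast
      with that obtain E where "E \<subseteq> dpolys ds n" "U = {x. length x = n} - zero_set ds n E"
        by blast
      with U show "x \<in> {x. length x = n} - zero_set ds n ?E"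
        by (auto simp: zero_set_def)
    next
      fix x assume "x \<in> {x. length x = n} - zero_set ds n ?E"
      then obtain E p where "E \<subseteq> dpolys ds n" "{x. length x = n} - zero_set ds n E \<in> \<U>"
        "length x = n" "p \<in> E" "dpoly_eval ds p x \<noteq> 0"
        by (auto simp: zero_set_def)
      then show "x \<in> \<Union>\<U>"
        by (intro UnionI[of "{x. length x = n} - zero_set ds n E"]) (auto simp: zero_set_def)
    qed
  qed
  show ?thesis
    unfolding istopology_def
  proof (intro conjI allI impI)
    fix S T
    assume "\<exists>E\<subseteq>dpolys ds n. S = {x. length x = n} - zero_set ds n E"
      and "\<exists>E\<subseteq>dpolys ds n. T = {x. length x = n} - zero_set ds n E"
    then show "\<exists>E\<subseteq>dpolys ds n. S \<inter> T = {x. length x = n} - zero_set ds n E"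
      by (elim exE conjE) (simp only: inter)
  next
    fix \<U>
    assume "\<forall>U\<in>\<U>. \<exists>E\<subseteq>dpolys ds n. U = {x. length x = n} - zero_set ds n E"
    then show "\<exists>E\<subseteq>dpolys ds n. \<Union>\<U> = {x. length x = n} - zero_set ds n E"
      by (rule union)
  qed
qed

lemma openin_kolchin_space:
  fixes ds :: "('a::field \<Rightarrow> 'a) list"
  shows "openin (kolchin_space ds n) U \<longleftrightarrow>
    (\<exists>E\<subseteq>dpolys ds n. U = {x. length x = n} - zero_set ds n E)"
  unfolding kolchin_space_def by (simp add: topology_inverse'[OF istopology_kolchin_space])

lemma topspace_kolchin_space [simp]:
  fixes ds :: "('a::field \<Rightarrow> 'a) list"
  shows "topspace (kolchin_space ds n) = {x. length x = n}"
proof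
  show "topspace (kolchin_space ds n) \<subseteq> {x. length x = n}"
    using openin_topspace[of "kolchin_space ds n"] unfolding openin_kolchin_space by blast
  have "1 \<in> dpolys ds n"
    by (simp add: dpolys_def)
  then have "openin (kolchin_space ds n) {x. length x = n}"
    unfolding openin_kolchin_space by (intro exI[of _ "{1}"]) (auto simp: zero_set_def)
  then show "{x. length x = n} \<subseteq> topspace (kolchin_space ds n)"
    by (rule openin_subset)
qed

lemma closedin_kolchin_space:
  fixes ds :: "('a::field \<Rightarrow> 'a) list"
  shows "closedin (kolchin_space ds n) C \<longleftrightarrow> (\<exists>E\<subseteq>dpolys ds n. C = zero_set ds n E)"
proof -
  have sub: "zero_set ds n E \<subseteq> {x. length x = n}" for E
    by (auto simp: zero_set_def)
  have "C \<subseteq> {x. length x = n} \<and> {x. length x = n} - C = {x. length x = n} - zero_set ds n E \<longleftrightarrow>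
      C = zero_set ds n E" for E
    using sub[of E] by blast
  then show ?thesis
    unfolding closedin_def openin_kolchin_space topspace_kolchin_space by blast
qed

lemma derivation_zero:
  assumes "derivation d"
  shows "d 0 = 0"
proof -
  have "d (0 + 0) = d 0 + d 0"
    using assms unfolding derivation_def by blast
  then show ?thesis by simp
qed

lemma derivation_one:
  assumes "derivation d"
  shows "d (1 :: 'a::ring_1) = 0"
proof -
  have "d (1 * 1) = d 1 * 1 + 1 * d 1"
    using assms unfolding derivation_def by blast
  then show ?thesis by simp
qed

lemma derivation_sum: "derivation d \<Longrightarrow> d (\<Sum>i\<in>A. f i) = (\<Sum>i\<in>A. d (f i))"
  by (induction A rule: infinite_finite_induct) (auto simp: derivation_zero derivation_def)

lemma derivation_power:
  fixes a :: "'a::comm_ring_1"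
  shows "derivation d \<Longrightarrow> d (a ^ k) = of_nat k * a ^ (k - 1) * d a"
proof (induction k)
  case (Suc k)
  then have "d (a ^ Suc k) = d a * a ^ k + a * (of_nat k * a ^ (k - 1) * d a)"
    by (simp add: derivation_def)
  then show ?case
    by (cases k) (simp_all add: algebra_simps)
qed (simp add: derivation_one)

lemma derivation_prod:
  fixes f :: "'i \<Rightarrow> 'a::comm_ring_1"
  assumes "derivation d" "finite A"
  shows "d (\<Prod>i\<in>A. f i) = (\<Sum>i\<in>A. d (f i) * (\<Prod>k\<in>A - {i}. f k))"
  using assms(2)
proof induction
  case (insert a A)
  have "(\<Prod>k\<in>insert a A - {i}. f k) = f a * (\<Prod>k\<in>A - {i}. f k)" if "i \<in> A" for i
  proof -
    from that insert have "insert a A - {i} = insert a (A - {i})" by auto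
    with insert show ?thesis by simp
  qed
  moreover have "insert a A - {a} = A"
    using insert by auto
  moreover have "d (f a * prod f A) = d (f a) * prod f A + f a * d (prod f A)"
    using assms(1) unfolding derivation_def by blast
  ultimately show ?case
    using insert by (simp add: sum_distrib_left mult_ac)
qed (simp add: derivation_one assms)

lemma dop_add_single:
  assumes "differential_field ds" "j < length ds"
  shows "dop ds (\<theta> + Poly_Mapping.single j 1) a = (ds ! j) (dop ds \<theta> a)"
proof -
  let ?f = "\<lambda>\<theta> xs. foldr (\<lambda>j. (ds ! j) ^^ Poly_Mapping.lookup \<theta> j) xs a"
  let ?\<eta> = "\<theta> + Poly_Mapping.single j 1"
  have comm: "((ds ! i) ^^ k) ((ds ! j) b) = (ds ! j) (((ds ! i) ^^ k) b)"
    if "i < length ds" for i k b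
  proof -
    have "(ds ! i) ((ds ! j) c) = (ds ! j) ((ds ! i) c)" for c
      using assms that nth_mem unfolding differential_field_def by blast
    then show ?thesis
      by (induction k) simp_all
  qed
  have "?f ?\<eta> xs = (if j \<in> set xs then (ds ! j) (?f \<theta> xs) else ?f \<theta> xs)"
    if "set xs \<subseteq> {..<length ds}" "distinct xs" for xs
    using that
  proof (induction xs)
    case (Cons i xs)
    then show ?case
      using comm by (auto simp: lookup_add lookup_single when_def)
  qed simp
  from this[of "[0..<length ds]"] assms(2) show ?thesis
    unfolding dop_def by (simp add: atLeast0LessThan)
qed

lemma dpoly_eval_deriv:
  assumes K: "differential_field ds" and j: "j < length ds"
  shows "dpoly_eval ds (dpoly_deriv ds j p) x = (ds ! j) (dpoly_eval ds p x)"
proof -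
  let ?d = "ds ! j"
  have d: "derivation ?d"
    using K j by (auto simp: differential_field_def)
  let ?y = "\<lambda>v. dop ds (snd v) (x ! fst v)"
  let ?w = "\<lambda>v. (fst v, snd v + Poly_Mapping.single j 1)"
  have mon: "?d (dmonom_eval ds M x) = (\<Sum>v\<in>Poly_Mapping.keys M.
      of_nat (Poly_Mapping.lookup M v) *
      dmonom_eval ds (M - Poly_Mapping.single v 1 + Poly_Mapping.single (?w v) 1) x)" for M
  proof -
    have "dmonom_eval ds (M - Poly_Mapping.single v 1 + Poly_Mapping.single (?w v) 1) x =
        ?y v ^ (Poly_Mapping.lookup M v - 1) * ?d (?y v) *
        (\<Prod>u\<in>Poly_Mapping.keys M - {v}. ?y u ^ Poly_Mapping.lookup M u)"
      if v: "v \<in> Poly_Mapping.keys M" for v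
    proof -
      have "Poly_Mapping.keys (M - Poly_Mapping.single v 1) \<subseteq> Poly_Mapping.keys M"
        by (auto simp: in_keys_iff lookup_minus)
      then have "dmonom_eval ds (M - Poly_Mapping.single v 1) x =
          ?y v ^ (Poly_Mapping.lookup M v - 1) *
          (\<Prod>u\<in>Poly_Mapping.keys M - {v}. ?y u ^ Poly_Mapping.lookup (M - Poly_Mapping.single v 1) u)"
        using prod.remove[OF finite_keys v,
            of "\<lambda>u. ?y u ^ Poly_Mapping.lookup (M - Poly_Mapping.single v 1) u"]
        by (simp add: dmonom_eval_superset[of "Poly_Mapping.keys M"] lookup_minus)
      also have "(\<Prod>u\<in>Poly_Mapping.keys M - {v}. ?y u ^ Poly_Mapping.lookup (M - Poly_Mapping.single v 1) u) =
          (\<Prod>u\<in>Poly_Mapping.keys M - {v}. ?y u ^ Poly_Mapping.lookup M u)"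
        by (intro prod.cong) (auto simp: lookup_minus lookup_single when_def)
      moreover have "dmonom_eval ds (Poly_Mapping.single (?w v) 1) x = ?d (?y v)"
        using dop_add_single[OF K j] by (simp add: dmonom_eval_def)
      ultimately show ?thesis
        by (simp only: dmonom_eval_add mult_ac)
    qed
    moreover have "?d (dmonom_eval ds M x) = (\<Sum>v\<in>Poly_Mapping.keys M.
        of_nat (Poly_Mapping.lookup M v) * (?y v ^ (Poly_Mapping.lookup M v - 1) * ?d (?y v) *
        (\<Prod>u\<in>Poly_Mapping.keys M - {v}. ?y u ^ Poly_Mapping.lookup M u)))"
      unfolding dmonom_eval_def derivation_prod[OF d finite_keys] derivation_power[OF d]
      by (simp only: mult.assoc)
    ultimately show ?thesis
      by simp
  qed
  have mult: "?d (a * b) = ?d a * b + a * ?d b" for a b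
    using d by (simp add: derivation_def)
  have "?d (dpoly_eval ds p x) = (\<Sum>M\<in>Poly_Mapping.keys p.
      ?d (Poly_Mapping.lookup p M) * dmonom_eval ds M x +
      Poly_Mapping.lookup p M * ?d (dmonom_eval ds M x))"
    by (simp only: dpoly_eval_def derivation_sum[OF d] mult)
  also have "\<dots> = dpoly_eval ds (dpoly_deriv ds j p) x"
    unfolding dpoly_deriv_def dpoly_eval_sum dpoly_eval_add dpoly_eval_single mon sum_distrib_left
    by (simp only: mult_ac)
  finally show ?thesis ..
qed

subsection \<open>Independence of the type of the extension\<close>

inductive_set dfield_gen :: "('b, 'c) ring_scheme \<Rightarrow> ('b \<Rightarrow> 'b) list \<Rightarrow> 'b set \<Rightarrow> 'b set"
  for L es B where
  base: "b \<in> B \<Longrightarrow> b \<in> dfield_gen L es B"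
| neg: "a \<in> dfield_gen L es B \<Longrightarrow> \<ominus>\<^bsub>L\<^esub> a \<in> dfield_gen L es B"
| inv: "a \<in> dfield_gen L es B \<Longrightarrow> a \<noteq> \<zero>\<^bsub>L\<^esub> \<Longrightarrow> inv\<^bsub>L\<^esub> a \<in> dfield_gen L es B"
| deriv: "a \<in> dfield_gen L es B \<Longrightarrow> d \<in> set es \<Longrightarrow> d a \<in> dfield_gen L es B"
| add: "a \<in> dfield_gen L es B \<Longrightarrow> b \<in> dfield_gen L es B \<Longrightarrow> a \<oplus>\<^bsub>L\<^esub> b \<in> dfield_gen L es B"
| mult: "a \<in> dfield_gen L es B \<Longrightarrow> b \<in> dfield_gen L es B \<Longrightarrow> a \<otimes>\<^bsub>L\<^esub> b \<in> dfield_gen L es B"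

lemma dfield_gen_subset:
  assumes "differential_field_on L es" "B \<subseteq> carrier L"
  shows "dfield_gen L es B \<subseteq> carrier L"
proof
  interpret field L
    using assms by (simp add: differential_field_on_def)
  fix a assume "a \<in> dfield_gen L es B"
  then show "a \<in> carrier L"
  proof induction
    case (inv a)
    then show ?case
      using field_Units by blast
  next
    case (deriv a d)
    then show ?case
      using assms by (auto simp: differential_field_on_def derivation_on_def)
  qed (use assms in auto)
qed

lemma dfield_gen_subfield:
  assumes "differential_field_on L es" "B \<subseteq> carrier L" "\<one>\<^bsub>L\<^esub> \<in> B"
  shows "subfield (dfield_gen L es B) L"
proof -
  interpret field L
    using assms by (simp add: differential_field_on_def)
  have "subring (dfield_gen L es B) L"
    using dfield_gen_subset[OF assms(1,2)] assms(3)
    by (intro subringI) (auto intro: dfield_gen.intros)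
  then show ?thesis
    by (rule subfieldI') (auto intro: dfield_gen.intros)
qed

lemma dfield_gen_inj:
  fixes B :: "'b set"
  assumes inf: "infinite (UNIV :: 'a set)" and "\<exists>f :: 'b \<Rightarrow> 'a. inj_on f B"
  shows "\<exists>f :: 'b \<Rightarrow> 'a. inj_on f (dfield_gen L es B)"
proof -
  let ?small = "\<lambda>A :: 'b set. (card_of A, card_of (UNIV :: 'a set)) \<in> ordLeq"
  define step where "step = (\<lambda>A. A \<union> a_inv L ` A \<union> m_inv L ` A \<union> (\<Union>d\<in>set es. d ` A) \<union>
    (\<lambda>(a, b). a \<oplus>\<^bsub>L\<^esub> b) ` (A \<times> A) \<union> (\<lambda>(a, b). a \<otimes>\<^bsub>L\<^esub> b) ` (A \<times> A))"
  have Un: "?small (A \<union> A')" if "?small A" "?small A'" for A A'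
    by (rule card_of_Un_ordLeq_infinite_Field)
      (simp_all add: inf that Field_card_of card_of_Card_order card_of_card_order_on)
  have Times: "(card_of (A \<times> A), card_of (UNIV :: 'a set)) \<in> ordLeq" if "?small A" for A
    by (rule card_of_Times_ordLeq_infinite_Field)
      (simp_all add: inf that Field_card_of card_of_Card_order card_of_card_order_on)
  have img: "?small (g ` C)" if "(card_of C, card_of (UNIV :: 'a set)) \<in> ordLeq" for g and C :: "'x set"
    using card_of_image that by (rule ordLeq_transitive)
  have UN: "?small (\<Union>i\<in>I. F i)"
    if "(card_of I, card_of (UNIV :: 'a set)) \<in> ordLeq" "\<And>i. ?small (F i)" for F and I :: "'x set"
    using that inf by (intro card_of_UNION_ordLeq_infinite) auto
  have nat: "(card_of (UNIV :: nat set), card_of (UNIV :: 'a set)) \<in> ordLeq"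
    using inf infinite_iff_card_of_nat by blast
  have step: "?small (step A)" if "?small A" for A
  proof -
    have "(card_of (set es), card_of (UNIV :: 'a set)) \<in> ordLeq"
      using inf by (intro ordLess_imp_ordLeq finite_ordLess_infinite)
        (auto simp: Field_card_of card_of_well_order_on)
    then show ?thesis
      unfolding step_def using that by (intro Un img UN Times)
  qed
  have "?small B"
    using assms(2) card_of_ordLeq[of B "UNIV :: 'a set"] by auto
  then have "?small ((step ^^ k) B)" for k
    by (induction k) (auto intro: step)
  then have small: "?small (\<Union>k. (step ^^ k) B)"
    by (intro UN nat)
  have mono: "(step ^^ k) B \<subseteq> (step ^^ l) B" if "k \<le> l" for k l
    using that by (rule lift_Suc_mono_le[rotated]) (auto simp: step_def)
  have "a \<in> (\<Union>k. (step ^^ k) B)" if "a \<in> dfield_gen L es B" for a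
    using that
  proof induction
    case (base b)
    then show ?case by (intro UN_I[of 0]) auto
  next
    case (neg a)
    then obtain k where "a \<in> (step ^^ k) B" by blast
    then show ?case by (intro UN_I[of "Suc k"]) (auto simp: step_def)
  next
    case (inv a)
    then obtain k where "a \<in> (step ^^ k) B" by blast
    then show ?case by (intro UN_I[of "Suc k"]) (auto simp: step_def)
  next
    case (deriv a d)
    then obtain k where "a \<in> (step ^^ k) B" by blast
    with deriv show ?case by (intro UN_I[of "Suc k"]) (auto simp: step_def)
  next
    case (add a b)
    then obtain k l where "a \<in> (step ^^ k) B" "b \<in> (step ^^ l) B" by blast
    then have "a \<in> (step ^^ max k l) B" "b \<in> (step ^^ max k l) B"
      using mono[of k "max k l"] mono[of l "max k l"] by auto
    then show ?case by (intro UN_I[of "Suc (max k l)"]) (auto simp: step_def)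
  next
    case (mult a b)
    then obtain k l where "a \<in> (step ^^ k) B" "b \<in> (step ^^ l) B" by blast
    then have "a \<in> (step ^^ max k l) B" "b \<in> (step ^^ max k l) B"
      using mono[of k "max k l"] mono[of l "max k l"] by auto
    then show ?case by (intro UN_I[of "Suc (max k l)"]) (auto simp: step_def)
  qed
  then have "dfield_gen L es B \<subseteq> (\<Union>k. (step ^^ k) B)" by blast
  then have "?small (dfield_gen L es B)"
    using card_of_mono1 small ordLeq_transitive by blast
  then show ?thesis
    using card_of_ordLeq[of "dfield_gen L es B" "UNIV :: 'a set"] by auto
qed

lemma dpoly_eval_on_hom:
  assumes L: "cring L" and M: "cring M" and h: "h \<in> ring_hom L M"
    and len: "length fs = length es"
    and es: "\<And>d. d \<in> set es \<Longrightarrow> d \<in> carrier L \<rightarrow> carrier L"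
    and comm: "\<And>j a. j < length es \<Longrightarrow> a \<in> carrier L \<Longrightarrow> h ((es ! j) a) = (fs ! j) (h a)"
    and e: "\<And>a. e a \<in> carrier L"
    and x: "length x = n" "set x \<subseteq> carrier L"
    and p: "p \<in> dpolys ds n"
  shows "dpoly_eval_on L es e p x \<in> carrier L"
    and "dpoly_eval_on M fs (\<lambda>a. h (e a)) p (map h x) = h (dpoly_eval_on L es e p x)"
proof -
  interpret ring_hom_cring L M h
    using L M h by (simp add: ring_hom_cring_def ring_hom_cring_axioms_def)
  have hom_pow: "h (a [^]\<^bsub>L\<^esub> k) = h a [^]\<^bsub>M\<^esub> k" if "a \<in> carrier L" for a and k :: nat
    using that by (induction k) simp_all
  have pow: "((es ! j) ^^ k) a \<in> carrier L \<and> h (((es ! j) ^^ k) a) = ((fs ! j) ^^ k) (h a)"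
    if "j < length es" "a \<in> carrier L" for j k a
  proof (induction k)
    case (Suc k)
    then show ?case
      using that es[of "es ! j"] comm by (auto simp: Pi_iff)
  qed (use that in simp)
  have dop: "dop es \<theta> a \<in> carrier L \<and> h (dop es \<theta> a) = dop fs \<theta> (h a)"
    if a: "a \<in> carrier L" for \<theta> a
  proof -
    have "foldr (\<lambda>j. (es ! j) ^^ Poly_Mapping.lookup \<theta> j) js a \<in> carrier L \<and>
        h (foldr (\<lambda>j. (es ! j) ^^ Poly_Mapping.lookup \<theta> j) js a) =
          foldr (\<lambda>j. (fs ! j) ^^ Poly_Mapping.lookup \<theta> j) js (h a)"
      if "set js \<subseteq> {..<length es}" for js
      using that by (induction js) (use a pow in auto)
    from this[of "[0..<length es]"] show ?thesis
      by (simp add: dop_def len atLeast0LessThan)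
  qed
  have var: "dop es (snd v) (x ! fst v) \<in> carrier L \<and>
      dop fs (snd v) (map h x ! fst v) = h (dop es (snd v) (x ! fst v))"
    if "K \<in> Poly_Mapping.keys p" "v \<in> Poly_Mapping.keys K" for K v
  proof -
    have "fst v < length x"
      using that p x by (auto simp: dpolys_def)
    moreover from this have "x ! fst v \<in> carrier L"
      using x(2) nth_mem by blast
    ultimately show ?thesis
      using dop[of "x ! fst v" "snd v"] by simp
  qed
  let ?m = "\<lambda>K. \<Otimes>\<^bsub>L\<^esub>v\<in>Poly_Mapping.keys K. dop es (snd v) (x ! fst v) [^]\<^bsub>L\<^esub> Poly_Mapping.lookup K v"
  let ?m' = "\<lambda>K. \<Otimes>\<^bsub>M\<^esub>v\<in>Poly_Mapping.keys K. dop fs (snd v) (map h x ! fst v) [^]\<^bsub>M\<^esub> Poly_Mapping.lookup K v"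
  have mon: "?m K \<in> carrier L \<and> ?m' K = h (?m K)" if K: "K \<in> Poly_Mapping.keys p" for K
  proof
    have mem: "(\<lambda>v. dop es (snd v) (x ! fst v) [^]\<^bsub>L\<^esub> Poly_Mapping.lookup K v)
        \<in> Poly_Mapping.keys K \<rightarrow> carrier L"
      using var[OF K] by (auto intro!: R.nat_pow_closed)
    then show "?m K \<in> carrier L"
      by (rule R.finprod_closed)
    have "h (?m K) = (\<Otimes>\<^bsub>M\<^esub>v\<in>Poly_Mapping.keys K. (h \<circ> (\<lambda>v. dop es (snd v) (x ! fst v) [^]\<^bsub>L\<^esub> Poly_Mapping.lookup K v)) v)"
      using hom_finprod[OF mem] by (simp add: o_def)
    also have "\<dots> = ?m' K"
      using var[OF K] by (intro S.finprod_cong') (auto simp: hom_pow)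
    finally show "?m' K = h (?m K)" ..
  qed
  have mem: "(\<lambda>K. e (Poly_Mapping.lookup p K) \<otimes>\<^bsub>L\<^esub> ?m K) \<in> Poly_Mapping.keys p \<rightarrow> carrier L"
    using mon e by auto
  show "dpoly_eval_on L es e p x \<in> carrier L"
    unfolding dpoly_eval_on_def using mem by (rule R.finsum_closed)
  have "h (dpoly_eval_on L es e p x) =
      (\<Oplus>\<^bsub>M\<^esub>K\<in>Poly_Mapping.keys p. (h \<circ> (\<lambda>K. e (Poly_Mapping.lookup p K) \<otimes>\<^bsub>L\<^esub> ?m K)) K)"
    unfolding dpoly_eval_on_def using hom_finsum[OF mem] by (simp add: o_def)
  also have "\<dots> = dpoly_eval_on M fs (\<lambda>a. h (e a)) p (map h x)"
    unfolding dpoly_eval_on_def using mon e by (intro S.finsum_cong') auto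
  finally show "dpoly_eval_on M fs (\<lambda>a. h (e a)) p (map h x) = h (dpoly_eval_on L es e p x)" ..
qed

theorem differentially_closed_imp_solution:
  fixes ds :: "('a::field_char_0 \<Rightarrow> 'a) list" and L :: "('b, 'c) ring_scheme"
  assumes closed: "differentially_closed ds"
    and ext: "differential_extension ds L es e"
    and sol: "solution_on L es e n E N x"
    and sys: "finite E" "finite N" "E \<subseteq> dpolys ds n" "N \<subseteq> dpolys ds n"
  shows "\<exists>x. solution ds n E N x"
proof -
  have L: "differential_field_on L es" and len: "length es = length ds"
    and e: "e \<in> ring_hom field_record L"
    and comm: "\<And>j a. j < length ds \<Longrightarrow> e ((ds ! j) a) = (es ! j) (e a)"
    using ext by (auto simp: differential_extension_def)
  have x: "length x = n" "set x \<subseteq> carrier L"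
    using sol by (auto simp: solution_on_def)
  interpret L: field L
    using L by (simp add: differential_field_on_def)
  have carr: "carrier (field_record :: 'a ring) = UNIV"
    by (simp add: field_record_def)
  define B where "B = range e \<union> set x"
  define S where "S = dfield_gen L es B"
  define M where "M = L\<lparr>carrier := S\<rparr>"
  have inf: "infinite (UNIV :: 'a set)"
    by (rule infinite_UNIV_char_0)
  have B: "B \<subseteq> carrier L" "\<one>\<^bsub>L\<^esub> \<in> B" "B \<subseteq> S"
  proof -
    show "B \<subseteq> carrier L"
      using ring_hom_closed[OF e] x by (auto simp: B_def carr)
    have "e 1 = \<one>\<^bsub>L\<^esub>"
      using ring_hom_one[OF e] by (simp add: field_record_def)
    then show "\<one>\<^bsub>L\<^esub> \<in> B"
      unfolding B_def by (metis UnI1 rangeI)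
    show "B \<subseteq> S"
      by (auto simp: S_def intro: dfield_gen.base)
  qed
  have "(card_of B, card_of (UNIV :: 'a set)) \<in> ordLeq"
    unfolding B_def
  proof (rule card_of_Un_ordLeq_infinite_Field)
    show "(card_of (set x), card_of (UNIV :: 'a set)) \<in> ordLeq"
      using inf by (intro ordLess_imp_ordLeq finite_ordLess_infinite)
        (auto simp: Field_card_of card_of_well_order_on)
  qed (simp_all add: inf Field_card_of card_of_Card_order card_of_card_order_on card_of_image)
  then have "\<exists>f :: 'b \<Rightarrow> 'a. inj_on f B"
    using card_of_ordLeq[of B "UNIV :: 'a set"] by auto
  then obtain f :: "'b \<Rightarrow> 'a" where f: "inj_on f S"
    using dfield_gen_inj[OF inf] unfolding S_def by blast
  have S: "subfield S L"
    unfolding S_def using L B(1,2) by (rule dfield_gen_subfield)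
  have SL: "S \<subseteq> carrier L"
    using S by (rule subfieldE(3))
  have M: "field M" "carrier M = S"
    using L.subfield_iff(2)[OF S] by (simp_all add: M_def)
  have dS: "d a \<in> S" if "d \<in> set es" "a \<in> S" for d a
    using that unfolding S_def by (rule dfield_gen.deriv[rotated])
  define L' :: "'a ring" where "L' = image_ring f M"
  have L': "field L'"
    using field.inj_imp_image_ring_is_field[OF M(1)] f M(2) by (simp add: L'_def)
  have "f \<in> ring_iso M L'"
    using inj_imp_image_ring_iso[of f M] f M(2) by (simp add: L'_def)
  then have fhom: "f \<in> ring_hom M L'" and fcarr: "f ` S = carrier L'"
    using M(2) by (auto simp: ring_iso_def bij_betw_def)
  have fadd: "f a \<oplus>\<^bsub>L'\<^esub> f b = f (a \<oplus>\<^bsub>L\<^esub> b)" and fmult: "f a \<otimes>\<^bsub>L'\<^esub> f b = f (a \<otimes>\<^bsub>L\<^esub> b)"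
    if "a \<in> S" "b \<in> S" for a b
    using ring_hom_add[OF fhom] ring_hom_mult[OF fhom] that M(2) by (simp_all add: M_def)
  define g where "g = (\<lambda>d a. f (d (inv_into S f a)))"
  have g: "g d (f a) = f (d a)" if "a \<in> S" for d a
    using that f by (simp add: g_def)
  have Sclosed: "a \<oplus>\<^bsub>L\<^esub> b \<in> S" "a \<otimes>\<^bsub>L\<^esub> b \<in> S" if "a \<in> S" "b \<in> S" for a b
    using that unfolding S_def by (auto intro: dfield_gen.intros)
  have der: "derivation_on L' (g d)" if d: "d \<in> set es" for d
  proof -
    have dd: "derivation_on L d"
      using L d by (simp add: differential_field_on_def)
    show ?thesis
      unfolding derivation_on_def fcarr[symmetric]
    proof (intro conjI ballI funcsetI)
      fix y assume "y \<in> f ` S"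
      then show "g d y \<in> f ` S"
        using g dS[OF d] by auto
    next
      fix y z assume "y \<in> f ` S" "z \<in> f ` S"
      then obtain a b where ab: "a \<in> S" "b \<in> S" "y = f a" "z = f b" by blast
      then have "a \<in> carrier L" "b \<in> carrier L" using SL by auto
      with dd have "d (a \<oplus>\<^bsub>L\<^esub> b) = d a \<oplus>\<^bsub>L\<^esub> d b"
        "d (a \<otimes>\<^bsub>L\<^esub> b) = d a \<otimes>\<^bsub>L\<^esub> b \<oplus>\<^bsub>L\<^esub> a \<otimes>\<^bsub>L\<^esub> d b"
        by (simp_all add: derivation_on_def)
      with ab show "g d (y \<oplus>\<^bsub>L'\<^esub> z) = g d y \<oplus>\<^bsub>L'\<^esub> g d z"
        and "g d (y \<otimes>\<^bsub>L'\<^esub> z) = g d y \<otimes>\<^bsub>L'\<^esub> z \<oplus>\<^bsub>L'\<^esub> y \<otimes>\<^bsub>L'\<^esub> g d z"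
        using dS[OF d] by (simp_all add: g fadd fmult Sclosed)
    qed
  qed
  have dcomm: "g d (g d' y) = g d' (g d y)"
    if "d \<in> set es" "d' \<in> set es" "y \<in> carrier L'" for d d' y
  proof -
    from that(3) obtain a where a: "a \<in> S" "y = f a"
      using fcarr by blast
    then have "d (d' a) = d' (d a)"
      using L that SL by (auto simp: differential_field_on_def)
    with a that show ?thesis
      by (simp add: g dS)
  qed
  have L'field: "differential_field_on L' (map g es)"
    using L' der dcomm by (auto simp: differential_field_on_def)
  have eS: "e a \<in> S" for a
    using B(3) by (auto simp: B_def)
  have "e \<in> ring_hom field_record M"
    using e eS by (auto simp: ring_hom_def M_def)
  then have e'hom: "(\<lambda>a. f (e a)) \<in> ring_hom field_record L'"
    using ring_hom_trans[OF _ fhom, of e field_record] by (simp add: o_def)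
  have ext': "differential_extension ds L' (map g es) (\<lambda>a. f (e a))"
    unfolding differential_extension_def
    using L'field len e'hom comm eS by (simp add: g)
  have xS: "set x \<subseteq> S"
    using B(3) by (auto simp: B_def)
  have cr: "cring L" "cring M" "cring L'"
    using L.field_axioms M(1) L' by (auto dest: fieldE(1))
  have idhom: "id \<in> ring_hom M L"
    using SL by (auto simp: ring_hom_def M_def)
  have ev: "dpoly_eval_on M es e p x \<in> S"
    "dpoly_eval_on L es e p x = dpoly_eval_on M es e p x"
    "dpoly_eval_on L' (map g es) (\<lambda>a. f (e a)) p (map f x) = f (dpoly_eval_on M es e p x)"
    if p: "p \<in> dpolys ds n" for p
  proof -
    have M_es: "d \<in> carrier M \<rightarrow> carrier M" if "d \<in> set es" for d
      using dS that by (simp add: M)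
    have eM: "e a \<in> carrier M" for a
      using eS by (simp add: M)
    have xM: "set x \<subseteq> carrier M"
      using xS by (simp add: M)
    show "dpoly_eval_on M es e p x \<in> S"
      using dpoly_eval_on_hom(1)[OF cr(2,1) idhom refl M_es _ eM x(1) xM p] by (simp add: M)
    show "dpoly_eval_on L es e p x = dpoly_eval_on M es e p x"
      using dpoly_eval_on_hom(2)[OF cr(2,1) idhom refl M_es _ eM x(1) xM p] by simp
    show "dpoly_eval_on L' (map g es) (\<lambda>a. f (e a)) p (map f x) = f (dpoly_eval_on M es e p x)"
      by (rule dpoly_eval_on_hom(2)[OF cr(2,3) fhom _ M_es _ eM x(1) xM p])
        (simp_all add: g M)
  qed
  have "f \<zero>\<^bsub>L\<^esub> = \<zero>\<^bsub>L'\<^esub>"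
    by (simp add: L'_def image_ring_zero M_def)
  moreover have "\<zero>\<^bsub>L\<^esub> \<in> S"
    using L.subfield_iff(2)[OF S] ring.ring_simprules(2)[OF cring.axioms(1)[OF cr(2)]]
    by (simp add: M_def)
  ultimately have zero: "f a = \<zero>\<^bsub>L'\<^esub> \<longleftrightarrow> a = \<zero>\<^bsub>L\<^esub>" if "a \<in> S" for a
    using that inj_on_eq_iff[OF f, of a "\<zero>\<^bsub>L\<^esub>"] by simp
  have "solution_on L' (map g es) (\<lambda>a. f (e a)) n E N (map f x)"
    unfolding solution_on_def
  proof (intro conjI ballI)
    show "set (map f x) \<subseteq> carrier L'"
      using xS fcarr by auto
  next
    fix p assume p: "p \<in> E"
    then have "p \<in> dpolys ds n" using sys by blast
    moreover have "dpoly_eval_on L es e p x = \<zero>\<^bsub>L\<^esub>"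
      using sol p unfolding solution_on_def by blast
    ultimately show "dpoly_eval_on L' (map g es) (\<lambda>a. f (e a)) p (map f x) = \<zero>\<^bsub>L'\<^esub>"
      using ev[of p] zero[of "dpoly_eval_on M es e p x"] by metis
  next
    fix p assume p: "p \<in> N"
    then have "p \<in> dpolys ds n" using sys by blast
    moreover have "dpoly_eval_on L es e p x \<noteq> \<zero>\<^bsub>L\<^esub>"
      using sol p unfolding solution_on_def by blast
    ultimately show "dpoly_eval_on L' (map g es) (\<lambda>a. f (e a)) p (map f x) \<noteq> \<zero>\<^bsub>L'\<^esub>"
      using ev[of p] zero[of "dpoly_eval_on M es e p x"] by metis
  qed (use x in simp)
  with ext' have "\<exists>(L :: 'a ring) es e x. differential_extension ds L es e \<and> solution_on L es e n E N x"
    by (intro exI conjI)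
  with sys closed[unfolded differentially_closed_def, rule_format, of E N n] show ?thesis
    by simp
qed

end

theory Submission
  imports Defs "HOL-Algebra.Algebraic_Closure_Type" "HOL-Library.Product_Lexorder"
begin

text \<open>
  By translation it suffices to find one point at which \<open>\<phi>\<close> is open: then \<open>\<phi>\<close> is open, and its image is
  an open dense subgroup, hence everything. On a small irreducible open subset of \<open>G\<close> the map is given by
  quotients of differential polynomials and is the projection of its graph. So let \<open>P\<close> be a prime
  differential ideal of \<open>K{y, x}\<close>, and project its zeros to the coordinates \<open>y\<close>.

  A characteristic set of \<open>P\<close> over \<open>K{y}\<close> yields some \<open>h \<notin> P\<close> after whose inversion the residue ring arises
  by adjoining one derivative of the \<open>x\<close> at a time, each of them either free or a root of a polynomial with
  invertible initial and separant. If \<open>b h\<close> does not vanish at a zero of \<open>P\<close>, passing to coefficients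
  gives \<open>c \<in> K{y}\<close>, not vanishing there either, such that every zero \<open>y\<close> of \<open>P \<inter> K{y}\<close> with \<open>c(y) \<noteq> 0\<close>
  extends to a zero of \<open>P\<close> with \<open>b h \<noteq> 0\<close> in the algebraic closure, if the derivations are ignored.
  Therefore no power of \<open>b h\<close> lies in the differential ideal of the fibre over \<open>y\<close>, some prime differential
  ideal above it does not contain \<open>b h\<close>, and as \<open>K\<close> is differentially closed, the latter has a zero in \<open>K\<close>
  with \<open>b h \<noteq> 0\<close>.
\<close>

\<comment> \<open>The obstacle is that \<open>K\<close> solves only finite systems, whereas a fibre
  imposes infinitely many conditions linking derivatives of all orders. What tames both is that
  \<open>P\<close> is a differential ideal. A relation at a leader, once differentiated, has degree
  one with the old separant as its initial, so a single \<open>h\<close> serves all orders. And the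
  plain ideal generated by \<open>P\<close> and the differences between the derivatives of the
  \<open>y\<close> and their values is already closed under the derivations; that it contains no
  power of \<open>b h\<close> is a matter of commutative algebra, shown by assigning values to no
  more derivatives than occur in a given identity.

  Openness at a point demands that \<open>c\<close> be nonzero at that very point. Multiplying
  \<open>c\<close> by a discriminant, which may vanish there, is therefore not allowed; this is why
  remainders are taken of \<open>b\<close> times the separant.

  \<open>G\<close> and \<open>H\<close> are reducible in general. Finiteness for zero sets supplies
  both the irreducible open subset and the finite cover of \<open>G\<close> by translates.\<close>
alias keys = Poly_Mapping.keys
alias lookup = Poly_Mapping.lookup
alias single = Poly_Mapping.single
alias coeff = Polynomial.coeff
alias degree = Polynomial.degree
alias lead_coeff = Polynomial.lead_coeff
alias smult = Polynomial.smult
alias monom = Polynomial.monom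
alias pCons = Polynomial.pCons

section \<open>The ring of differential polynomials\<close>

text \<open>An arbitrary set of derivatives is allowed because a characteristic set adjoins them one
  at a time: the polynomials in an initial segment of a ranking are in general not of the form
  \<open>dpolys ds n\<close>.\<close>

definition polys_in :: "dvar set \<Rightarrow> 'a::zero dpoly set" where
  "polys_in U = {p. \<forall>M\<in>keys p. keys M \<subseteq> U}"

definition pconst :: "'a::zero \<Rightarrow> 'a dpoly" where
  "pconst c = single 0 c"

definition pvar :: "dvar \<Rightarrow> 'a::zero_neq_one dpoly" where
  "pvar v = single (single v 1) 1"

definition dvars :: "nat \<Rightarrow> nat \<Rightarrow> dvar set" where
  "dvars k n = {v. fst v < n \<and> keys (snd v) \<subseteq> {..<k}}"

definition shift :: "nat \<Rightarrow> dvar \<Rightarrow> dvar" where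
  "shift j v = (fst v, snd v + single j 1)"

lemma dpolys_eq: "dpolys ds n = polys_in (dvars (length ds) n)"
  by (auto simp: dpolys_def polys_in_def dvars_def)

lemma polys_in_mono: "U \<subseteq> W \<Longrightarrow> polys_in U \<subseteq> polys_in W"
  unfolding polys_in_def by blast

lemma polys_in_zero [simp]: "0 \<in> polys_in U"
  by (simp add: polys_in_def)

lemma polys_in_one [simp]: "1 \<in> polys_in U"
  by (simp add: polys_in_def)

lemma polys_in_const [simp]: "pconst c \<in> polys_in U"
  by (simp add: polys_in_def pconst_def)

lemma polys_in_pvar: "v \<in> U \<Longrightarrow> (pvar v :: 'a::zero_neq_one dpoly) \<in> polys_in U"
  by (simp add: polys_in_def pvar_def)

lemma polys_in_add: "p \<in> polys_in U \<Longrightarrow> q \<in> polys_in U \<Longrightarrow> p + q \<in> polys_in U"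
  using keys_add[of p q] unfolding polys_in_def by blast

lemma polys_in_mult:
  fixes p q :: "'a::comm_ring_1 dpoly"
  assumes "p \<in> polys_in U" "q \<in> polys_in U"
  shows "p * q \<in> polys_in U"
proof -
  have "keys M \<subseteq> U" if "M \<in> keys (p * q)" for M
  proof -
    from that obtain A B where "M = A + B" "A \<in> keys p" "B \<in> keys q"
      using keys_mult[of p q] by blast
    then show ?thesis
      using assms keys_add[of A B] unfolding polys_in_def by blast
  qed
  then show ?thesis by (simp add: polys_in_def)
qed

lemma polys_in_uminus: "p \<in> polys_in U \<Longrightarrow> - p \<in> polys_in U"
  for p :: "'a::comm_ring_1 dpoly"
  by (auto simp: polys_in_def in_keys_iff)

lemma polys_in_diff: "p \<in> polys_in U \<Longrightarrow> q \<in> polys_in U \<Longrightarrow> p - q \<in> polys_in U"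
  for p :: "'a::comm_ring_1 dpoly"
  using polys_in_add[of p U "- q"] polys_in_uminus[of q U] by simp

lemma polys_in_sum: "(\<And>i. i \<in> A \<Longrightarrow> f i \<in> polys_in U) \<Longrightarrow> sum f A \<in> polys_in U"
  by (induction A rule: infinite_finite_induct) (simp_all add: polys_in_add)

lemma polys_in_power: "p \<in> polys_in U \<Longrightarrow> p ^ k \<in> polys_in U"
  for p :: "'a::comm_ring_1 dpoly"
  by (induction k) (simp_all add: polys_in_mult)

lemma polys_in_of_nat [simp]: "(of_nat k :: 'a::comm_ring_1 dpoly) \<in> polys_in U"
  by (induction k) (simp_all add: polys_in_add)

lemma polys_in_single: "keys M \<subseteq> U \<Longrightarrow> single M c \<in> polys_in U"
  by (simp add: polys_in_def)

lemma pconst_hom: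
  "pconst (a + b) = pconst a + pconst b" "pconst (a * b) = pconst a * (pconst b :: 'a::comm_ring_1 dpoly)"
  "pconst 0 = (0 :: 'a dpoly)" "pconst 1 = (1 :: 'a dpoly)"
  by (simp_all add: pconst_def single_add mult_single)

lemma pconst_of_nat: "pconst (of_nat k) = (of_nat k :: 'a::comm_ring_1 dpoly)"
  by (induction k) (simp_all add: pconst_hom)

lemma pvar_power: "(pvar v :: 'a::comm_ring_1 dpoly) ^ k = single (single v k) 1"
  by (induction k) (simp_all add: pvar_def mult_single single_add[symmetric])

lemma single_eq_pvar_power_mult:
  "single M (c :: 'a::comm_ring_1) =
    single (M - single v (lookup M v)) c *
    pvar v ^ lookup M v"
proof -
  have "M - single v (lookup M v) +
      single v (lookup M v) = M"
    by (rule poly_mapping_eqI) (auto simp: lookup_add lookup_minus lookup_single when_def)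
  then show ?thesis
    by (simp add: pvar_power mult_single)
qed

text \<open>Reduces additive and multiplicative identities to the generators of the ring. Single
  monomials are reached by splitting off the full power of one variable at a time, sums of monomials
  by insertion.\<close>

lemma polys_in_induct [consumes 1, case_names const var add mult]:
  fixes p :: "'a::comm_ring_1 dpoly"
  assumes p: "p \<in> polys_in U"
    and const: "\<And>c. P (pconst c)"
    and var: "\<And>v. v \<in> U \<Longrightarrow> P (pvar v)"
    and add: "\<And>p q. p \<in> polys_in U \<Longrightarrow> q \<in> polys_in U \<Longrightarrow> P p \<Longrightarrow> P q \<Longrightarrow> P (p + q)"
    and mult: "\<And>p q. p \<in> polys_in U \<Longrightarrow> q \<in> polys_in U \<Longrightarrow> P p \<Longrightarrow> P q \<Longrightarrow> P (p * q)"
  shows "P p"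
proof -
  have pow: "P (pvar v ^ k)" if "v \<in> U" for v k
  proof (induction k)
    case 0
    then show ?case using const[of 1] by (simp add: pconst_hom)
  next
    case (Suc k)
    then show ?case
      using that by (simp add: mult var polys_in_power polys_in_pvar)
  qed
  have mon: "P (single M c)" if "keys M \<subseteq> U" for M c
    using that
  proof (induction "card (keys M)" arbitrary: M)
    case 0
    then show ?case using const[of c] by (simp add: pconst_def)
  next
    case (Suc k)
    then obtain v where v: "v \<in> keys M"
      by (metis card.empty ex_in_conv nat.distinct(1))
    let ?N = "M - single v (lookup M v)"
    have N: "keys ?N = keys M - {v}"
      by (auto simp: in_keys_iff lookup_minus lookup_single when_def split: if_splits)
    then have "P (single ?N c)"
      using Suc v by (intro Suc(1)) auto
    then show ?case
      using Suc v N by (subst single_eq_pvar_power_mult[of M c v], intro mult)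
        (auto intro!: pow polys_in_power polys_in_pvar polys_in_single)
  qed
  have "P (\<Sum>M\<in>S. single M (lookup p M)) \<and>
      (\<Sum>M\<in>S. single M (lookup p M)) \<in> polys_in U"
    if "S \<subseteq> keys p" for S
    using finite_subset[OF that finite_keys] that
  proof (induction S)
    case empty
    then show ?case using const[of 0] by (simp add: pconst_hom)
  next
    case (insert M S)
    then have "keys M \<subseteq> U"
      using p by (auto simp: polys_in_def)
    then show ?case
      using insert by (auto intro!: add mon polys_in_single polys_in_add)
  qed
  from this[of "keys p"] show ?thesis
    by (simp add: dpoly_sum_single)
qed

lemma polys_in_UNIV [simp]: "polys_in UNIV = UNIV"
  by (simp add: polys_in_def)

lemma polys_in_finite:
  fixes p :: "'a::comm_ring_1 dpoly"
  assumes "p \<in> polys_in U"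
  obtains F where "finite F" "F \<subseteq> U" "p \<in> polys_in F"
  using assms by (intro that[of "\<Union>M\<in>keys p. keys M"])
    (auto simp: polys_in_def)

text \<open>Each monomial \<open>M\<close> contributes its part without \<open>v\<close> to the
  coefficient at the exponent of \<open>v\<close>.\<close>

lemma polys_in_insert:
  fixes p :: "'a::comm_ring_1 dpoly"
  assumes "p \<in> polys_in (insert v U)"
  obtains q where "\<And>k. coeff q k \<in> polys_in U" "poly q (pvar v) = p"
proof -
  let ?N = "\<lambda>M. M - single v (lookup M v)"
  let ?q = "\<Sum>M\<in>keys p. monom
    (single (?N M) (lookup p M)) (lookup M v)"
  have "coeff ?q k \<in> polys_in U" for k
  proof -
    have "keys (?N M) \<subseteq> U" if "M \<in> keys p" for M
    proof
      fix w assume "w \<in> keys (?N M)"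
      then have "w \<noteq> v" "w \<in> keys M"
        by (auto simp: in_keys_iff lookup_minus lookup_single when_def split: if_splits)
      then show "w \<in> U"
        using that assms unfolding polys_in_def by blast
    qed
    then show ?thesis
      unfolding coeff_sum Polynomial.coeff_monom by (intro polys_in_sum) (auto intro: polys_in_single)
  qed
  moreover have "poly ?q (pvar v) = (\<Sum>M\<in>keys p. single M (lookup p M))"
    unfolding poly_sum by (intro sum.cong) (simp_all add: poly_monom single_eq_pvar_power_mult[symmetric])
  ultimately show thesis
    by (intro that[of ?q]) (simp_all only: dpoly_sum_single)
qed

subsection \<open>The derivations\<close>

lemma dpoly_deriv_superset:
  fixes ds :: "('a::field \<Rightarrow> 'a) list"
  assumes "derivation (ds ! j)" "finite S" "keys p \<subseteq> S"
  shows "dpoly_deriv ds j p =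
     (\<Sum>M\<in>S.
        single M ((ds ! j) (lookup p M)) +
        (\<Sum>v\<in>keys M.
           single
             (M - single v 1 + single (shift j v) 1)
             (of_nat (lookup M v) * lookup p M)))"
  unfolding dpoly_deriv_def shift_def using assms
  by (intro sum.mono_neutral_left) (auto simp: in_keys_iff derivation_zero)

lemma dpoly_deriv_add:
  fixes ds :: "('a::field \<Rightarrow> 'a) list"
  assumes "derivation (ds ! j)"
  shows "dpoly_deriv ds j (p + q) = dpoly_deriv ds j p + dpoly_deriv ds j q"
proof -
  let ?S = "keys p \<union> keys q"
  have "keys (p + q) \<subseteq> ?S" by (rule keys_add)
  moreover have "(ds ! j) (a + b) = (ds ! j) a + (ds ! j) b" for a b
    using assms by (simp add: derivation_def)
  ultimately show ?thesis
    by (simp add: dpoly_deriv_superset[OF assms, of ?S] lookup_add single_add distrib_left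
        sum.distrib algebra_simps)
qed

lemma dpoly_deriv_single:
  fixes ds :: "('a::field \<Rightarrow> 'a) list"
  assumes "derivation (ds ! j)" "finite V" "keys M \<subseteq> V"
  shows "dpoly_deriv ds j (single M c) =
    single M ((ds ! j) c) +
    (\<Sum>v\<in>V. of_nat (lookup M v) * single
       (M - single v 1 + single (shift j v) 1) c)"
proof -
  have of_nat: "of_nat k * single N c = single N (of_nat k * c)" for k N
    by (metis add_0 mult_single single_of_nat)
  have "dpoly_deriv ds j (single M c) = single M ((ds ! j) c) +
    (\<Sum>v\<in>keys M. of_nat (lookup M v) * single
       (M - single v 1 + single (shift j v) 1) c)"
    using assms(1) by (subst dpoly_deriv_superset[of _ _ "{M}"]) (auto simp: of_nat)
  also have "(\<Sum>v\<in>keys M. of_nat (lookup M v) * single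
       (M - single v 1 + single (shift j v) 1) c) =
    (\<Sum>v\<in>V. of_nat (lookup M v) * single
       (M - single v 1 + single (shift j v) 1) c)"
    using assms by (intro sum.mono_neutral_left) (auto simp: in_keys_iff)
  finally show ?thesis .
qed

lemma dpoly_deriv_single_mult:
  fixes ds :: "('a::field \<Rightarrow> 'a) list"
  assumes d: "derivation (ds ! j)"
  shows "dpoly_deriv ds j (single M a * single N b) =
    dpoly_deriv ds j (single M a) * single N b +
    single M a * dpoly_deriv ds j (single N b)"
proof -
  let ?V = "keys M \<union> keys N"
  let ?s = "\<lambda>M v c. of_nat (lookup M v) * single
       (M - single v 1 + single (shift j v) 1) c"
  have V: "keys (M + N) \<subseteq> ?V" by (rule keys_add)
  have key: "?s (M + N) v (a * b) = ?s M v a * single N b + single M a * ?s N v b" for v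
  proof -
    \<comment> \<open>Subtraction of exponents is truncated, so \<open>single v 1\<close> can be
      moved past \<open>N\<close> only if \<open>v\<close> occurs in \<open>M\<close>; otherwise the
      factor \<open>lookup M v\<close> annihilates both sides.\<close>
    have 1: "of_nat (lookup M v) * single
       (M + N - single v 1 + single (shift j v) 1) (a * b) = ?s M v a * single N b"
      if "lookup M v \<noteq> 0" for M N a b
    proof -
      have "M + N - single v 1 + single (shift j v) 1 =
          M - single v 1 + single (shift j v) 1 + N"
        using that by (intro poly_mapping_eqI) (auto simp: lookup_add lookup_minus lookup_single when_def)
      then show ?thesis by (simp add: mult_single mult.assoc)
    qed
    have 2: "of_nat (lookup M v) * single
       (M + N - single v 1 + single (shift j v) 1) (a * b) = ?s M v a * single N b"
      for M N a b
      using 1[of M N a b] by (cases "lookup M v = 0") auto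
    have "?s (M + N) v (a * b) = of_nat (lookup M v) * single
       (M + N - single v 1 + single (shift j v) 1) (a * b) +
       of_nat (lookup N v) * single
       (N + M - single v 1 + single (shift j v) 1) (b * a)"
      by (simp add: lookup_add distrib_right add.commute mult.commute)
    then show ?thesis
      unfolding 2 by (simp add: mult_ac)
  qed
  have "(ds ! j) (a * b) = (ds ! j) a * b + a * (ds ! j) b"
    using d by (simp add: derivation_def)
  then show ?thesis
    by (simp add: mult_single dpoly_deriv_single[OF d _ V] dpoly_deriv_single[OF d, of ?V]
        key sum.distrib single_add distrib_left distrib_right sum_distrib_left sum_distrib_right
        del: One_nat_def)
qed

lemma dpoly_deriv_mult:
  fixes ds :: "('a::field \<Rightarrow> 'a) list"
  assumes d: "derivation (ds ! j)"
  shows "dpoly_deriv ds j (p * q) = dpoly_deriv ds j p * q + p * dpoly_deriv ds j q"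
proof -
  note add = dpoly_deriv_add[OF d]
  have zero: "dpoly_deriv ds j 0 = 0"
    by (simp add: dpoly_deriv_def)
  have sum: "dpoly_deriv ds j (\<Sum>i\<in>A. f i) = (\<Sum>i\<in>A. dpoly_deriv ds j (f i))" for A :: "'i set" and f
    by (induction A rule: infinite_finite_induct) (simp_all add: add zero)
  let ?s = "\<lambda>p M. single M (lookup p M)"
  have "dpoly_deriv ds j ((\<Sum>M\<in>keys p. ?s p M) * (\<Sum>N\<in>keys q. ?s q N)) =
    dpoly_deriv ds j (\<Sum>M\<in>keys p. ?s p M) * (\<Sum>N\<in>keys q. ?s q N) +
    (\<Sum>M\<in>keys p. ?s p M) * dpoly_deriv ds j (\<Sum>N\<in>keys q. ?s q N)"
    unfolding sum_product sum dpoly_deriv_single_mult[OF d] by (simp add: sum.distrib)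
  then show ?thesis by (simp add: dpoly_sum_single)
qed

lemma derivation_dpoly_deriv:
  fixes ds :: "('a::field \<Rightarrow> 'a) list"
  shows "derivation (ds ! j) \<Longrightarrow> derivation (dpoly_deriv ds j)"
  by (simp add: derivation_def[of "dpoly_deriv ds j"] dpoly_deriv_add dpoly_deriv_mult)

lemma dpoly_deriv_const:
  fixes ds :: "('a::field \<Rightarrow> 'a) list"
  assumes "derivation (ds ! j)"
  shows "dpoly_deriv ds j (pconst c) = pconst ((ds ! j) c)"
  using dpoly_deriv_single[OF assms, of "{}" 0] by (simp add: pconst_def)

lemma dpoly_deriv_var:
  fixes ds :: "('a::field \<Rightarrow> 'a) list"
  assumes "derivation (ds ! j)"
  shows "dpoly_deriv ds j (pvar v) = pvar (shift j v)"
  using dpoly_deriv_single[OF assms, of "{v}" "single v 1" 1]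
  by (simp add: pvar_def derivation_one[OF assms])

lemma shift_commute: "shift i (shift j v) = shift j (shift i v)"
  by (simp add: shift_def ac_simps)

lemma shift_in_dvars: "v \<in> dvars k n \<Longrightarrow> j < k \<Longrightarrow> shift j v \<in> dvars k n"
  using keys_add[of "snd v" "single j 1"] by (auto simp: dvars_def shift_def)

lemma dpoly_deriv_commute:
  fixes ds :: "('a::field \<Rightarrow> 'a) list"
  assumes K: "differential_field ds" and ij: "i < length ds" "j < length ds"
  shows "dpoly_deriv ds i (dpoly_deriv ds j p) = dpoly_deriv ds j (dpoly_deriv ds i p)"
proof -
  have d: "derivation (ds ! i)" "derivation (ds ! j)"
    and c: "(ds ! i) ((ds ! j) a) = (ds ! j) ((ds ! i) a)" for a
    using K ij by (auto simp: differential_field_def)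
  have "p \<in> polys_in UNIV" by simp
  then show ?thesis
    by (induction rule: polys_in_induct)
      (simp_all add: dpoly_deriv_const dpoly_deriv_var dpoly_deriv_add dpoly_deriv_mult d c
        shift_commute[of i j] algebra_simps)
qed

lemma dpoly_deriv_polys_in:
  fixes ds :: "('a::field \<Rightarrow> 'a) list"
  assumes d: "derivation (ds ! j)" and "p \<in> polys_in U" "U \<subseteq> W" "shift j ` U \<subseteq> W"
  shows "dpoly_deriv ds j p \<in> polys_in W"
  using assms(2)
proof (induction rule: polys_in_induct)
  case (mult p q)
  then show ?case
    using polys_in_mono[OF assms(3)] by (auto simp: dpoly_deriv_mult[OF d] intro!: polys_in_add polys_in_mult)
qed (use assms in \<open>auto simp: dpoly_deriv_const dpoly_deriv_var dpoly_deriv_add intro!: polys_in_pvar polys_in_add\<close>)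

text \<open>Apart from the term in which \<open>v\<close> itself is differentiated, only
  coefficients of \<open>q\<close> are, and their derivatives stay in \<open>W\<close>. When
  \<open>shift j v\<close> lies outside \<open>W\<close>, the result is thus linear in it, and the
  separant has become the initial.\<close>

lemma dpoly_deriv_poly:
  fixes ds :: "('a::field \<Rightarrow> 'a) list"
  assumes d: "derivation (ds ! j)" and "\<And>k. coeff q k \<in> polys_in U" "U \<subseteq> W" "shift j ` U \<subseteq> W" "v \<in> W"
  shows "\<exists>T\<in>polys_in W. dpoly_deriv ds j (poly q (pvar v)) = poly (pderiv q) (pvar v) * pvar (shift j v) + T"
  using assms(2)
proof (induction q)
  case 0
  have "dpoly_deriv ds j 0 = 0"
    by (simp add: dpoly_deriv_def)
  then show ?case by (auto intro: bexI[of _ 0])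
next
  case (pCons a q)
  have a: "a \<in> polys_in U" and q: "coeff q k \<in> polys_in U" for k
    using pCons.prems[of 0] pCons.prems[of "Suc k"] by simp_all
  with pCons.IH obtain T where T: "T \<in> polys_in W"
    "dpoly_deriv ds j (poly q (pvar v)) = poly (pderiv q) (pvar v) * pvar (shift j v) + T"
    by blast
  have "dpoly_deriv ds j (poly (pCons a q) (pvar v)) =
      poly (pderiv (pCons a q)) (pvar v) * pvar (shift j v) + (dpoly_deriv ds j a + pvar v * T)"
    by (simp add: dpoly_deriv_add[OF d] dpoly_deriv_mult[OF d] dpoly_deriv_var[OF d] T(2) pderiv_pCons algebra_simps)
  moreover have "dpoly_deriv ds j a + pvar v * T \<in> polys_in W"
    using dpoly_deriv_polys_in[OF d a assms(3,4)] T(1) assms(5) by (intro polys_in_add polys_in_mult polys_in_pvar)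
  ultimately show ?case by blast
qed

subsection \<open>Evaluation in an algebraic closure\<close>

text \<open>Unlike in \<^const>\<open>dpoly_eval\<close>, the values of the derivatives of one indeterminate need not be related.\<close>

definition ac_eval :: "(dvar \<Rightarrow> 'a::field alg_closure) \<Rightarrow> 'a dpoly \<Rightarrow> 'a alg_closure" where
  "ac_eval \<sigma> p = (\<Sum>M\<in>keys p. to_ac (lookup p M) *
     (\<Prod>v\<in>keys M. \<sigma> v ^ lookup M v))"

lemma ac_eval_superset:
  assumes "finite S" "keys p \<subseteq> S"
  shows "ac_eval \<sigma> p = (\<Sum>M\<in>S. to_ac (lookup p M) *
     (\<Prod>v\<in>keys M. \<sigma> v ^ lookup M v))"
  unfolding ac_eval_def using assms
  by (intro sum.mono_neutral_left) (auto simp: in_keys_iff)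

lemma ac_eval_add: "ac_eval \<sigma> (p + q) = ac_eval \<sigma> p + ac_eval \<sigma> q"
proof -
  let ?S = "keys p \<union> keys q"
  have "keys (p + q) \<subseteq> ?S" by (rule keys_add)
  then show ?thesis
    by (simp add: ac_eval_superset[of ?S] lookup_add distrib_right sum.distrib)
qed

lemma ac_eval_single: "ac_eval \<sigma> (single M c) =
    to_ac c * (\<Prod>v\<in>keys M. \<sigma> v ^ lookup M v)"
  by (simp add: ac_eval_def)

lemma ac_eval_const [simp]: "ac_eval \<sigma> (pconst c) = to_ac c"
  by (simp add: pconst_def ac_eval_single)

lemma ac_eval_var [simp]: "ac_eval \<sigma> (pvar v) = \<sigma> v"
  by (simp add: pvar_def ac_eval_single)

lemma ac_eval_0 [simp]: "ac_eval \<sigma> 0 = 0"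
  by (simp add: ac_eval_def)

lemma ac_eval_1 [simp]: "ac_eval \<sigma> 1 = 1"
  by (simp add: ac_eval_def)

lemma ac_eval_mult: "ac_eval \<sigma> (p * q) = ac_eval \<sigma> p * ac_eval \<sigma> q"
proof -
  have sum: "ac_eval \<sigma> (\<Sum>i\<in>A. f i) = (\<Sum>i\<in>A. ac_eval \<sigma> (f i))" for A :: "'i set" and f
    by (induction A rule: infinite_finite_induct) (simp_all add: ac_eval_add)
  have mon: "ac_eval \<sigma> (single M a * single N b) =
      ac_eval \<sigma> (single M a) * ac_eval \<sigma> (single N b)" for M N a b
  proof -
    let ?V = "keys M \<union> keys N"
    have sup: "(\<Prod>v\<in>keys L. \<sigma> v ^ lookup L v) = (\<Prod>v\<in>?V. \<sigma> v ^ lookup L v)"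
      if "keys L \<subseteq> ?V" for L
      using that by (intro prod.mono_neutral_left) (auto simp: in_keys_iff)
    have "(\<Prod>v\<in>keys (M + N). \<sigma> v ^ lookup (M + N) v) =
        (\<Prod>v\<in>keys M. \<sigma> v ^ lookup M v) *
        (\<Prod>v\<in>keys N. \<sigma> v ^ lookup N v)"
      unfolding sup[OF keys_add] sup[OF Un_upper1] sup[OF Un_upper2]
      by (simp add: lookup_add power_add prod.distrib)
    then show ?thesis
      by (simp add: mult_single ac_eval_single)
  qed
  let ?s = "\<lambda>p M. single M (lookup p M)"
  have "ac_eval \<sigma> ((\<Sum>M\<in>keys p. ?s p M) * (\<Sum>N\<in>keys q. ?s q N)) =
    ac_eval \<sigma> (\<Sum>M\<in>keys p. ?s p M) * ac_eval \<sigma> (\<Sum>N\<in>keys q. ?s q N)"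
    unfolding sum_product sum mon ..
  then show ?thesis by (simp add: dpoly_sum_single)
qed

lemma ac_eval_uminus: "ac_eval \<sigma> (- p) = - ac_eval \<sigma> p"
  using ac_eval_add[of \<sigma> p "- p"] by (simp add: eq_neg_iff_add_eq_0 add.commute)

lemma ac_eval_diff: "ac_eval \<sigma> (p - q) = ac_eval \<sigma> p - ac_eval \<sigma> q"
  using ac_eval_add[of \<sigma> p "- q"] by (simp add: ac_eval_uminus)

lemma ac_eval_power: "ac_eval \<sigma> (p ^ k) = ac_eval \<sigma> p ^ k"
  by (induction k) (simp_all add: ac_eval_mult)

lemma ac_eval_of_nat: "ac_eval \<sigma> (of_nat k) = of_nat k"
  by (induction k) (simp_all add: ac_eval_add)

lemma ac_eval_cong:
  assumes "p \<in> polys_in U" "\<And>v. v \<in> U \<Longrightarrow> \<sigma> v = \<tau> v"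
  shows "ac_eval \<sigma> p = ac_eval \<tau> p"
  using assms(1) by (induction rule: polys_in_induct) (simp_all add: assms(2) ac_eval_add ac_eval_mult)

lemma ac_eval_poly:
  "ac_eval \<sigma> (poly q p) = poly (map_poly (ac_eval \<sigma>) q) (ac_eval \<sigma> p)"
  by (induction q) (simp_all add: ac_eval_add ac_eval_mult map_poly_pCons)

lemma map_poly_ac_eval_mult:
  "map_poly (ac_eval \<sigma>) (p * q) = map_poly (ac_eval \<sigma>) p * map_poly (ac_eval \<sigma>) q"
proof -
  have sum: "ac_eval \<sigma> (\<Sum>i\<in>A. f i) = (\<Sum>i\<in>A. ac_eval \<sigma> (f i))" for A :: "nat set" and f
    by (induction A rule: infinite_finite_induct) (simp_all add: ac_eval_add)
  show ?thesis
    by (rule poly_eqI) (simp add: coeff_map_poly Polynomial.coeff_mult sum ac_eval_mult)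
qed

lemma map_poly_ac_eval_add:
  "map_poly (ac_eval \<sigma>) (p + q) = map_poly (ac_eval \<sigma>) p + map_poly (ac_eval \<sigma>) q"
  by (rule poly_eqI) (simp add: coeff_map_poly ac_eval_add)

lemma map_poly_ac_eval_pderiv:
  "map_poly (ac_eval \<sigma>) (pderiv p) = pderiv (map_poly (ac_eval \<sigma>) p)"
  by (rule poly_eqI) (simp add: coeff_map_poly coeff_pderiv ac_eval_mult ac_eval_add ac_eval_of_nat)

text \<open>The assignments that do respect the derivations: the derivatives of the coordinates of
  an actual point, moved into the algebraic closure.\<close>

definition jet :: "('a::field \<Rightarrow> 'a) list \<Rightarrow> 'a list \<Rightarrow> dvar \<Rightarrow> 'a alg_closure" where
  "jet ds x v = to_ac (dop ds (snd v) (x ! fst v))"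

lemma ac_eval_jet: "ac_eval (jet ds x) p = to_ac (dpoly_eval ds p x)"
  by (simp add: ac_eval_def dpoly_eval_def dmonom_eval_def jet_def to_ac_sum to_ac_prod)

lemma dpoly_eval_const [simp]: "dpoly_eval ds (pconst c) x = c"
  by (simp add: pconst_def dmonom_eval_def)

lemma dpoly_eval_var: "dpoly_eval ds (pvar v) x = dop ds (snd v) (x ! fst v)"
  by (simp add: pvar_def dmonom_eval_def)

lemma dop_0 [simp]: "dop ds 0 a = a"
proof -
  have "foldr (\<lambda>j. (ds ! j) ^^ lookup 0 j) js a = a" for js
    by (induction js) simp_all
  then show ?thesis by (simp add: dop_def)
qed

lemma dpoly_eval_uminus: "dpoly_eval ds (- p) x = - dpoly_eval ds p x"
  using dpoly_eval_add[of ds p "- p" x] by (simp add: eq_neg_iff_add_eq_0 add.commute)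

lemma dpoly_eval_diff: "dpoly_eval ds (p - q) x = dpoly_eval ds p x - dpoly_eval ds q x"
  using dpoly_eval_add[of ds p "- q" x] by (simp add: dpoly_eval_uminus)

lemma dpoly_eval_power: "dpoly_eval ds (p ^ k) x = dpoly_eval ds p x ^ k"
  by (induction k) (simp_all add: dpoly_eval_mult)

section \<open>Differential ideals\<close>

definition radical_dideal :: "('a::comm_ring_1 \<Rightarrow> 'a) list \<Rightarrow> nat \<Rightarrow> 'a dpoly set \<Rightarrow> bool" where
  "radical_dideal ds n I \<longleftrightarrow>
     differential_ideal ds n I \<and> (\<forall>p\<in>dpolys ds n. \<forall>k. p ^ k \<in> I \<longrightarrow> p \<in> I)"

definition prime_dideal :: "('a::comm_ring_1 \<Rightarrow> 'a) list \<Rightarrow> nat \<Rightarrow> 'a dpoly set \<Rightarrow> bool" where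
  "prime_dideal ds n I \<longleftrightarrow>
     differential_ideal ds n I \<and> 1 \<notin> I \<and>
     (\<forall>p\<in>dpolys ds n. \<forall>q\<in>dpolys ds n. p * q \<in> I \<longrightarrow> p \<in> I \<or> q \<in> I)"

lemma dpolys_closed:
  fixes p q :: "'a::comm_ring_1 dpoly"
  shows "p \<in> dpolys ds n \<Longrightarrow> q \<in> dpolys ds n \<Longrightarrow> p + q \<in> dpolys ds n"
    and "p \<in> dpolys ds n \<Longrightarrow> q \<in> dpolys ds n \<Longrightarrow> p - q \<in> dpolys ds n"
    and "p \<in> dpolys ds n \<Longrightarrow> - p \<in> dpolys ds n"
    and "p \<in> dpolys ds n \<Longrightarrow> p ^ k \<in> dpolys ds n"
    and "(0 :: 'a dpoly) \<in> dpolys ds n" "(1 :: 'a dpoly) \<in> dpolys ds n"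
    and "(of_nat k :: 'a dpoly) \<in> dpolys ds n" "pconst c \<in> dpolys ds n"
  by (simp_all add: dpolys_eq polys_in_add polys_in_diff polys_in_uminus polys_in_power)

lemma dpolys_prod:
  fixes f :: "'i \<Rightarrow> 'a::comm_ring_1 dpoly"
  shows "(\<And>i. i \<in> A \<Longrightarrow> f i \<in> dpolys ds n) \<Longrightarrow> prod f A \<in> dpolys ds n"
  by (induction A rule: infinite_finite_induct) (simp_all add: dpolys_closed dpolys_mult)

lemma dpolys_var: "v \<in> dvars (length ds) n \<Longrightarrow> pvar v \<in> dpolys ds n"
  by (simp add: dpolys_eq polys_in_pvar)

lemma differential_field_nth: "differential_field ds \<Longrightarrow> j < length ds \<Longrightarrow> derivation (ds ! j)"
  by (simp add: differential_field_def)

lemma dpolys_deriv: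
  fixes ds :: "('a::field \<Rightarrow> 'a) list"
  assumes "differential_field ds" "j < length ds" "p \<in> dpolys ds n"
  shows "dpoly_deriv ds j p \<in> dpolys ds n"
  using assms dpoly_deriv_polys_in[OF differential_field_nth[OF assms(1,2)], of p]
  by (auto simp: dpolys_eq intro: shift_in_dvars)

lemma differential_idealD:
  fixes p q :: "'a::comm_ring_1 dpoly"
  assumes "differential_ideal ds n I"
  shows "p \<in> I \<Longrightarrow> p \<in> dpolys ds n" "0 \<in> I"
    "p \<in> I \<Longrightarrow> q \<in> I \<Longrightarrow> p + q \<in> I"
    "p \<in> dpolys ds n \<Longrightarrow> q \<in> I \<Longrightarrow> p * q \<in> I"
    "p \<in> I \<Longrightarrow> q \<in> dpolys ds n \<Longrightarrow> p * q \<in> I"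
    "j < length ds \<Longrightarrow> p \<in> I \<Longrightarrow> dpoly_deriv ds j p \<in> I"
  using assms unfolding differential_ideal_def by (auto simp: mult.commute)

lemma differential_ideal_diff:
  fixes p q :: "'a::comm_ring_1 dpoly"
  assumes "differential_ideal ds n I" "p \<in> I" "q \<in> I"
  shows "p - q \<in> I"
proof -
  have "(- 1) * q \<in> I"
    using assms by (intro differential_idealD(4)[OF assms(1)] dpolys_closed)
  then show ?thesis
    using differential_idealD(3)[OF assms(1,2), of "- 1 * q"] by simp
qed

lemma differential_ideal_sum:
  fixes f :: "'i \<Rightarrow> 'a::comm_ring_1 dpoly"
  assumes "differential_ideal ds n I" "\<And>i. i \<in> A \<Longrightarrow> f i \<in> I"
  shows "sum f A \<in> I"
  using assms(2) by (induction A rule: infinite_finite_induct)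
    (simp_all add: differential_idealD[OF assms(1)])

lemma prime_dideal_prod:
  assumes "prime_dideal ds n I" "finite A" "\<And>i. i \<in> A \<Longrightarrow> f i \<in> dpolys ds n - I"
  shows "prod f A \<in> dpolys ds n - I"
  using assms(2,3)
proof induction
  case empty
  then show ?case using assms(1) by (simp add: prime_dideal_def dpolys_closed)
next
  case (insert i A)
  then show ?case using assms(1) unfolding prime_dideal_def by (auto intro!: dpolys_mult)
qed

text \<open>If \<open>a p\<close> lies in a radical differential ideal, so does
  \<open>a (D p)\<close>, because its square is \<open>a (D p) D(a p) - (D a) (D p) a p\<close>. A
  whole set of multipliers is allowed so that the quotient can be formed twice.\<close>

lemma radical_dideal_colon:
  fixes ds :: "('a::field \<Rightarrow> 'a) list"
  assumes K: "differential_field ds" and I: "radical_dideal ds n I" and A: "A \<subseteq> dpolys ds n"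
  shows "radical_dideal ds n {p \<in> dpolys ds n. \<forall>a\<in>A. a * p \<in> I}"
proof -
  have D: "differential_ideal ds n I"
    and rad: "\<And>p k. p \<in> dpolys ds n \<Longrightarrow> p ^ k \<in> I \<Longrightarrow> p \<in> I"
    using I by (auto simp: radical_dideal_def)
  note D' = differential_idealD[OF D]
  have deriv: "a * dpoly_deriv ds j p \<in> I"
    if j: "j < length ds" and p: "p \<in> dpolys ds n" and a: "a \<in> A" and ap: "a * p \<in> I" for j p a
  proof -
    note d = differential_field_nth[OF K j]
    have a': "a \<in> dpolys ds n" using a A by blast
    note Dp = dpolys_deriv[OF K j p] and Da = dpolys_deriv[OF K j a']
    have "a * dpoly_deriv ds j p * dpoly_deriv ds j (a * p) -
        dpoly_deriv ds j a * dpoly_deriv ds j p * (a * p) \<in> I"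
      by (intro differential_ideal_diff[OF D] D'(4)[OF _ ap] D'(4)[OF _ D'(6)[OF j ap]] dpolys_mult a' Dp Da)
    also have "a * dpoly_deriv ds j p * dpoly_deriv ds j (a * p) -
        dpoly_deriv ds j a * dpoly_deriv ds j p * (a * p) = (a * dpoly_deriv ds j p) ^ 2"
    proof -
      have "a * c * (b * p + a * c) - b * c * (a * p) = (a * c) ^ 2" for a b c p :: "'r::comm_ring_1"
        by (simp add: power2_eq_square algebra_simps)
      then show ?thesis unfolding dpoly_deriv_mult[OF d] .
    qed
    finally show ?thesis
      by (rule rad[rotated]) (intro dpolys_mult a' Dp)
  qed
  have pow: "a * p \<in> I" if "p \<in> dpolys ds n" "a \<in> A" "a * p ^ k \<in> I" for a p k
  proof -
    have a': "a \<in> dpolys ds n" using that A by blast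
    \<comment> \<open>The factors \<open>a^k\<close> and \<open>p\<close> complete
      \<open>a p^k\<close> to the power \<open>(a p)^(k + 1)\<close>.\<close>
    have "a ^ k * (a * p ^ k) \<in> I"
      by (rule D'(4)[OF dpolys_closed(4)[OF a'] that(3)])
    then have "a * (a * p) ^ k \<in> I"
      by (simp only: power_mult_distrib mult_ac)
    then have "p * (a * (a * p) ^ k) \<in> I"
      by (rule D'(4)[OF that(1)])
    then have "(a * p) ^ Suc k \<in> I"
      by (simp only: power_Suc mult_ac)
    then show ?thesis
      by (rule rad[rotated]) (intro dpolys_mult a' that)
  qed
  let ?X = "{p \<in> dpolys ds n. \<forall>a\<in>A. a * p \<in> I}"
  have mult: "a * (p * q) \<in> I" if "p \<in> dpolys ds n" "a * q \<in> I" for a p q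
    using D'(4)[OF that] by (simp add: mult.left_commute)
  have "differential_ideal ds n ?X"
    unfolding differential_ideal_def[of ds n ?X]
    by (auto simp: distrib_left dpolys_closed dpolys_mult D' intro: mult deriv dpolys_deriv[OF K])
  then show ?thesis
    unfolding radical_dideal_def using pow by blast
qed

text \<open>Every closure condition involves at most two elements, so a directed union suffices;
  besides chains this covers the hulls of the finite subsets of a given set.\<close>

lemma radical_dideal_Union_chain:
  fixes ds :: "('a::field \<Rightarrow> 'a) list"
  assumes "\<And>I. I \<in> \<C> \<Longrightarrow> radical_dideal ds n I" "\<C> \<noteq> {}"
    and "\<And>I J. I \<in> \<C> \<Longrightarrow> J \<in> \<C> \<Longrightarrow> \<exists>M\<in>\<C>. I \<subseteq> M \<and> J \<subseteq> M"
  shows "radical_dideal ds n (\<Union>\<C>)"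
proof -
  have D: "differential_ideal ds n I" if "I \<in> \<C>" for I
    using assms(1)[OF that] by (simp add: radical_dideal_def)
  have add: "p + q \<in> \<Union>\<C>" if "I \<in> \<C>" "J \<in> \<C>" "p \<in> I" "q \<in> J" for p q I J
    using assms(3)[OF that(1,2)] that differential_idealD(3)[OF D] by blast
  have "differential_ideal ds n (\<Union>\<C>)"
    unfolding differential_ideal_def[of ds n "\<Union>\<C>"]
  proof (intro conjI ballI allI impI subsetI)
    show "0 \<in> \<Union>\<C>" using assms(2) D differential_idealD(2) by blast
    show "p + q \<in> \<Union>\<C>" if "p \<in> \<Union>\<C>" "q \<in> \<Union>\<C>" for p q
      using that add by blast
    show "p \<in> dpolys ds n" if "p \<in> \<Union>\<C>" for p
      using that D differential_idealD(1) by blast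
    show "p * q \<in> \<Union>\<C>" if "p \<in> dpolys ds n" "q \<in> \<Union>\<C>" for p q
      using that D differential_idealD(4) by blast
    show "dpoly_deriv ds j p \<in> \<Union>\<C>" if "j < length ds" "p \<in> \<Union>\<C>" for j p
      using that D differential_idealD(6) by blast
  qed
  then show ?thesis
    unfolding radical_dideal_def using assms(1) by (auto simp: radical_dideal_def)
qed

text \<open>
  In characteristic zero \<open>a ^ m (D a) ^ l \<in> I\<close> implies \<open>a ^ (m - 1) (D a) ^ (l + 2) \<in> I\<close>, so that a power of
  \<open>D a\<close> lies in \<open>I\<close> if a power of \<open>a\<close> does.
\<close>

lemma radical_of_dideal:
  fixes ds :: "('a::field_char_0 \<Rightarrow> 'a) list"
  assumes K: "differential_field ds" and D: "differential_ideal ds n I"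
  shows "radical_dideal ds n {p \<in> dpolys ds n. \<exists>k. p ^ k \<in> I}"
proof -
  note D' = differential_idealD[OF D]
  have deriv: "\<exists>k. dpoly_deriv ds j a ^ k \<in> I"
    if j: "j < length ds" and a: "a \<in> dpolys ds n" and k: "a ^ k \<in> I" for j a k
  proof -
    note d = differential_field_nth[OF K j]
    have one: "dpoly_deriv ds j 1 = 0"
      by (rule derivation_one[OF derivation_dpoly_deriv[OF d]])
    let ?b = "dpoly_deriv ds j a"
    have b: "?b \<in> dpolys ds n" by (rule dpolys_deriv[OF K j a])
    have "a ^ (k - i) * ?b ^ (2 * i) \<in> I" if "i \<le> k" for i
      using that
    proof (induction i)
      case (Suc i)
      define m where "m = k - Suc i"
      have m: "k - i = Suc m" using Suc by (simp add: m_def)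
      have IH: "a ^ Suc m * ?b ^ (2 * i) \<in> I" using Suc m by simp
      have deriv_pow: "dpoly_deriv ds j (p ^ Suc l) = of_nat (Suc l) * p ^ l * dpoly_deriv ds j p" for p l
        using derivation_power[OF derivation_dpoly_deriv[of _ j, OF d], of p "Suc l"] by simp
      \<comment> \<open>Differentiation lowers the exponent of \<open>a\<close>, but also yields a
        term with only \<open>2 i - 1\<close> factors \<open>?b\<close>. The extra factor
        \<open>?b\<close> turns that term into a multiple of the element of \<open>I\<close> being
        differentiated.\<close>
      have "?b * dpoly_deriv ds j (a ^ Suc m * ?b ^ (2 * i)) \<in> I"
        using b D'(6)[OF j IH] by (intro D'(4))
      also have "?b * dpoly_deriv ds j (a ^ Suc m * ?b ^ (2 * i)) =
          of_nat (Suc m) * (a ^ m * ?b ^ (2 * Suc i)) +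
          of_nat (2 * i) * dpoly_deriv ds j ?b * (a ^ Suc m * ?b ^ (2 * i))"
      proof (cases i)
        case 0
        then show ?thesis
          by (simp only: 0 deriv_pow dpoly_deriv_mult[OF d]) (simp add: one power2_eq_square algebra_simps)
      next
        case (Suc l)
        then have "2 * i = Suc (Suc (2 * l))" by simp
        then show ?thesis
          by (simp only: deriv_pow dpoly_deriv_mult[OF d]) (simp add: algebra_simps)
      qed
      finally have sum: "of_nat (Suc m) * (a ^ m * ?b ^ (2 * Suc i)) +
          of_nat (2 * i) * dpoly_deriv ds j ?b * (a ^ Suc m * ?b ^ (2 * i)) \<in> I" .
      have "of_nat (2 * i) * dpoly_deriv ds j ?b * (a ^ Suc m * ?b ^ (2 * i)) \<in> I"
        by (intro D'(4)[OF _ IH] dpolys_mult dpolys_closed dpolys_deriv[OF K j b])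
      from differential_ideal_diff[OF D sum this]
      have "of_nat (Suc m) * (a ^ m * ?b ^ (2 * Suc i)) \<in> I" by simp
      then have "pconst (inverse (of_nat (Suc m))) * (of_nat (Suc m) * (a ^ m * ?b ^ (2 * Suc i))) \<in> I"
        by (rule D'(4)[OF dpolys_closed(8)])
      moreover have "pconst (inverse (of_nat (Suc m))) * (of_nat (Suc m) :: 'a dpoly) = 1"
        unfolding pconst_of_nat[symmetric] pconst_hom(2)[symmetric]
        by (simp add: pconst_hom del: of_nat_Suc)
      ultimately show ?case
        by (simp add: m_def mult.assoc[symmetric] del: of_nat_Suc)
    qed (use k in simp)
    from this[of k] show ?thesis by auto
  qed
  have add: "(p + q) ^ (k + l) \<in> I"
    if p: "p \<in> dpolys ds n" "p ^ k \<in> I" and q: "q \<in> dpolys ds n" "q ^ l \<in> I" for p q k l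
    unfolding binomial_ring
  proof (intro differential_ideal_sum[OF D])
    fix i assume i: "i \<in> {..k + l}"
    have mon: "of_nat c * p ^ i * q ^ j \<in> I" if "i \<ge> k \<or> j \<ge> l" for c i j
    proof -
      from that consider m where "i = k + m" | m where "j = l + m"
        using le_iff_add by blast
      then show ?thesis
      proof cases
        case 1
        have "(of_nat c * p ^ m * q ^ j) * p ^ k \<in> I"
          by (rule D'(4)[OF _ p(2)]) (intro dpolys_mult dpolys_closed p q)
        also have "(of_nat c * p ^ m * q ^ j) * p ^ k = of_nat c * p ^ i * q ^ j"
          by (simp only: 1 power_add mult_ac)
        finally show ?thesis .
      next
        case 2
        have "(of_nat c * p ^ i * q ^ m) * q ^ l \<in> I"
          by (rule D'(4)[OF _ q(2)]) (intro dpolys_mult dpolys_closed p q)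
        also have "(of_nat c * p ^ i * q ^ m) * q ^ l = of_nat c * p ^ i * q ^ j"
          by (simp only: 2 power_add mult_ac)
        finally show ?thesis .
      qed
    qed
    show "of_nat (k + l choose i) * p ^ i * q ^ (k + l - i) \<in> I"
      using i by (intro mon) auto
  qed
  show ?thesis
    unfolding radical_dideal_def differential_ideal_def[of ds n "{p \<in> dpolys ds n. \<exists>k. p ^ k \<in> I}"]
  proof (intro conjI ballI allI impI)
    show "0 \<in> {p \<in> dpolys ds n. \<exists>k. p ^ k \<in> I}"
      using D'(2) by (auto simp: dpolys_closed intro!: exI[of _ 1])
  next
    fix p q assume "p \<in> dpolys ds n" "q \<in> {p \<in> dpolys ds n. \<exists>k. p ^ k \<in> I}"
    then obtain k where "p * q \<in> dpolys ds n" "p ^ k * q ^ k \<in> I"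
      using D'(4)[OF dpolys_closed(4)] dpolys_mult by blast
    then show "p * q \<in> {p \<in> dpolys ds n. \<exists>k. p ^ k \<in> I}"
      by (auto simp: power_mult_distrib)
  next
    fix p k assume "p \<in> dpolys ds n" "p ^ k \<in> {p \<in> dpolys ds n. \<exists>k. p ^ k \<in> I}"
    then show "p \<in> {p \<in> dpolys ds n. \<exists>k. p ^ k \<in> I}"
      by (auto simp: power_mult[symmetric])
  next
    fix p q assume "p \<in> {p \<in> dpolys ds n. \<exists>k. p ^ k \<in> I}" "q \<in> {p \<in> dpolys ds n. \<exists>k. p ^ k \<in> I}"
    then show "p + q \<in> {p \<in> dpolys ds n. \<exists>k. p ^ k \<in> I}"
      using add dpolys_closed(1) by blast
  next
    fix j p assume "j < length ds" "p \<in> {p \<in> dpolys ds n. \<exists>k. p ^ k \<in> I}"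
    then show "dpoly_deriv ds j p \<in> {p \<in> dpolys ds n. \<exists>k. p ^ k \<in> I}"
      using deriv dpolys_deriv[OF K] by blast
  qed auto
qed

text \<open>Zorn's lemma gives a radical differential ideal \<open>Q\<close> maximal among those
  above \<open>J\<close> without \<open>s\<close>. If \<open>a b\<close> is in \<open>Q\<close> and
  \<open>b\<close> is not, the quotient of \<open>Q\<close> by \<open>a\<close> is strictly larger,
  hence contains \<open>s\<close>, so \<open>s a\<close> is in \<open>Q\<close>. Applied to
  \<open>p q\<close> and then to \<open>s p\<close>, this puts \<open>s^2\<close>, and so
  \<open>s\<close>, into \<open>Q\<close>.\<close>

lemma prime_dideal_exists:
  fixes ds :: "('a::field_char_0 \<Rightarrow> 'a) list"
  assumes K: "differential_field ds" and J: "differential_ideal ds n J"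
    and s: "s \<in> dpolys ds n" "\<And>k. s ^ k \<notin> J"
  obtains Q where "prime_dideal ds n Q" "J \<subseteq> Q" "s \<notin> Q"
proof -
  define \<A> where "\<A> = {I. radical_dideal ds n I \<and> J \<subseteq> I \<and> s \<notin> I}"
  have "{p \<in> dpolys ds n. \<exists>k. p ^ k \<in> J} \<in> \<A>"
  proof -
    have "p \<in> dpolys ds n \<and> p ^ 1 \<in> J" if "p \<in> J" for p
      using that differential_idealD(1)[OF J] by simp
    then show ?thesis
      unfolding \<A>_def using radical_of_dideal[OF K J] s by blast
  qed
  then have "\<A> \<noteq> {}" by blast
  moreover have "\<Union>\<C> \<in> \<A>" if "\<C> \<noteq> {}" "subset.chain \<A> \<C>" for \<C>
  proof -
    have sub: "\<C> \<subseteq> \<A>" and chain: "\<And>I M. I \<in> \<C> \<Longrightarrow> M \<in> \<C> \<Longrightarrow> I \<subseteq> M \<or> M \<subseteq> I"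
      using that(2) by (auto simp: subset.chain_def)
    have "radical_dideal ds n (\<Union>\<C>)"
    proof (rule radical_dideal_Union_chain)
      show "\<exists>N\<in>\<C>. I \<subseteq> N \<and> M \<subseteq> N" if "I \<in> \<C>" "M \<in> \<C>" for I M
        using chain[OF that] that by blast
    qed (use sub that(1) \<A>_def in blast)+
    then show ?thesis
      using that(1) sub unfolding \<A>_def by blast
  qed
  ultimately obtain Q where Q: "Q \<in> \<A>" and max: "\<And>I. I \<in> \<A> \<Longrightarrow> Q \<subseteq> I \<Longrightarrow> I = Q"
    using subset_Zorn_nonempty[of \<A>] by blast
  have rad: "radical_dideal ds n Q" and D: "differential_ideal ds n Q" and "J \<subseteq> Q" "s \<notin> Q"
    using Q by (auto simp: \<A>_def radical_dideal_def)
  note D' = differential_idealD[OF D]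
  have colon: "s * a \<in> Q" if "a \<in> dpolys ds n" "b \<in> dpolys ds n" "b \<notin> Q" "a * b \<in> Q" for a b
  proof (rule ccontr)
    assume "s * a \<notin> Q"
    let ?X = "{p \<in> dpolys ds n. \<forall>a\<in>{a}. a * p \<in> Q}"
    have "Q \<subseteq> ?X"
      using D' that by auto
    moreover have "?X \<in> \<A>"
      using radical_dideal_colon[OF K rad, of "{a}"] that \<open>J \<subseteq> Q\<close> \<open>s * a \<notin> Q\<close> \<open>Q \<subseteq> ?X\<close>
      by (auto simp: \<A>_def mult.commute)
    ultimately have "?X = Q" using max by blast
    then show False using that by auto
  qed
  have "p \<in> Q \<or> q \<in> Q" if "p \<in> dpolys ds n" "q \<in> dpolys ds n" "p * q \<in> Q" for p q
  proof (rule ccontr)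
    assume "\<not> (p \<in> Q \<or> q \<in> Q)"
    then have "s * p \<in> Q" using colon[of p q] that by blast
    then have "s * s \<in> Q"
      using colon[of s p] that s \<open>\<not> (p \<in> Q \<or> q \<in> Q)\<close> by blast
    then have "s ^ 2 \<in> Q" by (simp add: power2_eq_square)
    then show False
      using rad s \<open>s \<notin> Q\<close> unfolding radical_dideal_def by blast
  qed
  moreover have "1 \<notin> Q"
    using D'(4)[of s 1] s \<open>s \<notin> Q\<close> by auto
  ultimately have "prime_dideal ds n Q"
    using D by (auto simp: prime_dideal_def)
  then show thesis using that \<open>J \<subseteq> Q\<close> \<open>s \<notin> Q\<close> by blast
qed

section \<open>The generic point of a prime differential ideal\<close>

text \<open>The differential fraction field of \<open>R\<close> modulo a prime differential ideal
  \<open>Q\<close>, built in one stroke from pairs compared by their cross-differences modulo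
  \<open>Q\<close>. \<open>R\<close> is a subset of the type because the differential polynomials in
  \<open>n\<close> indeterminates are one, and \<open>n\<close> varies.\<close>

locale dfraction_field =
  fixes R Q :: "'r::comm_ring_1 set" and D :: "nat \<Rightarrow> 'r \<Rightarrow> 'r" and k :: nat
  assumes R_one: "1 \<in> R"
    and R_add: "\<And>a b. a \<in> R \<Longrightarrow> b \<in> R \<Longrightarrow> a + b \<in> R"
    and R_uminus: "\<And>a. a \<in> R \<Longrightarrow> - a \<in> R"
    and R_mult: "\<And>a b. a \<in> R \<Longrightarrow> b \<in> R \<Longrightarrow> a * b \<in> R"
    and R_deriv: "\<And>j a. j < k \<Longrightarrow> a \<in> R \<Longrightarrow> D j a \<in> R"
    and derivation: "\<And>j. j < k \<Longrightarrow> derivation (D j)"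
    and deriv_commute: "\<And>i j a. i < k \<Longrightarrow> j < k \<Longrightarrow> D i (D j a) = D j (D i a)"
    and Q_subset: "Q \<subseteq> R" and Q_zero: "0 \<in> Q" and Q_one: "1 \<notin> Q"
    and Q_add: "\<And>a b. a \<in> Q \<Longrightarrow> b \<in> Q \<Longrightarrow> a + b \<in> Q"
    and Q_mult: "\<And>a b. a \<in> R \<Longrightarrow> b \<in> Q \<Longrightarrow> a * b \<in> Q"
    and Q_deriv: "\<And>j a. j < k \<Longrightarrow> a \<in> Q \<Longrightarrow> D j a \<in> Q"
    and Q_prime: "\<And>a b. a \<in> R \<Longrightarrow> b \<in> R \<Longrightarrow> a * b \<in> Q \<Longrightarrow> a \<in> Q \<or> b \<in> Q"
begin

lemma R_diff: "a \<in> R \<Longrightarrow> b \<in> R \<Longrightarrow> a - b \<in> R"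
  using R_add[of a "- b"] R_uminus[of b] by simp

lemma R_zero: "0 \<in> R"
  using Q_zero Q_subset by blast

lemma Q_diff: "a \<in> Q \<Longrightarrow> b \<in> Q \<Longrightarrow> a - b \<in> Q"
  using Q_add[of a "- 1 * b"] Q_mult[OF R_uminus[OF R_one], of b] by simp

lemma deriv_mult: "j < k \<Longrightarrow> D j (a * b) = D j a * b + a * D j b"
  and deriv_add: "j < k \<Longrightarrow> D j (a + b) = D j a + D j b"
  using derivation by (simp_all add: derivation_def)

lemma deriv_diff: "j < k \<Longrightarrow> D j (a - b) = D j a - D j b"
  using deriv_add[of j "a - b" b] by simp

lemma deriv_one: "j < k \<Longrightarrow> D j 1 = 0"
  using derivation_one[OF derivation] .

definition dens :: "'r set" where
  "dens = R - Q"

lemma one_dens: "1 \<in> dens"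
  by (simp add: dens_def R_one Q_one)

lemma mult_dens: "a \<in> dens \<Longrightarrow> b \<in> dens \<Longrightarrow> a * b \<in> dens"
  using Q_prime by (auto simp: dens_def R_mult)

lemma dens_cancel: "b \<in> dens \<Longrightarrow> a \<in> R \<Longrightarrow> b * a \<in> Q \<Longrightarrow> a \<in> Q"
  using Q_prime by (auto simp: dens_def)

lemma dens_R: "b \<in> dens \<Longrightarrow> b \<in> R"
  by (simp add: dens_def)

definition eqv :: "'r \<times> 'r \<Rightarrow> 'r \<times> 'r \<Rightarrow> bool" where
  "eqv x y \<longleftrightarrow> fst x * snd y - fst y * snd x \<in> Q"

text \<open>A fraction is represented by a chosen element of its equivalence class.\<close>

definition frac :: "'r \<Rightarrow> 'r \<Rightarrow> 'r \<times> 'r" where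
  "frac a b = (SOME z. z \<in> R \<times> dens \<and> eqv z (a, b))"

lemma eqv_refl: "eqv x x"
  by (simp add: eqv_def Q_zero)

lemma eqv_sym: "eqv x y \<Longrightarrow> eqv y x"
  using Q_diff[OF Q_zero, of "fst x * snd y - fst y * snd x"] by (simp add: eqv_def Q_zero)

lemma eqv_trans:
  assumes "x \<in> R \<times> dens" "y \<in> R \<times> dens" "z \<in> R \<times> dens"
    and "eqv x y" "eqv y z"
  shows "eqv x z"
proof -
  obtain a b c d e f where [simp]: "x = (a, b)" "y = (c, d)" "z = (e, f)"
    by (metis surj_pair)
  have "f * (a * d - c * b) + b * (c * f - e * d) \<in> Q"
    using assms by (intro Q_add Q_mult) (auto simp: eqv_def dens_def)
  also have "f * (a * d - c * b) + b * (c * f - e * d) = d * (a * f - e * b)"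
    by (simp add: algebra_simps)
  finally show ?thesis
    using assms dens_cancel[of d "a * f - e * b"] by (auto simp: eqv_def dens_R R_diff R_mult)
qed

lemma frac_rep:
  assumes "a \<in> R" "b \<in> dens"
  shows "frac a b \<in> R \<times> dens" "eqv (frac a b) (a, b)"
proof -
  have "\<exists>z. z \<in> R \<times> dens \<and> eqv z (a, b)"
    using assms eqv_refl by (intro exI[of _ "(a, b)"]) auto
  then have "frac a b \<in> R \<times> dens \<and> eqv (frac a b) (a, b)"
    unfolding frac_def by (rule someI_ex)
  then show "frac a b \<in> R \<times> dens" "eqv (frac a b) (a, b)" by auto
qed

lemma frac_eq_iff:
  assumes "a \<in> R" "b \<in> dens" "c \<in> R" "d \<in> dens"
  shows "frac a b = frac c d \<longleftrightarrow> a * d - c * b \<in> Q"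
proof
  assume "frac a b = frac c d"
  then have "eqv (a, b) (c, d)"
    using frac_rep[OF assms(1,2)] frac_rep[OF assms(3,4)] assms
      eqv_trans[of "(a, b)" "frac a b" "(c, d)"] eqv_sym[of "frac a b" "(a, b)"] by simp
  then show "a * d - c * b \<in> Q" by (simp add: eqv_def)
next
  assume "a * d - c * b \<in> Q"
  then have e: "eqv (a, b) (c, d)" by (simp add: eqv_def)
  have ab: "(a, b) \<in> R \<times> dens" and cd: "(c, d) \<in> R \<times> dens"
    using assms by auto
  have "(z \<in> R \<times> dens \<and> eqv z (a, b)) = (z \<in> R \<times> dens \<and> eqv z (c, d))" for z
    using eqv_trans[OF _ ab cd _ e, of z] eqv_trans[OF _ cd ab _ eqv_sym[OF e], of z] by blast
  then show "frac a b = frac c d"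
    unfolding frac_def by simp
qed

lemma frac_eqI:
  assumes "a \<in> R" "b \<in> dens" "c \<in> R" "d \<in> dens" "a * d = c * b"
  shows "frac a b = frac c d"
  using assms by (simp add: frac_eq_iff Q_zero)

definition fracs :: "('r \<times> 'r) ring" where
  "fracs = \<lparr>carrier = {frac a b |a b. a \<in> R \<and> b \<in> dens},
     monoid.mult = (\<lambda>x y. frac (fst x * fst y) (snd x * snd y)), one = frac 1 1,
     zero = frac 0 1, add = (\<lambda>x y. frac (fst x * snd y + fst y * snd x) (snd x * snd y))\<rparr>"

definition frac_deriv :: "nat \<Rightarrow> 'r \<times> 'r \<Rightarrow> 'r \<times> 'r" where
  "frac_deriv j x =
     frac (D j (fst x) * snd x - fst x * D j (snd x)) (snd x * snd x)"

lemma frac_carrier: "a \<in> R \<Longrightarrow> b \<in> dens \<Longrightarrow> frac a b \<in> carrier fracs"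
  by (auto simp: fracs_def)

lemma fracs_cases:
  assumes "x \<in> carrier fracs"
  obtains a b where "a \<in> R" "b \<in> dens" "x = frac a b"
  using assms by (auto simp: fracs_def)

text \<open>The operations of \<open>fracs\<close> act on chosen representatives. That the choice is
  immaterial is seen here, and in the rules for sums and derivatives, by writing the
  cross-difference of the results as a combination of those of the arguments and, for derivatives,
  of their derivatives.\<close>

lemma frac_mult:
  assumes "a \<in> R" "b \<in> dens" "c \<in> R" "d \<in> dens"
  shows "frac a b \<otimes>\<^bsub>fracs\<^esub> frac c d = frac (a * c) (b * d)"
proof -
  obtain a' b' c' d' where eq: "frac a b = (a', b')" "frac c d = (c', d')"
    by (metis surj_pair)
  have m: "a' \<in> R" "b' \<in> dens" "c' \<in> R" "d' \<in> dens"
    and e: "a' * b - a * b' \<in> Q" "c' * d - c * d' \<in> Q"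
    using frac_rep[OF assms(1,2)] frac_rep[OF assms(3,4)] by (auto simp: eq eqv_def)
  have "c' * d * (a' * b - a * b') + a * b' * (c' * d - c * d') \<in> Q"
    by (intro Q_add Q_mult[OF _ e(1)] Q_mult[OF _ e(2)] R_mult dens_R m assms)
  then have "a' * c' * (b * d) - a * c * (b' * d') \<in> Q"
    by (simp add: algebra_simps)
  then show ?thesis
    using m assms by (simp add: fracs_def eq frac_eq_iff R_mult mult_dens)
qed

lemma frac_add:
  assumes "a \<in> R" "b \<in> dens" "c \<in> R" "d \<in> dens"
  shows "frac a b \<oplus>\<^bsub>fracs\<^esub> frac c d = frac (a * d + c * b) (b * d)"
proof -
  obtain a' b' c' d' where eq: "frac a b = (a', b')" "frac c d = (c', d')"
    by (metis surj_pair)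
  have m: "a' \<in> R" "b' \<in> dens" "c' \<in> R" "d' \<in> dens"
    and e: "a' * b - a * b' \<in> Q" "c' * d - c * d' \<in> Q"
    using frac_rep[OF assms(1,2)] frac_rep[OF assms(3,4)] by (auto simp: eq eqv_def)
  have "d * d' * (a' * b - a * b') + b * b' * (c' * d - c * d') \<in> Q"
    by (intro Q_add Q_mult[OF _ e(1)] Q_mult[OF _ e(2)] R_mult dens_R m assms)
  then have "(a' * d' + c' * b') * (b * d) - (a * d + c * b) * (b' * d') \<in> Q"
    by (simp add: algebra_simps)
  then show ?thesis
    using m assms by (simp add: fracs_def eq frac_eq_iff R_mult mult_dens R_add dens_R)
qed

lemma frac_deriv:
  assumes "a \<in> R" "b \<in> dens" "j < k"
  shows "frac_deriv j (frac a b) = frac (D j a * b - a * D j b) (b * b)"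
proof -
  obtain a' b' where eq: "frac a b = (a', b')"
    by (metis surj_pair)
  have m: "a' \<in> R" "b' \<in> dens" and e: "a' * b - a * b' \<in> Q"
    using frac_rep[OF assms(1,2)] by (auto simp: eq eqv_def)
  note e' = Q_deriv[OF assms(3) e]
  have "b * b' * D j (a' * b - a * b') - (b * D j b' + b' * D j b) * (a' * b - a * b') \<in> Q"
    by (intro Q_diff Q_mult[OF _ e] Q_mult[OF _ e'] R_mult R_add dens_R R_deriv m assms)
  then have "(D j a' * b' - a' * D j b') * (b * b) - (D j a * b - a * D j b) * (b' * b') \<in> Q"
    using assms(3) by (simp add: deriv_diff deriv_mult algebra_simps)
  then show ?thesis
    using m assms by (simp add: frac_deriv_def eq frac_eq_iff R_mult mult_dens R_diff dens_R R_deriv)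
qed

lemma frac_zero: "\<zero>\<^bsub>fracs\<^esub> = frac 0 1" and frac_one: "\<one>\<^bsub>fracs\<^esub> = frac 1 1"
  by (simp_all add: fracs_def)

lemmas frac_closed = R_mult R_add R_diff R_uminus R_one R_zero R_deriv mult_dens dens_R one_dens

lemma frac_eq_zero: "a \<in> R \<Longrightarrow> b \<in> dens \<Longrightarrow> frac a b = \<zero>\<^bsub>fracs\<^esub> \<longleftrightarrow> a \<in> Q"
  by (simp add: frac_zero frac_eq_iff frac_closed)

lemma field_fracs: "field fracs"
proof (rule cring.cring_fieldI2)
  show "cring fracs"
  proof (rule cringI)
    show "abelian_group fracs"
    proof (rule abelian_groupI)
      fix x assume "x \<in> carrier fracs"
      then obtain a b where x: "a \<in> R" "b \<in> dens" "x = frac a b" by (rule fracs_cases)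
      show "\<exists>y\<in>carrier fracs. y \<oplus>\<^bsub>fracs\<^esub> x = \<zero>\<^bsub>fracs\<^esub>"
        using x by (intro bexI[of _ "frac (- a) b"])
          (auto simp: frac_add frac_eq_zero frac_carrier frac_closed Q_zero)
    qed (auto elim!: fracs_cases simp: frac_add frac_zero frac_closed frac_carrier algebra_simps
        intro!: frac_eqI)
    show "Group.comm_monoid fracs"
      by (rule comm_monoidI) (auto elim!: fracs_cases simp: frac_mult frac_one frac_closed frac_carrier
        algebra_simps intro!: frac_eqI)
    fix x y z assume "x \<in> carrier fracs" "y \<in> carrier fracs" "z \<in> carrier fracs"
    then show "(x \<oplus>\<^bsub>fracs\<^esub> y) \<otimes>\<^bsub>fracs\<^esub> z = x \<otimes>\<^bsub>fracs\<^esub> z \<oplus>\<^bsub>fracs\<^esub> y \<otimes>\<^bsub>fracs\<^esub> z"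
      by (auto elim!: fracs_cases simp: frac_mult frac_add frac_closed algebra_simps intro!: frac_eqI)
  qed
  show "\<zero>\<^bsub>fracs\<^esub> \<noteq> \<one>\<^bsub>fracs\<^esub>"
    using frac_eq_zero[of 1 1] one_dens by (metis DiffD2 dens_def R_one frac_one)
  fix x assume "x \<in> carrier fracs" "x \<noteq> \<zero>\<^bsub>fracs\<^esub>"
  then obtain a b where x: "a \<in> R" "b \<in> dens" "x = frac a b" "a \<in> dens"
    by (metis DiffI dens_def frac_eq_zero fracs_cases)
  then show "\<exists>y\<in>carrier fracs. x \<otimes>\<^bsub>fracs\<^esub> y = \<one>\<^bsub>fracs\<^esub>"
    by (intro bexI[of _ "frac b a"])
      (auto simp: frac_mult frac_one frac_closed frac_carrier mult.commute intro!: frac_eqI)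
qed

definition frac_derivs :: "('r \<times> 'r \<Rightarrow> 'r \<times> 'r) list" where
  "frac_derivs = map frac_deriv [0..<k]"

lemma differential_field_fracs: "differential_field_on fracs frac_derivs"
  unfolding differential_field_on_def frac_derivs_def
proof (intro conjI ballI field_fracs)
  fix d assume "d \<in> set (map frac_deriv [0..<k])"
  then obtain j where j: "j < k" and d: "d = frac_deriv j" by auto
  show "derivation_on fracs d"
    unfolding derivation_on_def d
    using j by (auto elim!: fracs_cases simp: frac_mult frac_add frac_deriv frac_closed frac_carrier deriv_add deriv_mult
        algebra_simps intro!: frac_eqI)
next
  fix d d' x assume "d \<in> set (map frac_deriv [0..<k])" "d' \<in> set (map frac_deriv [0..<k])"
    and x: "x \<in> carrier fracs"
  then obtain i j where ij: "i < k" "j < k" and d: "d = frac_deriv i" "d' = frac_deriv j"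
    by auto
  show "d (d' x) = d' (d x)"
    using x ij unfolding d
    by (auto elim!: fracs_cases simp: frac_deriv frac_closed deriv_mult deriv_diff
        deriv_commute[of i j] algebra_simps intro!: frac_eqI)
qed

lemma frac_deriv_one: "j < k \<Longrightarrow> a \<in> R \<Longrightarrow> frac_deriv j (frac a 1) = frac (D j a) 1"
  by (simp add: frac_deriv frac_closed deriv_one)

end

lemma dfraction_field_prime_dideal:
  fixes ds :: "('a::field_char_0 \<Rightarrow> 'a) list"
  assumes K: "differential_field ds" and Q: "prime_dideal ds n Q"
  shows "dfraction_field (dpolys ds n) Q (dpoly_deriv ds) (length ds)"
proof -
  have D: "differential_ideal ds n Q" using Q by (simp add: prime_dideal_def)
  note D' = differential_idealD[OF D]
  show ?thesis
  proof
    show "Q \<subseteq> dpolys ds n" using D'(1) by blast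
    show "\<And>a b. a \<in> dpolys ds n \<Longrightarrow> b \<in> dpolys ds n \<Longrightarrow> a * b \<in> Q \<Longrightarrow> a \<in> Q \<or> b \<in> Q"
      using Q unfolding prime_dideal_def by blast
    show "1 \<notin> Q" using Q by (simp add: prime_dideal_def)
  qed (simp_all add: dpolys_closed dpolys_mult dpolys_deriv[OF K] D' dpoly_deriv_commute[OF K]
      derivation_dpoly_deriv differential_field_nth[OF K])
qed

lemma dpolys_sum: "(\<And>i. i \<in> A \<Longrightarrow> f i \<in> dpolys ds n) \<Longrightarrow> sum f A \<in> dpolys ds n"
  by (simp add: dpolys_eq polys_in_sum)

lemma dpolys_single:
  "(\<And>v. v \<in> keys M \<Longrightarrow> v \<in> dvars (length ds) n) \<Longrightarrow> single M c \<in> dpolys ds n"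
  by (auto simp: dpolys_eq intro: polys_in_single)

lemma dpolys_keys:
  "p \<in> dpolys ds n \<Longrightarrow> M \<in> keys p \<Longrightarrow> v \<in> keys M \<Longrightarrow> v \<in> dvars (length ds) n"
  by (auto simp: dpolys_eq polys_in_def)

locale generic_point =
  fixes ds :: "('a::field_char_0 \<Rightarrow> 'a) list" and n :: nat and Q :: "'a dpoly set"
  assumes K: "differential_field ds" and Q: "prime_dideal ds n Q"
begin

sublocale dfraction_field "dpolys ds n" Q "dpoly_deriv ds" "length ds"
  by (rule dfraction_field_prime_dideal[OF K Q])

lemma differential_extension_fracs:
  "differential_extension ds fracs frac_derivs (\<lambda>c. frac (pconst c) 1)"
  unfolding differential_extension_def
proof (intro conjI allI impI differential_field_fracs)
  show "length frac_derivs = length ds"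
    by (simp add: frac_derivs_def)
  show "(\<lambda>c. frac (pconst c) 1) \<in> ring_hom field_record fracs"
    by (auto simp: ring_hom_def field_record_def frac_carrier frac_mult frac_add frac_one frac_closed dpolys_closed pconst_hom)
  fix j a assume j: "j < length ds"
  then show "frac (pconst ((ds ! j) a)) 1 = (frac_derivs ! j) (frac (pconst a) 1)"
    by (simp add: frac_derivs_def frac_deriv_one dpolys_closed dpoly_deriv_const differential_field_nth[OF K])
qed

definition point :: "('a dpoly \<times> 'a dpoly) list" where
  "point = map (\<lambda>i. frac (pvar (i, 0)) 1) [0..<n]"

lemma dop_generic_point:
  assumes v: "v \<in> dvars (length ds) n"
  shows "dop frac_derivs (snd v) (point ! fst v) = frac (pvar v) 1"
proof -
  let ?\<theta> = "snd v"
  have deriv: "(frac_derivs ! j) (frac (pvar w) 1) = frac (pvar (shift j w)) 1"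
    if j: "j < length ds" and w: "w \<in> dvars (length ds) n" for j w
    using j w by (simp add: frac_derivs_def frac_deriv_one dpolys_var dpoly_deriv_var
        differential_field_nth[OF K])
  have pow: "((frac_derivs ! j) ^^ k) (frac (pvar w) 1) = frac (pvar (fst w, snd w + single j k)) 1 \<and>
      (fst w, snd w + single j k) \<in> dvars (length ds) n"
    if j: "j < length ds" and w: "w \<in> dvars (length ds) n" for j w k
  proof (induction k)
    case (Suc k)
    have "(fst w, snd w + single j (Suc k)) =
        shift j (fst w, snd w + single j k)"
      by (simp add: shift_def add.assoc single_add[symmetric])
    then show ?case
      using Suc deriv[OF j, of "(fst w, snd w + single j k)"]
        shift_in_dvars[OF _ j, of "(fst w, snd w + single j k)"] by simp
  qed (use w in simp)
  have fold: "foldr (\<lambda>j. (frac_derivs ! j) ^^ lookup ?\<theta> j) js (frac (pvar (fst v, 0)) 1) =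
      frac (pvar (fst v, \<Sum>j\<leftarrow>js. single j (lookup ?\<theta> j))) 1 \<and>
      (fst v, \<Sum>j\<leftarrow>js. single j (lookup ?\<theta> j)) \<in> dvars (length ds) n"
    if "set js \<subseteq> {..<length ds}" for js
    using that
  proof (induction js)
    case Nil
    then show ?case using v by (simp add: dvars_def)
  next
    case (Cons j js)
    then show ?case
      using pow[of j "(fst v, \<Sum>j\<leftarrow>js. single j (lookup ?\<theta> j))" "lookup ?\<theta> j"]
      by (simp add: add.commute)
  qed
  have "(\<Sum>j\<leftarrow>[0..<length ds]. single j (lookup ?\<theta> j)) =
      (\<Sum>j\<in>{..<length ds}. single j (lookup ?\<theta> j))"
    by (simp add: sum_list_distinct_conv_sum_set atLeast0LessThan)
  also have "\<dots> = (\<Sum>j\<in>keys ?\<theta>. single j (lookup ?\<theta> j))"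
    using v by (intro sum.mono_neutral_right) (auto simp: dvars_def in_keys_iff)
  finally have "(\<Sum>j\<leftarrow>[0..<length ds]. single j (lookup ?\<theta> j)) = ?\<theta>"
    by (simp add: dpoly_sum_single)
  with fold[of "[0..<length ds]"] show ?thesis
    using v by (simp add: dop_def point_def dvars_def frac_derivs_def atLeast0LessThan)
qed

text \<open>Evaluation at the residue classes of the indeterminates is the passage to the residue
  class, so the polynomials vanishing at this point are exactly those in \<open>Q\<close>.\<close>

lemma dpoly_eval_generic_point:
  assumes p: "p \<in> dpolys ds n"
  shows "dpoly_eval_on fracs frac_derivs (\<lambda>c. frac (pconst c) 1) p point = frac p 1"
proof -
  interpret F: field fracs by (rule field_fracs)
  have pow: "frac a 1 [^]\<^bsub>fracs\<^esub> k = frac (a ^ k) 1" if "a \<in> dpolys ds n" for a and k :: nat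
    using that by (induction k) (simp_all add: frac_one frac_mult frac_closed dpolys_closed mult.commute)
  have prod: "(\<Otimes>\<^bsub>fracs\<^esub>i\<in>A. frac (f i) 1) = frac (\<Prod>i\<in>A. f i) 1"
    if "finite A" "\<And>i. i \<in> A \<Longrightarrow> f i \<in> dpolys ds n" for A :: "dvar set" and f
    using that
    by (induction A) (simp_all add: frac_one frac_mult frac_closed dpolys_closed frac_carrier Pi_iff dpolys_prod)
  have sum: "(\<Oplus>\<^bsub>fracs\<^esub>i\<in>A. frac (f i) 1) = frac (\<Sum>i\<in>A. f i) 1"
    if "finite A" "\<And>i. i \<in> A \<Longrightarrow> f i \<in> dpolys ds n" for A :: "(dvar \<Rightarrow>\<^sub>0 nat) set" and f
    using that
    by (induction A) (simp_all add: frac_zero frac_add frac_closed dpolys_closed frac_carrier Pi_iff dpolys_sum)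
  have mon: "frac (pconst (lookup p M)) 1 \<otimes>\<^bsub>fracs\<^esub>
      (\<Otimes>\<^bsub>fracs\<^esub>v\<in>keys M.
        dop frac_derivs (snd v) (point ! fst v) [^]\<^bsub>fracs\<^esub> lookup M v) =
      frac (single M (lookup p M)) 1" if M: "M \<in> keys p" for M
  proof -
    have v: "v \<in> dvars (length ds) n" if "v \<in> keys M" for v
      using p M that by (rule dpolys_keys)
    have "(\<Otimes>\<^bsub>fracs\<^esub>v\<in>keys M.
        dop frac_derivs (snd v) (point ! fst v) [^]\<^bsub>fracs\<^esub> lookup M v) =
        (\<Otimes>\<^bsub>fracs\<^esub>v\<in>keys M. frac (pvar v ^ lookup M v) 1)"
      using v by (intro F.finprod_cong')
        (auto simp: dop_generic_point pow dpolys_var frac_carrier frac_closed dpolys_closed)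
    also have "\<dots> = frac (\<Prod>v\<in>keys M. pvar v ^ lookup M v) 1"
      using v by (intro prod) (auto simp: dpolys_var frac_closed dpolys_closed)
    also have "(\<Prod>v\<in>keys M. pvar v ^ lookup M v) =
        (single M 1 :: 'a dpoly)"
    proof -
      have "(\<Prod>v\<in>A. pvar v ^ lookup M v) =
          (single (\<Sum>v\<in>A. single v (lookup M v)) 1 :: 'a dpoly)"
        if "finite A" for A
        using that by (induction A) (simp_all add: pvar_power mult_single)
      from this[of "keys M"] show ?thesis
        by (simp add: dpoly_sum_single)
    qed
    finally show ?thesis
      using v by (simp add: frac_mult frac_closed dpolys_closed dpolys_single)
        (simp add: pconst_def mult_single)
  qed
  have "dpoly_eval_on fracs frac_derivs (\<lambda>c. frac (pconst c) 1) p point =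
      (\<Oplus>\<^bsub>fracs\<^esub>M\<in>keys p. frac (single M (lookup p M)) 1)"
    unfolding dpoly_eval_on_def using p
    by (intro F.finsum_cong')
      (auto simp only: mon Pi_iff intro!: frac_carrier one_dens dpolys_single dpolys_keys)
  also have "\<dots> = frac (\<Sum>M\<in>keys p. single M (lookup p M)) 1"
    using p by (intro sum) (auto intro!: dpolys_single dpolys_keys)
  finally show ?thesis by (simp add: dpoly_sum_single)
qed

lemma generic_point_solution:
  assumes "E \<subseteq> Q" "N \<subseteq> dpolys ds n - Q"
  shows "solution_on fracs frac_derivs (\<lambda>c. frac (pconst c) 1) n E N point"
  unfolding solution_on_def using assms Q_subset
  by (auto simp: dpoly_eval_generic_point frac_eq_zero one_dens subset_iff)
    (auto simp: point_def dvars_def intro!: frac_carrier dpolys_var one_dens)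

end

text \<open>The generic point solves the system in a field whose elements are pairs of differential
  polynomials, hence the recourse to \<open>differentially_closed_imp_solution\<close>. Only
  finitely many elements of \<open>Q\<close> can be imposed at this stage.\<close>

lemma prime_dideal_finite_solution:
  fixes ds :: "('a::field_char_0 \<Rightarrow> 'a) list"
  assumes "differential_field ds" "differentially_closed ds" "prime_dideal ds n Q"
    and "finite E" "E \<subseteq> Q" "finite N" "N \<subseteq> dpolys ds n - Q"
  shows "\<exists>x. solution ds n E N x"
proof -
  interpret generic_point ds n Q
    using assms by unfold_locales
  have "E \<subseteq> dpolys ds n" using assms(5) Q_subset by blast
  then show ?thesis
    using differentially_closed_imp_solution[OF assms(2) differential_extension_fracs
        generic_point_solution[OF assms(5,7)]] assms by blast
qed

section \<open>Algebraic relations over a subring modulo a prime ideal\<close>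

definition polys_over :: "'r::comm_ring_1 set \<Rightarrow> 'r poly set" where
  "polys_over C = {q. \<forall>k. coeff q k \<in> C}"

definition subring_of :: "'r::comm_ring_1 set \<Rightarrow> bool" where
  "subring_of C \<longleftrightarrow> 0 \<in> C \<and> 1 \<in> C \<and> (\<forall>a\<in>C. \<forall>b\<in>C. a + b \<in> C \<and> a - b \<in> C \<and> a * b \<in> C)"

lemma subring_ofD:
  assumes "subring_of C"
  shows "0 \<in> C" "1 \<in> C" "a \<in> C \<Longrightarrow> b \<in> C \<Longrightarrow> a + b \<in> C" "a \<in> C \<Longrightarrow> b \<in> C \<Longrightarrow> a - b \<in> C"
    "a \<in> C \<Longrightarrow> b \<in> C \<Longrightarrow> a * b \<in> C"
  using assms by (auto simp: subring_of_def)

lemma subring_of_power: "subring_of C \<Longrightarrow> a \<in> C \<Longrightarrow> a ^ k \<in> C"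
  by (induction k) (simp_all add: subring_ofD)

lemma subring_of_sum: "subring_of C \<Longrightarrow> (\<And>i. i \<in> A \<Longrightarrow> f i \<in> C) \<Longrightarrow> sum f A \<in> C"
  by (induction A rule: infinite_finite_induct) (simp_all add: subring_ofD)

lemma subring_of_of_nat: "subring_of C \<Longrightarrow> of_nat k \<in> C"
  by (induction k) (simp_all add: subring_ofD)

lemma polys_overD: "q \<in> polys_over C \<Longrightarrow> coeff q k \<in> C"
  by (simp add: polys_over_def)

lemma polys_over_add: "subring_of C \<Longrightarrow> p \<in> polys_over C \<Longrightarrow> q \<in> polys_over C \<Longrightarrow> p + q \<in> polys_over C"
  by (simp add: polys_over_def subring_ofD)

lemma polys_over_diff: "subring_of C \<Longrightarrow> p \<in> polys_over C \<Longrightarrow> q \<in> polys_over C \<Longrightarrow> p - q \<in> polys_over C"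
  by (simp add: polys_over_def subring_ofD)

lemma polys_over_mult: "subring_of C \<Longrightarrow> p \<in> polys_over C \<Longrightarrow> q \<in> polys_over C \<Longrightarrow> p * q \<in> polys_over C"
  by (simp add: polys_over_def Polynomial.coeff_mult subring_of_sum subring_ofD)

lemma polys_over_smult: "subring_of C \<Longrightarrow> c \<in> C \<Longrightarrow> q \<in> polys_over C \<Longrightarrow> smult c q \<in> polys_over C"
  by (simp add: polys_over_def subring_ofD)

lemma polys_over_monom: "subring_of C \<Longrightarrow> c \<in> C \<Longrightarrow> monom c k \<in> polys_over C"
  by (simp add: polys_over_def subring_ofD Polynomial.coeff_monom)

lemma polys_over_pderiv: "subring_of C \<Longrightarrow> q \<in> polys_over C \<Longrightarrow> pderiv q \<in> polys_over C"
  for q :: "'r::idom poly"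
  by (simp add: polys_over_def coeff_pderiv subring_ofD subring_of_of_nat del: of_nat_Suc)

lemma polys_over_mono: "C \<subseteq> C' \<Longrightarrow> polys_over C \<subseteq> polys_over C'"
  by (auto simp: polys_over_def)

lemma poly_over_closed: "subring_of C \<Longrightarrow> q \<in> polys_over C \<Longrightarrow> a \<in> C \<Longrightarrow> poly q a \<in> C"
  by (simp add: poly_altdef polys_over_def subring_of_sum subring_ofD subring_of_power)

text \<open>Each step multiplies by the leading coefficient of \<open>g\<close> rather than dividing
  by it, so quotient and remainder keep their coefficients in the subring \<open>C\<close>.\<close>

lemma pseudo_division:
  fixes g p :: "'r::comm_ring_1 poly"
  assumes C: "subring_of C" and g: "g \<in> polys_over C" "degree g > 0" and p: "p \<in> polys_over C"
  obtains k q r where "q \<in> polys_over C" "r \<in> polys_over C" "degree r < degree g"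
    "smult (lead_coeff g ^ k) p = q * g + r"
proof -
  have "\<exists>k q r. q \<in> polys_over C \<and> r \<in> polys_over C \<and> degree r < degree g \<and>
    smult (lead_coeff g ^ k) p = q * g + r"
    using p
  proof (induction "degree p" arbitrary: p rule: less_induct)
    case less
    let ?l = "lead_coeff g" and ?d = "degree g" and ?e = "degree p"
    show ?case
    proof (cases "?e < ?d")
      case True
      have "0 \<in> polys_over C" using C by (simp add: polys_over_def subring_ofD)
      then show ?thesis
        using less.prems True by (intro exI[of _ 0] exI[of _ p]) simp
    next
      case False
      define s where "s = monom (lead_coeff p) (?e - ?d)"
      have s: "s \<in> polys_over C"
        unfolding s_def by (intro polys_over_monom C polys_overD less.prems)
      let ?p = "smult ?l p - s * g"
      have p': "?p \<in> polys_over C"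
        using s g less.prems by (intro polys_over_diff polys_over_smult polys_over_mult C polys_overD)
      have "degree (s * g) \<le> ?e"
        using False Polynomial.degree_mult_le[of s g] Polynomial.degree_monom_le[of "lead_coeff p" "?e - ?d"]
        unfolding s_def by linarith
      then have "degree ?p \<le> ?e"
        by (intro degree_diff_le Polynomial.degree_smult_le)
      moreover have "coeff ?p ?e = 0"
      proof -
        have "coeff (s * g) ?e = coeff (s * g) ((?e - ?d) + ?d)"
          using False by simp
        also have "\<dots> = lead_coeff p * ?l"
          unfolding s_def Polynomial.coeff_monom_mult by simp
        finally show ?thesis by simp
      qed
      ultimately have "degree ?p < ?e"
        using False g(2) by (metis Polynomial.degree_0 Polynomial.leading_coeff_0_iff bot_nat_0.not_eq_extremum
            le_neq_implies_less less_nat_zero_code not_less)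
      from less.hyps[OF this p'] obtain k q r where IH: "q \<in> polys_over C" "r \<in> polys_over C"
        "degree r < ?d" "smult (?l ^ k) ?p = q * g + r"
        by blast
      have "smult (?l ^ Suc k) p = smult (?l ^ k) ?p + smult (?l ^ k) s * g"
        by (simp add: Polynomial.smult_diff_right mult.commute)
      also have "\<dots> = (q + smult (?l ^ k) s) * g + r"
        by (simp only: IH(4)) (simp add: algebra_simps)
      finally have "smult (?l ^ Suc k) p = (q + smult (?l ^ k) s) * g + r" .
      moreover have "q + smult (?l ^ k) s \<in> polys_over C"
        using IH s g by (intro polys_over_add polys_over_smult C subring_of_power polys_overD)
      ultimately show ?thesis using IH by blast
    qed
  qed
  then show thesis using that by blast
qed

text \<open>An equation for \<open>x\<close> over \<open>C\<close> that stays nontrivial modulo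
  \<open>P\<close>: the leading coefficient is nonzero in the residue ring, so it witnesses
  algebraic dependence there.\<close>

definition relation :: "'r::comm_ring_1 set \<Rightarrow> 'r set \<Rightarrow> 'r \<Rightarrow> 'r poly \<Rightarrow> bool" where
  "relation C P x q \<longleftrightarrow>
     q \<in> polys_over C \<and> poly q x \<in> P \<and> degree q > 0 \<and> lead_coeff q \<notin> P"

text \<open>Leading terms with coefficient in \<open>P\<close> are dropped one after another. The
  coefficient at \<open>i\<close> survives, being outside \<open>P\<close>, so the process ends with
  a leading coefficient outside \<open>P\<close>. The degree is then positive, since a constant with
  value in \<open>P\<close> would lie in \<open>P\<close>.\<close>

lemma relation_exists:
  fixes q :: "'r::comm_ring_1 poly"
  assumes C: "subring_of C" "C \<subseteq> R" and R: "subring_of R" "x \<in> R"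
    and P: "0 \<in> P" "\<And>a b. a \<in> P \<Longrightarrow> b \<in> P \<Longrightarrow> a - b \<in> P" "\<And>a b. a \<in> R \<Longrightarrow> b \<in> P \<Longrightarrow> a * b \<in> P"
    and q: "q \<in> polys_over C" "poly q x \<in> P" "coeff q i \<notin> P"
  shows "\<exists>q'. relation C P x q' \<and> degree q' \<le> degree q"
  using q
proof (induction "degree q" arbitrary: q rule: less_induct)
  case less
  let ?n = "degree q"
  show ?case
  proof (cases "lead_coeff q \<in> P")
    case False
    have "?n > 0"
    proof (rule ccontr)
      assume "\<not> ?n > 0"
      then obtain c where "q = [:c:]" by (metis degree_eq_zeroE neq0_conv)
      with less.prems False show False by simp
    qed
    then show ?thesis
      using less.prems False by (auto simp: relation_def)
  next
    case True
    have "?n > 0"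
    proof (rule ccontr)
      assume "\<not> ?n > 0"
      then have "coeff q i \<in> P"
        using True P(1) Polynomial.coeff_eq_0[of q i] by (cases i) auto
      with less.prems show False by simp
    qed
    let ?q = "q - monom (lead_coeff q) ?n"
    have q': "?q \<in> polys_over C"
      using less.prems by (intro polys_over_diff polys_over_monom C polys_overD)
    have "x ^ ?n * lead_coeff q \<in> P"
      using True R by (intro P(3) subring_of_power)
    then have "poly ?q x \<in> P"
      using less.prems P(2) by (simp add: poly_monom mult.commute)
    moreover have "coeff ?q i \<notin> P"
      using less.prems True P(1) by (cases "i = ?n") (auto simp: Polynomial.coeff_monom)
    moreover have "degree ?q < ?n"
    proof -
      have "degree ?q \<le> ?n"
        by (intro degree_diff_le Polynomial.degree_monom_le) simp
      moreover have "coeff ?q ?n = 0" by simp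
      ultimately show ?thesis
        using \<open>?n > 0\<close> by (metis Polynomial.degree_0 Polynomial.leading_coeff_0_iff le_neq_implies_less)
    qed
    ultimately show ?thesis
      using less.hyps[of ?q] q' by (meson le_trans less_imp_le)
  qed
qed

section \<open>Rankings\<close>

text \<open>An orderly ranking, by the order of the derivative first; every derivative then has finite rank.\<close>

lemma ranking_exists:
  obtains \<rho> :: "dvar \<Rightarrow> nat" where "inj_on \<rho> (dvars k N)"
    "\<And>u v j. u \<in> dvars k N \<Longrightarrow> v \<in> dvars k N \<Longrightarrow> j < k \<Longrightarrow> \<rho> u < \<rho> v \<Longrightarrow> \<rho> (shift j u) < \<rho> (shift j v)"
    "\<And>v j. v \<in> dvars k N \<Longrightarrow> j < k \<Longrightarrow> \<rho> v < \<rho> (shift j v)"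
proof -
  define ord where "ord = (\<lambda>v :: dvar. \<Sum>j<k. lookup (snd v) j)"
  \<comment> \<open>Ties in the order of the derivative are broken by the linear order of pairs,
    which is compatible with adding \<open>single j 1\<close>. Only finitely many derivatives
    precede a given one, and their number is its rank.\<close>
  define key where "key = (\<lambda>v. (ord v, v))"
  define below where "below = (\<lambda>v. {u \<in> dvars k N. key u < key v})"
  have ord_shift: "ord (shift j v) = Suc (ord v)" if "j < k" for j v
    using that by (simp add: ord_def shift_def lookup_add lookup_single when_def sum.distrib)
  have finite_ord: "finite {u \<in> dvars k N. ord u \<le> d}" for d
  proof (rule inj_on_finite)
    let ?f = "\<lambda>u :: dvar. (fst u, restrict (lookup (snd u)) {..<k})"
    show "finite ({..<N} \<times> ({..<k} \<rightarrow>\<^sub>E {..d}))"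
      by (intro finite_cartesian_product finite_PiE) simp_all
    show "?f ` {u \<in> dvars k N. ord u \<le> d} \<subseteq> {..<N} \<times> ({..<k} \<rightarrow>\<^sub>E {..d})"
    proof -
      have "lookup (snd u) j \<le> d" if "ord u \<le> d" "j < k" for u j
        using member_le_sum[of j "{..<k}" "\<lambda>j. lookup (snd u) j"] that
        by (simp add: ord_def)
      then show ?thesis by (intro image_subsetI) (simp add: dvars_def restrict_PiE_iff)
    qed
    show "inj_on ?f {u \<in> dvars k N. ord u \<le> d}"
    proof (rule inj_onI)
      fix u v assume u: "u \<in> {u \<in> dvars k N. ord u \<le> d}" and v: "v \<in> {u \<in> dvars k N. ord u \<le> d}"
        and eq: "?f u = ?f v"
      have "lookup (snd u) j = lookup (snd v) j" for j
      proof (cases "j < k")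
        case True
        then show ?thesis using eq by (metis Pair_inject lessThan_iff restrict_apply')
      next
        case False
        then have "j \<notin> keys (snd u)" "j \<notin> keys (snd v)"
          using u v by (auto simp: dvars_def)
        then show ?thesis by (simp add: in_keys_iff)
      qed
      then have "snd u = snd v" by (rule poly_mapping_eqI)
      then show "u = v" using eq by (simp add: prod_eq_iff)
    qed
  qed
  have finite: "finite (below v)" for v
    by (rule finite_subset[OF _ finite_ord[of "ord v"]]) (auto simp: below_def key_def)
  have mono: "card (below u) < card (below v)" if "u \<in> dvars k N" "key u < key v" for u v
    using that finite by (intro psubset_card_mono) (auto simp: below_def)
  have iff: "card (below u) < card (below v) \<longleftrightarrow> key u < key v" if "u \<in> dvars k N" "v \<in> dvars k N" for u v
  proof (cases rule: linorder_cases[of "key u" "key v"])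
    case equal
    then have "u = v" by (simp add: key_def)
    then show ?thesis by simp
  qed (use mono[of u v] mono[of v u] that in auto)
  show thesis
  proof
    show "inj_on (\<lambda>v. card (below v)) (dvars k N)"
    proof (rule inj_onI)
      fix u v assume "u \<in> dvars k N" "v \<in> dvars k N" "card (below u) = card (below v)"
      then have "key u = key v" using iff[of u v] iff[of v u] linorder_less_linear[of "key u" "key v"] by auto
      then show "u = v" by (simp add: key_def)
    qed
    show "card (below v) < card (below (shift j v))" if "v \<in> dvars k N" "j < k" for v j
      using that by (intro mono) (simp_all add: key_def ord_shift)
    fix u v j assume uv: "u \<in> dvars k N" "v \<in> dvars k N" and j: "j < k"
      and "card (below u) < card (below v)"
    then have "key u < key v" by (simp add: iff)
    then have "key (shift j u) < key (shift j v)"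
      using j by (auto simp: key_def ord_shift) (auto simp: shift_def less_prod_def)
    then show "card (below (shift j u)) < card (below (shift j v))"
      using uv j by (intro mono shift_in_dvars)
  qed
qed

section \<open>Dickson's lemma for derivatives\<close>

text \<open>A decreasing sequence of natural numbers is constant from the place of its minimum on,
  hence weakly increasing there.\<close>

lemma nat_seq_mono_subseq:
  fixes a :: "nat \<Rightarrow> nat"
  obtains r :: "nat \<Rightarrow> nat" where "strict_mono r" "mono (\<lambda>n. a (r n))"
proof -
  obtain f where f: "strict_mono f" "monoseq (\<lambda>n. a (f n))"
    using seq_monosub[of a] by blast
  show thesis
  proof (cases "incseq (\<lambda>n. a (f n))")
    case True
    then show ?thesis by (rule that[OF f(1)])
  next
    case False
    then have dec: "decseq (\<lambda>n. a (f n))" using f(2) monoseq_iff by blast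
    obtain N where N: "\<And>n. a (f N) \<le> a (f n)"
      using ex_has_least_nat[of "\<lambda>_. True" 0 "\<lambda>n. a (f n)"] by auto
    have "a (f (N + n)) = a (f N)" for n
      using decseqD[OF dec, of N "N + n"] N[of "N + n"] by simp
    then have "mono (\<lambda>n. a (f (N + n)))" by (simp add: mono_def)
    moreover have "strict_mono (\<lambda>n. f (N + n))"
      using f(1) by (simp add: strict_mono_def)
    ultimately show ?thesis by (intro that)
  qed
qed

text \<open>Infinitely many elements concern the same indeterminate. Passing to a subsequence for
  one derivation after another makes all exponents weakly increasing, and then the first two terms
  are comparable.\<close>

lemma dickson:
  assumes "infinite L" "L \<subseteq> dvars k N"
  shows "\<exists>u\<in>L. \<exists>v\<in>L. u \<noteq> v \<and> fst u = fst v \<and>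
    (\<forall>j. lookup (snd u) j \<le> lookup (snd v) j)"
proof -
  obtain i where "infinite {u \<in> L. fst u = i}"
  proof (rule ccontr)
    assume "\<not> thesis"
    then have "finite (\<Union>i<N. {u \<in> L. fst u = i})" using that by blast
    moreover have "L \<subseteq> (\<Union>i<N. {u \<in> L. fst u = i})" using assms(2) by (auto simp: dvars_def)
    ultimately show False using assms(1) finite_subset by blast
  qed
  then obtain e :: "nat \<Rightarrow> dvar" where e: "inj e" "range e \<subseteq> {u \<in> L. fst u = i}"
    using infinite_countable_subset by blast
  have "\<exists>r :: nat \<Rightarrow> nat. strict_mono r \<and> (\<forall>j<l. mono (\<lambda>n. lookup (snd (e (r n))) j))" for l
  proof (induction l)
    case 0
    show ?case by (intro exI[of _ "\<lambda>n. n"]) (simp add: strict_mono_def)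
  next
    case (Suc l)
    then obtain r :: "nat \<Rightarrow> nat" where r: "strict_mono r" "\<And>j. j < l \<Longrightarrow> mono (\<lambda>n. lookup (snd (e (r n))) j)"
      by blast
    obtain s :: "nat \<Rightarrow> nat" where s: "strict_mono s" "mono (\<lambda>n. lookup (snd (e (r (s n)))) l)"
      by (rule nat_seq_mono_subseq[of "\<lambda>n. lookup (snd (e (r n))) l"])
    have "mono (\<lambda>n. lookup (snd (e (r (s n)))) j)" if "j < Suc l" for j
    proof (cases "j = l")
      case False
      then have "mono (\<lambda>n. lookup (snd (e (r n))) j)"
        using r(2)[of j] that by simp
      then show ?thesis
        using strict_mono_mono[OF s(1)] unfolding mono_def by blast
    qed (use s in simp)
    moreover have "strict_mono (\<lambda>n. r (s n))"
      using r(1) s(1) by (simp add: strict_mono_def)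
    ultimately show ?case by blast
  qed
  then obtain r :: "nat \<Rightarrow> nat" where r: "strict_mono r" "\<And>j. j < k \<Longrightarrow> mono (\<lambda>n. lookup (snd (e (r n))) j)"
    by blast
  have mem: "e l \<in> {u \<in> L. fst u = i}" for l
    using e(2) by blast
  let ?u = "e (r 0)" and ?v = "e (r 1)"
  have "?u \<noteq> ?v"
    using e(1) r(1) by (metis inj_eq strict_mono_eq zero_neq_one)
  moreover have "lookup (snd ?u) j \<le> lookup (snd ?v) j" for j
  proof (cases "j < k")
    case True
    from monoD[OF r(2)[OF this], of 0 1] show ?thesis by simp
  next
    case False
    have "?u \<in> dvars k N" using mem assms(2) by blast
    then have "j \<notin> keys (snd ?u)" using False by (auto simp: dvars_def)
    then show ?thesis by (simp add: in_keys_iff)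
  qed
  moreover have "?u \<in> L" "?v \<in> L" "fst ?u = fst ?v"
    using mem by simp_all
  ultimately show ?thesis by (intro bexI[of _ ?u] bexI[of _ ?v]) simp_all
qed

section \<open>Characteristic sets\<close>

lemma subring_of_polys_in: "subring_of (polys_in U :: 'a::comm_ring_1 dpoly set)"
  by (simp add: subring_of_def polys_in_add polys_in_diff polys_in_mult)

lemma polys_in_insert_poly:
  fixes p :: "'a::comm_ring_1 dpoly"
  assumes "p \<in> polys_in (insert v U)"
  obtains q where "q \<in> polys_over (polys_in U)" "poly q (pvar v) = p"
  using polys_in_insert[OF assms] unfolding polys_over_def by blast

locale ranked_prime =
  fixes ds :: "('a::field_char_0 \<Rightarrow> 'a) list" and m n :: nat and P :: "'a dpoly set" and \<rho> :: "dvar \<Rightarrow> nat"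
  assumes K: "differential_field ds" and prime: "prime_dideal ds (m + n) P"
    and rank_inj: "inj_on \<rho> (dvars (length ds) (m + n))"
    and rank_mono: "\<And>u v j. u \<in> dvars (length ds) (m + n) \<Longrightarrow> v \<in> dvars (length ds) (m + n) \<Longrightarrow>
      j < length ds \<Longrightarrow> \<rho> u < \<rho> v \<Longrightarrow> \<rho> (shift j u) < \<rho> (shift j v)"
    and rank_shift: "\<And>v j. v \<in> dvars (length ds) (m + n) \<Longrightarrow> j < length ds \<Longrightarrow> \<rho> v < \<rho> (shift j v)"
begin

abbreviation "V \<equiv> dvars (length ds) (m + n)"

text \<open>
  The first \<open>m\<close> indeterminates and their derivatives play the role of coefficients; only the derivatives of
  the other indeterminates are ranked.
\<close>

definition xvars :: "dvar set" where
  "xvars = {v \<in> V. m \<le> fst v}"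

text \<open>\<open>seg (\<rho> v)\<close> stops just before \<open>v\<close>. A number that is the
  rank of no element of \<open>xvars\<close> leaves the segment unchanged.\<close>

definition seg :: "nat \<Rightarrow> dvar set" where
  "seg i = dvars (length ds) m \<union> {u \<in> xvars. \<rho> u < i}"

abbreviation "rel v q \<equiv> relation (polys_in (seg (\<rho> v))) P (pvar v) q"

text \<open>The derivatives that are algebraic over the preceding ones modulo \<open>P\<close>; at
  all others the value can be chosen freely.\<close>

definition leader :: "dvar \<Rightarrow> bool" where
  "leader v \<longleftrightarrow> v \<in> xvars \<and> (\<exists>q. rel v q)"

definition min_rel :: "dvar \<Rightarrow> 'a dpoly poly \<Rightarrow> bool" where
  "min_rel v g \<longleftrightarrow> rel v g \<and> (\<forall>q. rel v q \<longrightarrow> degree g \<le> degree q)"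

definition separant :: "dvar \<Rightarrow> 'a dpoly poly \<Rightarrow> 'a dpoly" where
  "separant v g = poly (pderiv g) (pvar v)"

lemma ideal: "differential_ideal ds (m + n) P"
  using prime by (simp add: prime_dideal_def)

lemmas idealD = differential_idealD[OF ideal]

lemma ideal_diff: "p \<in> P \<Longrightarrow> q \<in> P \<Longrightarrow> p - q \<in> P"
  by (rule differential_ideal_diff[OF ideal])

lemma one_notin: "1 \<notin> P"
  using prime by (simp add: prime_dideal_def)

lemma dvars_mono: "i \<le> j \<Longrightarrow> dvars k i \<subseteq> dvars k j"
  by (auto simp: dvars_def)

lemma seg_subset: "seg i \<subseteq> V"
  using dvars_mono[of m "m + n"] by (auto simp: seg_def xvars_def)

lemma seg_mono: "i \<le> j \<Longrightarrow> seg i \<subseteq> seg j"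
  by (auto simp: seg_def)

lemma polys_in_seg: "p \<in> polys_in (seg i) \<Longrightarrow> p \<in> dpolys ds (m + n)"
  using polys_in_mono[OF seg_subset] by (auto simp: dpolys_eq)

lemma xvars_V: "v \<in> xvars \<Longrightarrow> v \<in> V"
  by (simp add: xvars_def)

lemma shift_xvars: "v \<in> xvars \<Longrightarrow> j < length ds \<Longrightarrow> shift j v \<in> xvars"
  using shift_in_dvars[of v "length ds" "m + n" j] by (simp add: xvars_def shift_def)

lemma xvars_notin_seg: "v \<in> xvars \<Longrightarrow> v \<notin> seg (\<rho> v)"
  by (auto simp: seg_def xvars_def dvars_def)

lemma seg_0: "polys_in (seg 0) = dpolys ds m"
  by (simp add: seg_def dpolys_eq)

lemma seg_Suc: "v \<in> xvars \<Longrightarrow> seg (Suc (\<rho> v)) = insert v (seg (\<rho> v))"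
  using rank_inj by (auto simp: seg_def xvars_def inj_on_def less_Suc_eq)

lemma seg_Suc': "(\<And>v. v \<in> xvars \<Longrightarrow> \<rho> v \<noteq> i) \<Longrightarrow> seg (Suc i) = seg i"
  by (auto simp: seg_def less_Suc_eq)

lemma polys_in_seg_exists:
  assumes "p \<in> dpolys ds (m + n)"
  obtains i where "p \<in> polys_in (seg i)"
proof -
  obtain F where F: "finite F" "F \<subseteq> V" "p \<in> polys_in F"
    using assms polys_in_finite unfolding dpolys_eq by blast
  have "F \<subseteq> seg (Suc (Max (insert 0 (\<rho> ` F))))"
  proof
    fix v assume v: "v \<in> F"
    then have "\<rho> v \<le> Max (insert 0 (\<rho> ` F))" using F(1) by (intro Max_ge) auto
    moreover have "v \<in> V" using v F(2) by blast
    ultimately show "v \<in> seg (Suc (Max (insert 0 (\<rho> ` F))))"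
      by (auto simp: seg_def xvars_def dvars_def)
  qed
  then show thesis using that F(3) polys_in_mono by blast
qed

text \<open>Below the least degree of a relation the powers of \<open>v\<close> are linearly
  independent modulo \<open>P\<close>. For a derivative that is no leader the hypothesis
  \<open>none\<close> is vacuous.\<close>

lemma coeff_in_P:
  assumes v: "v \<in> xvars" and q: "q \<in> polys_over (polys_in (seg (\<rho> v)))" "poly q (pvar v) \<in> P"
    and none: "\<And>q'. rel v q' \<Longrightarrow> degree q < degree q'"
  shows "coeff q i \<in> P"
proof (rule ccontr)
  assume "coeff q i \<notin> P"
  moreover have "subring_of (dpolys ds (m + n))"
    unfolding dpolys_eq by (rule subring_of_polys_in)
  moreover have "polys_in (seg (\<rho> v)) \<subseteq> dpolys ds (m + n)"
    using polys_in_seg by blast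
  ultimately obtain q' where "rel v q'" "degree q' \<le> degree q"
    using relation_exists[OF subring_of_polys_in _ _ dpolys_var[OF xvars_V[OF v]] idealD(2) ideal_diff idealD(4) q]
    by blast
  then show False using none by fastforce
qed

lemma relD:
  assumes "rel v g"
  shows "g \<in> polys_over (polys_in (seg (\<rho> v)))" "poly g (pvar v) \<in> P" "degree g > 0"
    "lead_coeff g \<notin> P" "lead_coeff g \<in> dpolys ds (m + n)"
  using assms polys_in_seg by (auto simp: relation_def polys_over_def)

lemma of_nat_mult_notin:
  assumes "p \<in> dpolys ds (m + n)" "p \<notin> P" "k > 0"
  shows "of_nat k * p \<notin> P"
proof
  assume "of_nat k * p \<in> P"
  then have "pconst (inverse (of_nat k)) * (of_nat k * p) \<in> P"
    by (rule idealD(4)[OF dpolys_closed(8)])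
  moreover have "pconst (inverse (of_nat k)) * (of_nat k :: 'a dpoly) = 1"
    unfolding pconst_of_nat[symmetric] pconst_hom(2)[symmetric] using assms(3) by (simp add: pconst_hom)
  ultimately show False using assms(2) by (simp add: mult.assoc[symmetric])
qed

text \<open>The formal derivative has smaller degree than the minimal relation. Were its value in
  \<open>P\<close>, so would be all its coefficients, among them the degree times the leading
  coefficient of \<open>g\<close>, and the degree is invertible in characteristic zero.\<close>

lemma separant_props:
  assumes v: "v \<in> xvars" and g: "min_rel v g"
  shows "separant v g \<in> polys_in (insert v (seg (\<rho> v)))" "separant v g \<in> dpolys ds (m + n) - P"
proof -
  have rel: "rel v g" using g by (simp add: min_rel_def)
  note relD = relD[OF rel]
  let ?C = "polys_in (seg (\<rho> v)) :: 'a dpoly set" and ?C' = "polys_in (insert v (seg (\<rho> v))) :: 'a dpoly set"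
  have pd: "pderiv g \<in> polys_over ?C"
    by (intro polys_over_pderiv subring_of_polys_in relD)
  moreover have "?C \<subseteq> ?C'" by (intro polys_in_mono) blast
  ultimately have "pderiv g \<in> polys_over ?C'" using polys_over_mono by blast
  then show sep: "separant v g \<in> ?C'"
    by (simp add: separant_def poly_over_closed subring_of_polys_in polys_in_pvar)
  have "insert v (seg (\<rho> v)) \<subseteq> V"
    using seg_subset xvars_V[OF v] by blast
  then have "separant v g \<in> dpolys ds (m + n)"
    using sep polys_in_mono unfolding dpolys_eq by blast
  moreover have "separant v g \<notin> P"
  proof
    assume "separant v g \<in> P"
    then have "coeff (pderiv g) (degree g - 1) \<in> P"
      unfolding separant_def using pd v g relD(3)
      by (intro coeff_in_P) (auto simp: min_rel_def degree_pderiv less_le_trans[of _ "degree g"])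
    then have "of_nat (degree g) * lead_coeff g \<in> P"
      using relD(3) by (simp add: coeff_pderiv)
    then show False
      using of_nat_mult_notin[OF relD(5,4,3)] by blast
  qed
  ultimately show "separant v g \<in> dpolys ds (m + n) - P" by blast
qed

lemma seg_shift:
  assumes v: "v \<in> xvars" and j: "j < length ds"
  shows "insert v (seg (\<rho> v)) \<subseteq> seg (\<rho> (shift j v))" "shift j ` seg (\<rho> v) \<subseteq> seg (\<rho> (shift j v))"
proof -
  have "\<rho> v < \<rho> (shift j v)"
    using rank_shift[OF xvars_V[OF v] j] .
  then show "insert v (seg (\<rho> v)) \<subseteq> seg (\<rho> (shift j v))"
    using v by (auto simp: seg_def)
  show "shift j ` seg (\<rho> v) \<subseteq> seg (\<rho> (shift j v))"
  proof (rule image_subsetI)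
    fix u assume "u \<in> seg (\<rho> v)"
    then consider "u \<in> dvars (length ds) m" | "u \<in> xvars" "\<rho> u < \<rho> v"
      by (auto simp: seg_def)
    then show "shift j u \<in> seg (\<rho> (shift j v))"
    proof cases
      case 1
      then show ?thesis using shift_in_dvars[OF _ j] by (simp add: seg_def)
    next
      case 2
      then show ?thesis
        using rank_mono[OF xvars_V xvars_V j] v shift_xvars[OF _ j] by (simp add: seg_def)
    qed
  qed
qed

text \<open>Differentiation turns a relation at \<open>v\<close> into one of degree one at
  \<open>shift j v\<close>, with the separant as leading coefficient. Degree one is minimal because
  relations are nonconstant by definition.\<close>

lemma min_rel_shift:
  assumes v: "v \<in> xvars" and g: "min_rel v g" and j: "j < length ds"
  obtains T where "poly [:T, separant v g:] (pvar (shift j v)) = dpoly_deriv ds j (poly g (pvar v))"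
    "min_rel (shift j v) [:T, separant v g:]"
proof -
  have rel: "rel v g" using g by (simp add: min_rel_def)
  let ?w = "shift j v" and ?S = "separant v g"
  obtain T where T: "T \<in> polys_in (seg (\<rho> ?w))"
    "dpoly_deriv ds j (poly g (pvar v)) = ?S * pvar ?w + T"
    using dpoly_deriv_poly[of ds j g "seg (\<rho> v)" "seg (\<rho> ?w)" v] relD(1)[OF rel] seg_shift[OF v j]
      differential_field_nth[OF K j] by (auto simp: separant_def polys_over_def)
  have S: "?S \<in> polys_in (seg (\<rho> ?w))" "?S \<notin> P"
    using separant_props[OF v g] polys_in_mono[OF seg_shift(1)[OF v j]] by blast+
  then have "?S \<noteq> 0" using idealD(2) by auto
  have eq: "poly [:T, ?S:] (pvar ?w) = dpoly_deriv ds j (poly g (pvar v))"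
    by (simp add: T(2) mult.commute add.commute)
  have "[:T, ?S:] \<in> polys_over (polys_in (seg (\<rho> ?w)))"
    using T(1) S(1) by (simp add: polys_over_def Polynomial.coeff_pCons split: nat.split)
  moreover have "poly [:T, ?S:] (pvar ?w) \<in> P"
    unfolding eq by (rule idealD(6)[OF j relD(2)[OF rel]])
  ultimately have "min_rel ?w [:T, ?S:]"
    using S(2) \<open>?S \<noteq> 0\<close> by (auto simp: min_rel_def relation_def)
  with eq show thesis by (rule that)
qed

lemma leader_min_rel:
  assumes "leader v"
  obtains g where "min_rel v g"
proof -
  obtain q where "rel v q" using assms by (auto simp: leader_def)
  then obtain g where "rel v g" "\<And>q. rel v q \<Longrightarrow> degree g \<le> degree q"
    using ex_has_least_nat[of "rel v" q degree] by blast
  then show thesis using that by (auto simp: min_rel_def)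
qed

lemma leader_shift: "leader v \<Longrightarrow> j < length ds \<Longrightarrow> leader (shift j v)"
  using leader_min_rel[of v] min_rel_shift[of v _ j] shift_xvars[of v j]
  by (metis leader_def min_rel_def)

text \<open>\<open>w\<close> is a derivative of \<open>u\<close>. Lowering one exponent in which it
  exceeds \<open>u\<close> gives a predecessor of smaller rank that is still a derivative of
  \<open>u\<close>, whence the induction.\<close>

lemma leader_multiple:
  assumes u: "leader u" and w: "w \<in> V" "fst w = fst u"
    "\<And>j. lookup (snd u) j \<le> lookup (snd w) j"
  shows "leader w"
    and "w \<noteq> u \<Longrightarrow> \<exists>w' j. leader w' \<and> j < length ds \<and> w = shift j w'"
proof -
  have pred: "\<exists>w' j. j < length ds \<and> w = shift j w' \<and> w' \<in> V \<and> fst w' = fst u \<and>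
      (\<forall>i. lookup (snd u) i \<le> lookup (snd w') i)"
    if w: "w \<in> V" "fst w = fst u" "\<And>j. lookup (snd u) j \<le> lookup (snd w) j" "w \<noteq> u" for w
  proof -
    have "snd w \<noteq> snd u" using w by (metis prod_eqI)
    then obtain j where "lookup (snd u) j \<noteq> lookup (snd w) j"
      by (metis poly_mapping_eqI)
    then have less: "lookup (snd u) j < lookup (snd w) j"
      using w(3)[of j] by simp
    then have "j \<in> keys (snd w)" by (simp add: in_keys_iff)
    then have j: "j < length ds" using w(1) by (auto simp: dvars_def)
    let ?w = "(fst w, snd w - single j 1)"
    have "snd w - single j 1 + single j 1 = snd w"
      using less by (intro poly_mapping_eqI) (auto simp: lookup_add lookup_minus lookup_single when_def)
    then have "w = shift j ?w" by (simp add: shift_def)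
    moreover have "keys (snd w - single j 1) \<subseteq> keys (snd w)"
      by (auto simp: in_keys_iff lookup_minus)
    then have "?w \<in> V"
      using w(1) by (auto simp: dvars_def)
    moreover have "lookup (snd u) i \<le> lookup (snd ?w) i" for i
      using w(3)[of i] less by (auto simp: lookup_minus lookup_single when_def)
    ultimately show ?thesis using j w(2) by (metis fst_conv)
  qed
  have all: "leader w" if "w \<in> V" "fst w = fst u"
    "\<And>j. lookup (snd u) j \<le> lookup (snd w) j" for w
    using that
  proof (induction "\<rho> w" arbitrary: w rule: less_induct)
    case less
    show ?case
    proof (cases "w = u")
      case False
      from pred[OF less.prems False] obtain w' j where w': "j < length ds" "w = shift j w'" "w' \<in> V"
        "fst w' = fst u" "\<And>i. lookup (snd u) i \<le> lookup (snd w') i"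
        by blast
      then have "leader w'"
        using rank_shift[of w' j] by (intro less.hyps) auto
      then show ?thesis using w' leader_shift by blast
    qed (use u in simp)
  qed
  show "leader w" by (rule all[OF w])
  show "\<exists>w' j. leader w' \<and> j < length ds \<and> w = shift j w'" if "w \<noteq> u"
    using pred[OF w that] all by blast
qed

definition min_leaders :: "dvar set" where
  "min_leaders = {v. leader v \<and> (\<forall>u j. leader u \<longrightarrow> j < length ds \<longrightarrow> v \<noteq> shift j u)}"

lemma finite_min_leaders: "finite min_leaders"
proof (rule ccontr)
  assume "infinite min_leaders"
  moreover have "min_leaders \<subseteq> V"
    by (auto simp: min_leaders_def leader_def xvars_def)
  ultimately obtain u v where "u \<in> min_leaders" "v \<in> min_leaders" "u \<noteq> v" "fst u = fst v" "v \<in> V"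
    "\<And>j. lookup (snd u) j \<le> lookup (snd v) j"
    using dickson[of min_leaders] by blast
  then have "leader u" "leader v" "\<exists>w j. leader w \<and> j < length ds \<and> v = shift j w"
    using leader_multiple(2)[of u v] by (simp_all add: min_leaders_def)
  then show False
    using \<open>v \<in> min_leaders\<close> unfolding min_leaders_def by blast
qed

text \<open>Finite data controlling infinitely many leaders: \<open>h\<close> is a common multiple
  of all initials and separants, and the zeros of \<open>A\<close> are zeros of all chosen
  relations. The last clause speaks of points over \<open>K\<close>, where evaluation commutes with
  the derivations.\<close>

definition characteristic :: "'a dpoly \<Rightarrow> 'a dpoly set \<Rightarrow> bool" where
  "characteristic h A \<longleftrightarrow> finite A \<and> A \<subseteq> P \<and> h \<in> dpolys ds (m + n) - P \<and>
     (\<forall>v. leader v \<longrightarrow> (\<exists>g. min_rel v g \<and> lead_coeff g dvd h \<and> separant v g dvd h \<and>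
        (\<forall>x. (\<forall>a\<in>A. dpoly_eval ds a x = 0) \<longrightarrow> dpoly_eval ds (poly g (pvar v)) x = 0)))"

text \<open>Only the minimal leaders contribute factors to \<open>h\<close>. At any other leader the
  derivative of a lower relation serves; its initial and its separant both equal the separant of the
  lower relation, which divides \<open>h\<close> already.\<close>

lemma characteristic_exists:
  obtains h A where "characteristic h A"
proof -
  have "\<exists>g. min_rel v g" if "v \<in> min_leaders" for v
    using that leader_min_rel unfolding min_leaders_def by blast
  then obtain g where g: "\<And>v. v \<in> min_leaders \<Longrightarrow> min_rel v (g v)"
    by metis
  define h where "h = (\<Prod>v\<in>min_leaders. lead_coeff (g v) * separant v (g v))"
  define A where "A = (\<lambda>v. poly (g v) (pvar v)) ` min_leaders"
  have xvars: "v \<in> xvars" if "v \<in> min_leaders" for v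
    using that by (simp add: min_leaders_def leader_def)
  have rel: "rel v (g v)" if "v \<in> min_leaders" for v
    using g[OF that] by (simp add: min_rel_def)
  have A: "finite A" "A \<subseteq> P"
    using finite_min_leaders relD(2)[OF rel] by (auto simp: A_def)
  have h: "h \<in> dpolys ds (m + n) - P"
    unfolding h_def
  proof (rule prime_dideal_prod[OF prime finite_min_leaders])
    fix v assume v: "v \<in> min_leaders"
    show "lead_coeff (g v) * separant v (g v) \<in> dpolys ds (m + n) - P"
      using relD(4,5)[OF rel[OF v]] separant_props(2)[OF xvars[OF v] g[OF v]] prime
      unfolding prime_dideal_def by (blast intro: dpolys_mult)
  qed
  have "\<exists>g. min_rel v g \<and> lead_coeff g dvd h \<and> separant v g dvd h \<and>
      (\<forall>x. (\<forall>a\<in>A. dpoly_eval ds a x = 0) \<longrightarrow> dpoly_eval ds (poly g (pvar v)) x = 0)"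
    if "leader v" for v
    using that
  proof (induction "\<rho> v" arbitrary: v rule: less_induct)
    case less
    show ?case
    proof (cases "v \<in> min_leaders")
      case True
      then have dvd: "lead_coeff (g v) * separant v (g v) dvd h"
        unfolding h_def by (intro dvd_prodI finite_min_leaders)
      have "lead_coeff (g v) dvd h" "separant v (g v) dvd h"
        using dvd_mult_left[OF dvd] dvd_mult_right[OF dvd] .
      moreover have "poly (g v) (pvar v) \<in> A" using True by (simp add: A_def)
      ultimately show ?thesis using g[OF True] by blast
    next
      case False
      then obtain u j where u: "leader u" "j < length ds" "v = shift j u"
        using less.prems by (auto simp: min_leaders_def)
      have ux: "u \<in> xvars" using u by (simp add: leader_def)
      have "\<rho> u < \<rho> v" using rank_shift[OF xvars_V[OF ux] u(2)] u(3) by simp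
      from less.hyps[OF this u(1)] obtain f where f: "min_rel u f" "separant u f dvd h"
        "\<And>x. (\<forall>a\<in>A. dpoly_eval ds a x = 0) \<Longrightarrow> dpoly_eval ds (poly f (pvar u)) x = 0"
        by blast
      obtain T where T: "poly [:T, separant u f:] (pvar (shift j u)) = dpoly_deriv ds j (poly f (pvar u))"
        "min_rel (shift j u) [:T, separant u f:]"
        by (rule min_rel_shift[OF ux f(1) u(2)])
      have nz: "separant u f \<noteq> 0"
        using separant_props(2)[OF ux f(1)] idealD(2) by auto
      have "separant v [:T, separant u f:] = separant u f"
        by (simp add: separant_def[of v] pderiv_pCons)
      moreover have "lead_coeff [:T, separant u f:] = separant u f"
        using nz by simp
      moreover have "dpoly_eval ds (poly [:T, separant u f:] (pvar v)) x = 0"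
        if "\<forall>a\<in>A. dpoly_eval ds a x = 0" for x
        using f(3)[OF that] derivation_zero[OF differential_field_nth[OF K u(2)]]
        by (simp only: u(3) T(1) dpoly_eval_deriv[OF K u(2)])
      ultimately show ?thesis
        using T(2) u(3) f(2) by (intro exI[of _ "[:T, separant u f:]"]) simp
    qed
  qed
  with A h have "characteristic h A"
    by (simp add: characteristic_def)
  then show thesis by (rule that)
qed

subsection \<open>Extending zeros of the coefficients\<close>

text \<open>Without a relation at \<open>v\<close>, the coefficients of an element of
  \<open>P\<close> with respect to \<open>v\<close> lie in \<open>P\<close> themselves, so any value
  of \<open>v\<close> is admissible.\<close>

lemma kills_nonleader:
  assumes v: "v \<in> xvars" "\<not> leader v" and P0: "\<And>p. p \<in> P \<inter> polys_in (seg (\<rho> v)) \<Longrightarrow> ac_eval \<sigma> p = 0"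
    and p: "p \<in> P \<inter> polys_in (seg (Suc (\<rho> v)))"
  shows "ac_eval \<sigma> p = 0"
proof -
  have "p \<in> polys_in (insert v (seg (\<rho> v)))"
    using p seg_Suc[OF v(1)] by simp
  then obtain q where q: "q \<in> polys_over (polys_in (seg (\<rho> v)))" "poly q (pvar v) = p"
    by (rule polys_in_insert_poly)
  have "coeff q k \<in> P" for k
    using v p q by (intro coeff_in_P[of v]) (auto simp: leader_def)
  then have "map_poly (ac_eval \<sigma>) q = 0"
    using P0 polys_overD[OF q(1)] by (intro poly_eqI) (simp add: coeff_map_poly)
  then show ?thesis
    unfolding q(2)[symmetric] ac_eval_poly by simp
qed

text \<open>Pseudo-division of an element of \<open>P\<close> by \<open>g\<close> leaves a remainder
  of too small degree, whose coefficients therefore lie in \<open>P\<close>. So, up to a power of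
  the initial, it is enough to kill \<open>g\<close> and the lower part of \<open>P\<close>.\<close>

lemma kills_leader:
  assumes v: "v \<in> xvars" and g: "min_rel v g"
    and P0: "\<And>p. p \<in> P \<inter> polys_in (seg (\<rho> v)) \<Longrightarrow> ac_eval \<sigma> p = 0"
    and l: "ac_eval \<sigma> (lead_coeff g) \<noteq> 0" and z: "ac_eval \<sigma> (poly g (pvar v)) = 0"
    and p: "p \<in> P \<inter> polys_in (seg (Suc (\<rho> v)))"
  shows "ac_eval \<sigma> p = 0"
proof -
  have rel: "rel v g" using g by (simp add: min_rel_def)
  let ?C = "polys_in (seg (\<rho> v)) :: 'a dpoly set"
  have "p \<in> polys_in (insert v (seg (\<rho> v)))"
    using p seg_Suc[OF v(1)] by simp
  then obtain f where f': "f \<in> polys_over ?C" and f: "poly f (pvar v) = p"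
    by (rule polys_in_insert_poly)
  obtain k q r where q: "q \<in> polys_over ?C" and r: "r \<in> polys_over ?C"
    and deg: "degree r < degree g"
    and eq: "smult (lead_coeff g ^ k) f = q * g + r"
    by (rule pseudo_division[OF subring_of_polys_in relD(1,3)[OF rel] f'])
  have peq: "lead_coeff g ^ k * p = poly q (pvar v) * poly g (pvar v) + poly r (pvar v)"
    using arg_cong[OF eq, of "\<lambda>f. poly f (pvar v)"] by (simp add: f)
  have "poly q (pvar v) \<in> dpolys ds (m + n)"
  proof -
    have "poly q (pvar v) \<in> polys_in (insert v (seg (\<rho> v)))"
      using q polys_over_mono[OF polys_in_mono[of "seg (\<rho> v)" "insert v (seg (\<rho> v))"]]
      by (intro poly_over_closed subring_of_polys_in polys_in_pvar) auto
    then show ?thesis using polys_in_seg seg_Suc[OF v] by metis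
  qed
  then have "poly q (pvar v) * poly g (pvar v) \<in> P"
    by (rule idealD(4)[OF _ relD(2)[OF rel]])
  moreover have "lead_coeff g ^ k * p \<in> P"
    using p by (intro idealD(4)[OF dpolys_closed(4)[OF relD(5)[OF rel]]]) simp
  ultimately have "lead_coeff g ^ k * p - poly q (pvar v) * poly g (pvar v) \<in> P"
    by (rule ideal_diff[rotated])
  then have "poly r (pvar v) \<in> P"
    unfolding peq by simp
  then have "coeff r i \<in> P" for i
    using v r g deg by (intro coeff_in_P[of v]) (auto simp: min_rel_def intro: less_le_trans)
  then have "map_poly (ac_eval \<sigma>) r = 0"
    using P0 polys_overD[OF r] by (intro poly_eqI) (simp add: coeff_map_poly)
  then have "ac_eval \<sigma> (poly r (pvar v)) = 0"
    unfolding ac_eval_poly by simp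
  then have "ac_eval \<sigma> (lead_coeff g ^ k * p) = 0"
    unfolding peq ac_eval_add ac_eval_mult z by simp
  then show ?thesis
    using l by (simp add: ac_eval_mult ac_eval_power)
qed

lemma map_poly_ac_eval_nonzero:
  "map_poly (ac_eval \<sigma>) q \<noteq> 0 \<longleftrightarrow> (\<exists>k. ac_eval \<sigma> (coeff q k) \<noteq> 0)"
  by (simp add: poly_eq_iff coeff_map_poly)

lemma ac_eval_dvd: "p dvd q \<Longrightarrow> ac_eval \<sigma> q \<noteq> 0 \<Longrightarrow> ac_eval \<sigma> p \<noteq> 0"
  by (auto simp: dvd_def ac_eval_mult)

text \<open>Ascending through the ranks, each new derivative of the given point is either
  unconstrained or satisfies its relation because \<open>A\<close> vanishes. Finitely many equations
  and one inequation thus imply all of \<open>P\<close>, once the part of \<open>P\<close> in the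
  first \<open>m\<close> indeterminates vanishes.\<close>

lemma characteristic_zero:
  assumes h: "characteristic h A" and A: "\<And>a. a \<in> A \<Longrightarrow> dpoly_eval ds a x = 0"
    and hx: "dpoly_eval ds h x \<noteq> 0" and P0: "\<And>p. p \<in> P \<inter> dpolys ds m \<Longrightarrow> dpoly_eval ds p x = 0"
    and p: "p \<in> P"
  shows "dpoly_eval ds p x = 0"
proof -
  let ?\<sigma> = "jet ds x"
  have kills: "\<forall>p \<in> P \<inter> polys_in (seg i). ac_eval ?\<sigma> p = 0" for i
  proof (induction i)
    case 0
    then show ?case using P0 by (simp add: seg_0 ac_eval_jet)
  next
    case (Suc i)
    show ?case
    proof (cases "\<exists>v\<in>xvars. \<rho> v = i")
      case False
      then have "seg (Suc i) = seg i" by (intro seg_Suc') auto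
      then show ?thesis using Suc by simp
    next
      case True
      then obtain v where v: "v \<in> xvars" "\<rho> v = i" by blast
      show ?thesis
      proof (cases "leader v")
        case False
        then show ?thesis using kills_nonleader[OF v(1) False] Suc v(2) by blast
      next
        case True
        then obtain g where g: "min_rel v g" "lead_coeff g dvd h"
          "dpoly_eval ds (poly g (pvar v)) x = 0"
          using h A unfolding characteristic_def by blast
        have "ac_eval ?\<sigma> h \<noteq> 0" using hx by (simp add: ac_eval_jet)
        then have l: "ac_eval ?\<sigma> (lead_coeff g) \<noteq> 0"
          by (rule ac_eval_dvd[OF g(2)])
        have z: "ac_eval ?\<sigma> (poly g (pvar v)) = 0"
          using g(3) by (simp add: ac_eval_jet)
        show ?thesis
          using kills_leader[OF v(1) g(1) _ l z] Suc v(2) by blast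
      qed
    qed
  qed
  obtain i where "p \<in> polys_in (seg i)"
    using polys_in_seg_exists idealD(1)[OF p] by blast
  then have "ac_eval ?\<sigma> p = 0" using kills[of i] p by blast
  then show ?thesis by (simp add: ac_eval_jet)
qed

end

section \<open>Roots of one polynomial that avoid the roots of another\<close>

text \<open>Over an algebraically closed field \<open>g\<close> splits into linear factors; each
  step cancels one of them on both sides.\<close>

lemma dvd_of_orders:
  fixes g h :: "'k::alg_closed_field poly"
  assumes "g \<noteq> 0" "h \<noteq> 0" "\<And>x. poly g x = 0 \<Longrightarrow> order x g \<le> order x h"
  shows "g dvd h"
  using assms
proof (induction "degree g" arbitrary: g h rule: less_induct)
  case less
  show ?case
  proof (cases "degree g = 0")
    case True
    then obtain c where "g = [:c:]" by (rule degree_eq_zeroE)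
    with less.prems show ?thesis by (simp add: const_poly_dvd_iff_dvd_content is_unit_const_poly_iff unit_imp_dvd dvd_field_iff)
  next
    case False
    then obtain x where x: "poly g x = 0" using alg_closed_imp_poly_has_root[of g] by auto
    then obtain g' where g': "g = [:-x, 1:] * g'" by (metis dvdE poly_eq_0_iff_dvd)
    have "order x g > 0" using x less.prems(1) by (simp add: order_root)
    then have "poly h x = 0" using less.prems(2,3) x order_root[of h x] by fastforce
    then obtain h' where h': "h = [:-x, 1:] * h'" by (metis dvdE poly_eq_0_iff_dvd)
    have nz: "g' \<noteq> 0" "h' \<noteq> 0" using less.prems g' h' by auto
    have ord: "order y g' \<le> order y h'" if "poly g' y = 0" for y
    proof -
      have "order y g \<le> order y h" using that by (intro less.prems(3)) (simp add: g')
      moreover have "order y g = order y [:-x, 1:] + order y g'"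
        using less.prems(1) unfolding g' by (rule order_mult)
      moreover have "order y h = order y [:-x, 1:] + order y h'"
        using less.prems(2) unfolding h' by (rule order_mult)
      ultimately show ?thesis by simp
    qed
    have "degree g = degree [:-x, 1:] + degree g'"
      unfolding g' using nz by (intro Polynomial.degree_mult_eq) simp_all
    then have "degree g' < degree g" by simp
    from less.hyps[OF this nz ord] show ?thesis unfolding g' h' by (intro mult_dvd_mono dvd_refl)
  qed
qed

text \<open>
  A multiple root of \<open>g\<close> is no obstacle: if \<open>b\<close> vanishes at all roots of \<open>g\<close>, then already \<open>g\<close> divides \<open>b g'\<close>.
\<close>

lemma root_avoiding:
  fixes g b :: "'k::{alg_closed_field, field_char_0} poly"
  assumes eq: "smult c (b * pderiv g) = q * g + r"
    and r: "r \<noteq> 0" "degree r < degree g"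
  obtains x where "poly g x = 0" "poly b x \<noteq> 0"
proof -
  have "\<exists>x. poly g x = 0 \<and> poly b x \<noteq> 0"
  proof (rule ccontr)
    assume none: "\<nexists>x. poly g x = 0 \<and> poly b x \<noteq> 0"
    have g: "g \<noteq> 0" "pderiv g \<noteq> 0" using r(2) by (auto simp: pderiv_eq_0_iff)
    have "g dvd b * pderiv g"
    proof (cases "b = 0")
      case False
      show ?thesis
      proof (rule dvd_of_orders)
        show "order x g \<le> order x (b * pderiv g)" if "poly g x = 0" for x
        proof -
          have "poly b x = 0" using none that by blast
          \<comment> \<open>The multiplicity of \<open>x\<close> in \<open>pderiv g\<close> is one
            less than in \<open>g\<close>; the factor \<open>b\<close> makes up for it.\<close>
          then have "order x b > 0" using False by (simp add: order_root)
          then show ?thesis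
            using order_pderiv[OF g(1) that] False g(2) by (simp add: order_mult)
        qed
      qed (use False g in simp_all)
    qed simp
    then have "g dvd smult c (b * pderiv g)" by (rule dvd_smult)
    then have "g dvd r" unfolding eq by (simp add: dvd_add_right_iff)
    then show False using r by (metis dvd_imp_degree_le not_less)
  qed
  then show thesis using that by blast
qed

section \<open>Lifting and extending assignments along the ranking\<close>

context ranked_prime
begin

lemma ac_eval_fun_upd:
  fixes p :: "'a dpoly"
  assumes "v \<in> xvars" "p \<in> polys_in (seg (\<rho> v))"
  shows "ac_eval (\<sigma>(v := \<beta>)) p = ac_eval \<sigma> p"
  using assms(2) by (rule ac_eval_cong) (use xvars_notin_seg[OF assms(1)] in auto)

lemma map_poly_fun_upd:
  fixes q :: "'a dpoly poly"
  assumes "v \<in> xvars" "q \<in> polys_over (polys_in (seg (\<rho> v)))"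
  shows "map_poly (ac_eval (\<sigma>(v := \<beta>))) q = map_poly (ac_eval \<sigma>) q"
  using ac_eval_fun_upd[OF assms(1)] polys_overD[OF assms(2)] by (intro poly_eqI) (simp add: coeff_map_poly)

text \<open>Such an assignment induces a homomorphism from the polynomials in \<open>seg i\<close>
  modulo \<open>P\<close> to the algebraic closure; its values outside \<open>seg i\<close> are
  arbitrary.\<close>

definition kills :: "nat \<Rightarrow> (dvar \<Rightarrow> 'a alg_closure) \<Rightarrow> bool" where
  "kills i \<sigma> \<longleftrightarrow> (\<forall>p \<in> P \<inter> polys_in (seg i). ac_eval \<sigma> p = 0)"

text \<open>
  The openness of the projection to the first \<open>m\<close> coordinates, for zeros in the algebraic closure that need not
  be compatible with the derivations.
\<close>

lemma kills_lift:
  assumes h: "characteristic h A" and \<zeta>: "\<And>p. p \<in> P \<Longrightarrow> ac_eval \<zeta> p = 0" "ac_eval \<zeta> h \<noteq> 0"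
    and b: "b \<in> polys_in (seg i)" "ac_eval \<zeta> b \<noteq> 0"
  shows "\<exists>c\<in>dpolys ds m. ac_eval \<zeta> c \<noteq> 0 \<and> (\<forall>\<tau>. kills 0 \<tau> \<and> ac_eval \<tau> c \<noteq> 0 \<longrightarrow>
    (\<exists>\<sigma>. (\<forall>v\<in>dvars (length ds) m. \<sigma> v = \<tau> v) \<and> kills i \<sigma> \<and> ac_eval \<sigma> b \<noteq> 0))"
  using b
proof (induction i arbitrary: b)
  case 0
  then show ?case unfolding seg_0 by (intro bexI[of _ b]) auto
next
  case (Suc i)
  show ?case
  proof (cases "\<exists>v\<in>xvars. \<rho> v = i")
    case False
    then have "seg (Suc i) = seg i" by (intro seg_Suc') auto
    then show ?thesis using Suc by (simp add: kills_def)
  next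
    case True
    then obtain v where v: "v \<in> xvars" "\<rho> v = i" by blast
    let ?C = "polys_in (seg i) :: 'a dpoly set"
    have vy: "v \<notin> dvars (length ds) m" using v(1) by (auto simp: xvars_def dvars_def)
    have "b \<in> polys_in (insert v (seg i))"
      using Suc.prems(1) seg_Suc[OF v(1)] v(2) by simp
    then obtain B where B: "B \<in> polys_over ?C" and B': "poly B (pvar v) = b"
      by (rule polys_in_insert_poly)
    \<comment> \<open>It remains to find a condition \<open>c'\<close> in the variables of lower
      rank, nonzero at \<open>\<zeta>\<close>, under which some value of \<open>v\<close> extends
      the assignment; the induction hypothesis turns \<open>c'\<close> into
      \<open>c\<close>.\<close>
    have step: ?thesis
      if c': "c' \<in> ?C" "ac_eval \<zeta> c' \<noteq> 0"
        and ext: "\<And>\<sigma>. kills i \<sigma> \<Longrightarrow> ac_eval \<sigma> c' \<noteq> 0 \<Longrightarrow>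
          \<exists>\<beta>. kills (Suc i) (\<sigma>(v := \<beta>)) \<and> ac_eval (\<sigma>(v := \<beta>)) b \<noteq> 0" for c'
    proof -
      from Suc.IH[OF c'] obtain c where c: "c \<in> dpolys ds m" "ac_eval \<zeta> c \<noteq> 0"
        "\<And>\<tau>. kills 0 \<tau> \<Longrightarrow> ac_eval \<tau> c \<noteq> 0 \<Longrightarrow>
          \<exists>\<sigma>. (\<forall>v\<in>dvars (length ds) m. \<sigma> v = \<tau> v) \<and> kills i \<sigma> \<and> ac_eval \<sigma> c' \<noteq> 0"
        by blast
      have "\<exists>\<sigma>. (\<forall>v\<in>dvars (length ds) m. \<sigma> v = \<tau> v) \<and> kills (Suc i) \<sigma> \<and> ac_eval \<sigma> b \<noteq> 0"
        if \<tau>: "kills 0 \<tau>" "ac_eval \<tau> c \<noteq> 0" for \<tau>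
      proof -
        from c(3)[OF \<tau>] obtain \<sigma> where \<sigma>: "\<forall>v\<in>dvars (length ds) m. \<sigma> v = \<tau> v" "kills i \<sigma>" "ac_eval \<sigma> c' \<noteq> 0"
          by blast
        from ext[OF \<sigma>(2,3)] obtain \<beta> where "kills (Suc i) (\<sigma>(v := \<beta>))" "ac_eval (\<sigma>(v := \<beta>)) b \<noteq> 0"
          by blast
        moreover have "\<forall>u\<in>dvars (length ds) m. (\<sigma>(v := \<beta>)) u = \<tau> u"
          using \<sigma>(1) vy by auto
        ultimately show ?thesis by blast
      qed
      then show ?thesis using c(1,2) by blast
    qed
    have eval_B: "ac_eval (\<sigma>(v := \<beta>)) b = poly (map_poly (ac_eval \<sigma>) B) \<beta>" for \<sigma> \<beta>
      using map_poly_fun_upd[OF v(1), of B \<sigma> \<beta>] B v(2) unfolding B'[symmetric] ac_eval_poly by simp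
    show ?thesis
    proof (cases "leader v")
      case False
      have "map_poly (ac_eval \<zeta>) B \<noteq> 0"
        using Suc.prems(2) unfolding B'[symmetric] ac_eval_poly by auto
      \<comment> \<open>A coefficient of \<open>B\<close> that is nonzero at \<open>\<zeta>\<close>
        keeps \<open>B\<close> nonzero wherever it is nonzero itself. The value of \<open>v\<close>
        has then only finitely many roots to avoid in an infinite field.\<close>
      then obtain k where k: "ac_eval \<zeta> (coeff B k) \<noteq> 0"
        unfolding map_poly_ac_eval_nonzero by blast
      show ?thesis
      proof (rule step[OF polys_overD[OF B] k])
        fix \<sigma> assume \<sigma>: "kills i \<sigma>" "ac_eval \<sigma> (coeff B k) \<noteq> 0"
        then have nz: "map_poly (ac_eval \<sigma>) B \<noteq> 0"
          unfolding map_poly_ac_eval_nonzero by blast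
        have "\<exists>\<beta>. poly (map_poly (ac_eval \<sigma>) B) \<beta> \<noteq> 0"
          using poly_roots_finite[OF nz] infinite_UNIV_char_0[where 'a = "'a alg_closure"]
          by (metis (mono_tags, lifting) UNIV_eq_I mem_Collect_eq)
        then obtain \<beta> where \<beta>: "poly (map_poly (ac_eval \<sigma>) B) \<beta> \<noteq> 0" by blast
        have "ac_eval (\<sigma>(v := \<beta>)) p = 0" if "p \<in> P \<inter> polys_in (seg (\<rho> v))" for p
          using that \<sigma>(1) ac_eval_fun_upd[OF v(1)] v(2) by (simp add: kills_def)
        then have "kills (Suc i) (\<sigma>(v := \<beta>))"
          using kills_nonleader[OF v(1) False] v(2) unfolding kills_def by blast
        then show "\<exists>\<beta>. kills (Suc i) (\<sigma>(v := \<beta>)) \<and> ac_eval (\<sigma>(v := \<beta>)) b \<noteq> 0"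
          using \<beta> eval_B by metis
      qed
    next
      case True
      then obtain g where g: "min_rel v g" "lead_coeff g dvd h" "separant v g dvd h"
        using h unfolding characteristic_def by blast
      have rel: "rel v g" using g by (simp add: min_rel_def)
      let ?l = "lead_coeff g"
      have gC: "g \<in> polys_over ?C" using relD(1)[OF rel] v(2) by simp
      \<comment> \<open>A nonzero remainder of \<open>B\<close> itself would only say that
        \<open>g\<close> does not divide \<open>B\<close>; if \<open>g\<close> acquires multiple
        roots, all of them may still be roots of \<open>B\<close>. The factor
        \<open>pderiv g\<close> does no harm at \<open>\<zeta>\<close>, because the separant divides
        \<open>h\<close>.\<close>
      have "B * pderiv g \<in> polys_over ?C"
        by (intro polys_over_mult polys_over_pderiv subring_of_polys_in B gC)
      then obtain k q r where q: "q \<in> polys_over ?C" and r: "r \<in> polys_over ?C"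
        and deg: "degree r < degree g"
        and eq: "smult (?l ^ k) (B * pderiv g) = q * g + r"
        by (rule pseudo_division[OF subring_of_polys_in gC relD(3)[OF rel]])
      have peq: "?l ^ k * (b * separant v g) = poly q (pvar v) * poly g (pvar v) + poly r (pvar v)"
        using arg_cong[OF eq, of "\<lambda>f. poly f (pvar v)"] by (simp add: B' separant_def)
      have "ac_eval \<zeta> (?l ^ k * (b * separant v g)) \<noteq> 0"
        using Suc.prems(2) ac_eval_dvd[OF g(2) \<zeta>(2)] ac_eval_dvd[OF g(3) \<zeta>(2)]
        by (simp add: ac_eval_mult ac_eval_power)
      moreover have "ac_eval \<zeta> (poly q (pvar v) * poly g (pvar v)) = 0"
        using \<zeta>(1)[OF relD(2)[OF rel]] by (simp add: ac_eval_mult)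
      ultimately have "ac_eval \<zeta> (poly r (pvar v)) \<noteq> 0"
        unfolding peq ac_eval_add by simp
      then have "map_poly (ac_eval \<zeta>) r \<noteq> 0"
        unfolding ac_eval_poly by auto
      then obtain j where j: "ac_eval \<zeta> (coeff r j) \<noteq> 0"
        unfolding map_poly_ac_eval_nonzero by blast
      \<comment> \<open>The first factor keeps the remainder nonzero, the second preserves the
        degree of \<open>g\<close>, so that the remainder still has the smaller degree.\<close>
      let ?c = "coeff r j * ?l"
      have "?c \<in> ?C" by (intro polys_in_mult polys_overD[OF r] polys_overD[OF gC])
      moreover have "ac_eval \<zeta> ?c \<noteq> 0"
        using j ac_eval_dvd[OF g(2) \<zeta>(2)] by (simp add: ac_eval_mult)
      ultimately show ?thesis
      proof (rule step)
        fix \<sigma> assume \<sigma>: "kills i \<sigma>" "ac_eval \<sigma> ?c \<noteq> 0"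
        let ?g = "map_poly (ac_eval \<sigma>) g" and ?r = "map_poly (ac_eval \<sigma>) r"
        have l: "ac_eval \<sigma> ?l \<noteq> 0" and rj: "ac_eval \<sigma> (coeff r j) \<noteq> 0"
          using \<sigma>(2) by (auto simp: ac_eval_mult)
        have deg_g: "degree ?g = degree g"
          using l by (intro map_poly_degree_eq)
        have r1: "?r \<noteq> 0" using rj unfolding map_poly_ac_eval_nonzero by blast
        have r2: "degree ?r < degree ?g"
          unfolding deg_g using deg map_poly_degree_leq[of "ac_eval \<sigma>" r] by simp
        have "map_poly (ac_eval \<sigma>) (smult (?l ^ k) (B * pderiv g)) =
            smult (ac_eval \<sigma> (?l ^ k)) (map_poly (ac_eval \<sigma>) B * pderiv ?g)"
          by (subst map_poly_smult) (simp_all add: ac_eval_mult map_poly_ac_eval_mult map_poly_ac_eval_pderiv)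
        then have E: "smult (ac_eval \<sigma> (?l ^ k)) (map_poly (ac_eval \<sigma>) B * pderiv ?g) =
            map_poly (ac_eval \<sigma>) q * ?g + ?r"
          unfolding eq by (simp only: map_poly_ac_eval_add map_poly_ac_eval_mult)
        obtain \<beta> where \<beta>: "poly ?g \<beta> = 0" "poly (map_poly (ac_eval \<sigma>) B) \<beta> \<noteq> 0"
          by (rule root_avoiding[OF E r1 r2])
        have "ac_eval (\<sigma>(v := \<beta>)) p = 0" if "p \<in> P \<inter> polys_in (seg (\<rho> v))" for p
          using that \<sigma>(1) ac_eval_fun_upd[OF v(1)] v(2) by (simp add: kills_def)
        moreover have "ac_eval (\<sigma>(v := \<beta>)) ?l \<noteq> 0"
          using l ac_eval_fun_upd[OF v(1), of ?l] polys_overD[OF gC] v(2) by simp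
        moreover have "ac_eval (\<sigma>(v := \<beta>)) (poly g (pvar v)) = 0"
          unfolding ac_eval_poly using \<beta>(1) map_poly_fun_upd[OF v(1), of g] gC v(2) by simp
        ultimately have "kills (Suc i) (\<sigma>(v := \<beta>))"
          using kills_leader[OF v(1) g(1)] v(2) unfolding kills_def by blast
        then show "\<exists>\<beta>. kills (Suc i) (\<sigma>(v := \<beta>)) \<and> ac_eval (\<sigma>(v := \<beta>)) b \<noteq> 0"
          using \<beta>(2) eval_B by metis
      qed
    qed
  qed
qed

text \<open>Since \<open>h\<close> is nonzero and its variables already have their values, all
  further initials are nonzero, so that each further relation has a root in the algebraic closure.
  Nothing else has to be kept nonzero.\<close>

lemma kills_extend:
  assumes h: "characteristic h A" "h \<in> polys_in (seg i)" and \<sigma>: "kills i \<sigma>" "ac_eval \<sigma> h \<noteq> 0" and "i \<le> i'"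
  shows "\<exists>\<sigma>'. (\<forall>v\<in>seg i. \<sigma>' v = \<sigma> v) \<and> kills i' \<sigma>'"
  using \<open>i \<le> i'\<close>
proof (induction rule: dec_induct)
  case base
  then show ?case using \<sigma> by blast
next
  case (step l)
  then obtain \<sigma>' where \<sigma>': "\<forall>v\<in>seg i. \<sigma>' v = \<sigma> v" "kills l \<sigma>'" by blast
  show ?case
  proof (cases "\<exists>v\<in>xvars. \<rho> v = l")
    case False
    then have "seg (Suc l) = seg l" by (intro seg_Suc') auto
    then show ?thesis using \<sigma>' by (auto simp: kills_def)
  next
    case True
    then obtain v where v: "v \<in> xvars" "\<rho> v = l" by blast
    have vi: "v \<notin> seg i" using xvars_notin_seg[OF v(1)] seg_mono[OF step.hyps(1)] v(2) by blast
    have P0: "ac_eval (\<sigma>'(v := \<beta>)) p = 0" if "p \<in> P \<inter> polys_in (seg (\<rho> v))" for p \<beta>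
      using that \<sigma>'(2) ac_eval_fun_upd[OF v(1)] v(2) by (simp add: kills_def)
    have "\<exists>\<beta>. kills (Suc l) (\<sigma>'(v := \<beta>))"
    proof (cases "leader v")
      case False
      then show ?thesis
        using kills_nonleader[OF v(1) False P0] v(2) unfolding kills_def by blast
    next
      case True
      then obtain g where g: "min_rel v g" "lead_coeff g dvd h"
        using h unfolding characteristic_def by blast
      have rel: "rel v g" using g by (simp add: min_rel_def)
      have "ac_eval \<sigma>' h = ac_eval \<sigma> h"
        using h(2) \<sigma>'(1) by (intro ac_eval_cong) auto
      then have l: "ac_eval \<sigma>' (lead_coeff g) \<noteq> 0"
        using ac_eval_dvd[OF g(2)] \<sigma>(2) by metis
      then have "degree (map_poly (ac_eval \<sigma>') g) = degree g"
        by (intro map_poly_degree_eq)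
      then obtain \<beta> where \<beta>: "poly (map_poly (ac_eval \<sigma>') g) \<beta> = 0"
        using alg_closed_imp_poly_has_root[of "map_poly (ac_eval \<sigma>') g"] relD(3)[OF rel] by auto
      have "ac_eval (\<sigma>'(v := \<beta>)) (lead_coeff g) \<noteq> 0"
        using l ac_eval_fun_upd[OF v(1)] polys_overD[OF relD(1)[OF rel]] by simp
      moreover have "ac_eval (\<sigma>'(v := \<beta>)) (poly g (pvar v)) = 0"
        unfolding ac_eval_poly using \<beta> map_poly_fun_upd[OF v(1) relD(1)[OF rel]] by simp
      ultimately have "kills (Suc l) (\<sigma>'(v := \<beta>))"
        using kills_leader[OF v(1) g(1) P0] v(2) unfolding kills_def by blast
      then show ?thesis by blast
    qed
    then obtain \<beta> where "kills (Suc l) (\<sigma>'(v := \<beta>))" by blast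
    moreover have "\<forall>u\<in>seg i. (\<sigma>'(v := \<beta>)) u = \<sigma> u"
      using \<sigma>'(1) vi by auto
    ultimately show ?thesis by blast
  qed
qed

end

section \<open>Zeros of differential ideals\<close>

lemma ranked_prime_exists:
  fixes ds :: "('a::field_char_0 \<Rightarrow> 'a) list"
  assumes "differential_field ds" "prime_dideal ds (m + n) P"
  shows "\<exists>\<rho>. ranked_prime ds m n P \<rho>"
proof (rule ranking_exists[of "length ds" "m + n"])
  fix \<rho> :: "dvar \<Rightarrow> nat"
  assume "inj_on \<rho> (dvars (length ds) (m + n))"
    "\<And>u v j. u \<in> dvars (length ds) (m + n) \<Longrightarrow> v \<in> dvars (length ds) (m + n) \<Longrightarrow>
      j < length ds \<Longrightarrow> \<rho> u < \<rho> v \<Longrightarrow> \<rho> (shift j u) < \<rho> (shift j v)"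
    "\<And>v j. v \<in> dvars (length ds) (m + n) \<Longrightarrow> j < length ds \<Longrightarrow> \<rho> v < \<rho> (shift j v)"
  then have "ranked_prime ds m n P \<rho>"
    using assms by (simp add: ranked_prime_def)
  then show ?thesis by blast
qed

lemma dpolys_0_const:
  assumes "p \<in> dpolys ds 0"
  obtains c where "p = pconst c"
proof
  have "M = 0" if "M \<in> keys p" for M
  proof (rule poly_mapping_eqI)
    fix v
    have "v \<notin> keys M" using assms that by (cases v) (auto simp: dpolys_def)
    then show "lookup M v = lookup 0 v" by (simp add: in_keys_iff)
  qed
  then have "keys p \<subseteq> {0}" by blast
  then show "p = pconst (lookup p 0)"
    by (intro poly_mapping_eqI) (auto simp: pconst_def lookup_single when_def in_keys_iff)
qed

text \<open>The case without coefficient indeterminates: a proper ideal contains no nonzero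
  constant, so the vanishing of \<open>A\<close> and the inequation for \<open>h\<close> imply the
  vanishing of all of \<open>Q\<close>.\<close>

lemma characteristic_pair:
  fixes ds :: "('a::field_char_0 \<Rightarrow> 'a) list"
  assumes K: "differential_field ds" and Q: "prime_dideal ds n Q"
  obtains h A where "finite A" "A \<subseteq> Q" "h \<in> dpolys ds n - Q"
    "\<forall>x. (\<forall>a\<in>A. dpoly_eval ds a x = 0) \<and> dpoly_eval ds h x \<noteq> 0 \<longrightarrow> (\<forall>p\<in>Q. dpoly_eval ds p x = 0)"
proof -
  obtain \<rho> where "ranked_prime ds 0 n Q \<rho>"
    using ranked_prime_exists[OF K, of 0 n Q] Q by auto
  then interpret ranked_prime ds 0 n Q \<rho> .
  obtain h A where h: "characteristic h A" by (rule characteristic_exists)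
  have const: "dpoly_eval ds p x = 0" if p: "p \<in> Q \<inter> dpolys ds 0" for p x
  proof -
    obtain c where c: "p = pconst c" using p dpolys_0_const by blast
    have "c = 0"
    proof (rule ccontr)
      assume "c \<noteq> 0"
      then have "pconst (inverse c) * p = 1"
        by (simp add: c pconst_hom(2)[symmetric] pconst_hom(4))
      moreover have "pconst (inverse c) * p \<in> Q"
        using p by (intro idealD(4) dpolys_closed) simp
      ultimately show False using one_notin by simp
    qed
    then show ?thesis by (simp add: c)
  qed
  show thesis
  proof (rule that[of A h])
    show "finite A" "A \<subseteq> Q" "h \<in> dpolys ds n - Q"
      using h by (simp_all add: characteristic_def)
    show "\<forall>x. (\<forall>a\<in>A. dpoly_eval ds a x = 0) \<and> dpoly_eval ds h x \<noteq> 0 \<longrightarrow> (\<forall>p\<in>Q. dpoly_eval ds p x = 0)"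
      using characteristic_zero[OF h _ _ const] by blast
  qed
qed

text \<open>The infinitely many equations of \<open>Q\<close> are traded for the finite system
  \<open>A\<close> with \<open>h\<close> and \<open>f\<close> nonzero, to which differential
  closedness applies.\<close>

lemma nullstellensatz:
  fixes ds :: "('a::field_char_0 \<Rightarrow> 'a) list"
  assumes K: "differential_field ds" "differentially_closed ds" and Q: "prime_dideal ds n Q"
    and f: "f \<in> dpolys ds n - Q"
  obtains x where "length x = n" "\<And>p. p \<in> Q \<Longrightarrow> dpoly_eval ds p x = 0" "dpoly_eval ds f x \<noteq> 0"
proof -
  obtain h A where h: "finite A" "A \<subseteq> Q" "h \<in> dpolys ds n - Q"
    "\<forall>x. (\<forall>a\<in>A. dpoly_eval ds a x = 0) \<and> dpoly_eval ds h x \<noteq> 0 \<longrightarrow> (\<forall>p\<in>Q. dpoly_eval ds p x = 0)"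
    by (rule characteristic_pair[OF K(1) Q])
  obtain x where "solution ds n A {h, f} x"
    using prime_dideal_finite_solution[OF K Q h(1,2), of "{h, f}"] h(3) f by blast
  then have x: "length x = n" "\<forall>a\<in>A. dpoly_eval ds a x = 0" "dpoly_eval ds h x \<noteq> 0" "dpoly_eval ds f x \<noteq> 0"
    by (simp_all add: solution_def)
  then have "\<forall>p\<in>Q. dpoly_eval ds p x = 0" using h(4) by blast
  then show thesis using that x(1,4) by blast
qed

section \<open>The Noetherian property of zero sets\<close>

definition vanishing :: "('a::comm_ring_1 \<Rightarrow> 'a) list \<Rightarrow> nat \<Rightarrow> 'a list set \<Rightarrow> 'a dpoly set" where
  "vanishing ds n S = {p \<in> dpolys ds n. \<forall>x\<in>S. dpoly_eval ds p x = 0}"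

lemma radical_vanishing:
  fixes ds :: "('a::field \<Rightarrow> 'a) list"
  assumes K: "differential_field ds"
  shows "radical_dideal ds n (vanishing ds n S)"
proof -
  have "dpoly_eval ds (dpoly_deriv ds j p) x = 0" if "j < length ds" "dpoly_eval ds p x = 0" for j p x
    using dpoly_eval_deriv[OF K that(1)] derivation_zero[OF differential_field_nth[OF K that(1)]] that(2)
    by simp
  then have "differential_ideal ds n (vanishing ds n S)"
    unfolding differential_ideal_def vanishing_def
    by (auto simp: dpolys_closed dpolys_mult dpolys_deriv[OF K] dpoly_eval_add dpoly_eval_mult)
  moreover have "p \<in> vanishing ds n S" if "p \<in> dpolys ds n" "p ^ k \<in> vanishing ds n S" for p k
    using that by (auto simp: vanishing_def dpoly_eval_power)
  ultimately show ?thesis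
    unfolding radical_dideal_def by blast
qed

definition radical_hull :: "('a::comm_ring_1 \<Rightarrow> 'a) list \<Rightarrow> nat \<Rightarrow> 'a dpoly set \<Rightarrow> 'a dpoly set" where
  "radical_hull ds n E = \<Inter>{I. radical_dideal ds n I \<and> E \<subseteq> I}"

lemma radical_radical_hull:
  fixes ds :: "('a::field \<Rightarrow> 'a) list"
  assumes K: "differential_field ds" and E: "E \<subseteq> dpolys ds n"
  shows "radical_dideal ds n (radical_hull ds n E)"
proof -
  \<comment> \<open>This member of the family ensures that the intersection consists of elements of
    \<open>dpolys ds n\<close>.\<close>
  have R: "radical_dideal ds n (dpolys ds n)"
    using radical_vanishing[OF K, of n "{}"] by (simp add: vanishing_def)
  have mem: "p \<in> radical_hull ds n E \<longleftrightarrow> (\<forall>I. radical_dideal ds n I \<longrightarrow> E \<subseteq> I \<longrightarrow> p \<in> I)" for p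
    by (auto simp: radical_hull_def)
  have D: "differential_ideal ds n I" if "radical_dideal ds n I" for I
    using that by (simp add: radical_dideal_def)
  have "differential_ideal ds n (radical_hull ds n E)"
    unfolding differential_ideal_def[of ds n "radical_hull ds n E"]
  proof (intro conjI ballI allI impI subsetI)
    show "p \<in> dpolys ds n" if "p \<in> radical_hull ds n E" for p
      using that R E by (simp add: mem)
  qed (simp_all add: mem differential_idealD(2,3,4,6)[OF D])
  moreover have "p \<in> radical_hull ds n E" if "p \<in> dpolys ds n" "p ^ k \<in> radical_hull ds n E" for p k
    unfolding mem
  proof (intro allI impI)
    fix I assume I: "radical_dideal ds n I" "E \<subseteq> I"
    then have "p ^ k \<in> I" using that(2) by (simp add: mem)
    then show "p \<in> I" using I(1) that(1) unfolding radical_dideal_def by blast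
  qed
  ultimately show ?thesis
    unfolding radical_dideal_def[of ds n "radical_hull ds n E"] by blast
qed

text \<open>\<open>U\<close> is the radical differential ideal generated by \<open>E\<close>,
  written as a directed union; this shows that finitely many of its elements depend on finitely many
  elements of \<open>E\<close>.\<close>

lemma radical_hull_directed:
  fixes ds :: "('a::field \<Rightarrow> 'a) list"
  assumes K: "differential_field ds" and E: "E \<subseteq> dpolys ds n"
  defines "U \<equiv> \<Union>{radical_hull ds n F |F. finite F \<and> F \<subseteq> E}"
  shows "radical_dideal ds n U" "E \<subseteq> U"
    "finite F \<Longrightarrow> F \<subseteq> U \<Longrightarrow> \<exists>F'. finite F' \<and> F' \<subseteq> E \<and> F \<subseteq> radical_hull ds n F'"
proof -
  have mono: "radical_hull ds n F \<subseteq> radical_hull ds n F'" if "F \<subseteq> F'" for F F'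
    using that unfolding radical_hull_def by blast
  show "radical_dideal ds n U"
    unfolding U_def
  proof (rule radical_dideal_Union_chain)
    fix I J assume "I \<in> {radical_hull ds n F |F. finite F \<and> F \<subseteq> E}" "J \<in> {radical_hull ds n F |F. finite F \<and> F \<subseteq> E}"
    then obtain F F' where F: "finite F" "F \<subseteq> E" "I = radical_hull ds n F"
      "finite F'" "F' \<subseteq> E" "J = radical_hull ds n F'" by blast
    have "radical_hull ds n (F \<union> F') \<in> {radical_hull ds n F |F. finite F \<and> F \<subseteq> E}"
      using F by blast
    then show "\<exists>M\<in>{radical_hull ds n F |F. finite F \<and> F \<subseteq> E}. I \<subseteq> M \<and> J \<subseteq> M"
      using mono[of F "F \<union> F'"] mono[of F' "F \<union> F'"] F by blast
  next
    fix I assume "I \<in> {radical_hull ds n F |F. finite F \<and> F \<subseteq> E}"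
    then show "radical_dideal ds n I" using radical_radical_hull[OF K] E by blast
  qed blast
  show "E \<subseteq> U"
  proof
    fix p assume "p \<in> E"
    moreover have "p \<in> radical_hull ds n {p}" by (simp add: radical_hull_def)
    ultimately show "p \<in> U" unfolding U_def by blast
  qed
  assume "finite F" "F \<subseteq> U"
  then show "\<exists>F'. finite F' \<and> F' \<subseteq> E \<and> F \<subseteq> radical_hull ds n F'"
  proof (induction F)
    case (insert p F)
    then obtain F' where F': "finite F'" "F' \<subseteq> E" "F \<subseteq> radical_hull ds n F'" by blast
    obtain F'' where F'': "finite F''" "F'' \<subseteq> E" "p \<in> radical_hull ds n F''"
      using insert.prems unfolding U_def by blast
    show ?case
      using F' F'' mono[of F' "F' \<union> F''"] mono[of F'' "F' \<union> F''"] by (intro exI[of _ "F' \<union> F''"]) blast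
  qed blast
qed

text \<open>The polynomials vanishing at a single point form a radical differential ideal, so
  passing to the hull loses no zeros.\<close>

lemma zero_set_hull:
  fixes ds :: "('a::field \<Rightarrow> 'a) list"
  assumes K: "differential_field ds" and "E \<subseteq> dpolys ds n" "F \<subseteq> radical_hull ds n E"
  shows "zero_set ds n E \<subseteq> zero_set ds n F"
proof
  fix x assume x: "x \<in> zero_set ds n E"
  then have "E \<subseteq> vanishing ds n {x}"
    using assms(2) by (auto simp: zero_set_def vanishing_def)
  then have "radical_hull ds n E \<subseteq> vanishing ds n {x}"
    using radical_vanishing[OF K] unfolding radical_hull_def by blast
  then show "x \<in> zero_set ds n F"
    using assms(3) x by (auto simp: zero_set_def vanishing_def)
qed

lemma zero_set_antimono: "E \<subseteq> F \<Longrightarrow> zero_set ds n F \<subseteq> zero_set ds n E"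
  by (auto simp: zero_set_def)

text \<open>
  The Ritt--Raudenbush basis theorem, for zero sets: a maximal radical differential ideal without a finite
  basis would be prime, hence be described by its characteristic set outside the zeros of some \<open>h\<close>, and
  inside by a larger ideal.
\<close>

theorem zero_set_finite:
  fixes ds :: "('a::field_char_0 \<Rightarrow> 'a) list"
  assumes K: "differential_field ds" and E: "E \<subseteq> dpolys ds n"
  shows "\<exists>F. finite F \<and> F \<subseteq> E \<and> zero_set ds n F = zero_set ds n E"
proof -
  define good where "good = (\<lambda>I. \<exists>F. finite F \<and> F \<subseteq> I \<and> zero_set ds n F = zero_set ds n I)"
  have all_good: "good I" if "radical_dideal ds n I" for I
  proof (rule ccontr)
    assume "\<not> good I"
    define \<A> where "\<A> = {I. radical_dideal ds n I \<and> \<not> good I}"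
    have "\<A> \<noteq> {}" using that \<open>\<not> good I\<close> by (auto simp: \<A>_def)
    moreover have "\<Union>\<C> \<in> \<A>" if \<C>: "\<C> \<noteq> {}" "subset.chain \<A> \<C>" for \<C>
    proof -
      have sub: "\<C> \<subseteq> \<A>" and chain: "\<And>I M. I \<in> \<C> \<Longrightarrow> M \<in> \<C> \<Longrightarrow> I \<subseteq> M \<or> M \<subseteq> I"
        using \<C>(2) by (auto simp: subset.chain_def)
      have "radical_dideal ds n (\<Union>\<C>)"
      proof (rule radical_dideal_Union_chain)
        show "\<exists>N\<in>\<C>. I \<subseteq> N \<and> M \<subseteq> N" if "I \<in> \<C>" "M \<in> \<C>" for I M
          using chain[OF that] that by blast
      qed (use sub \<C>(1) \<A>_def in blast)+
      moreover have "\<not> good (\<Union>\<C>)"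
      proof
        assume "good (\<Union>\<C>)"
        then obtain F where F: "finite F" "F \<subseteq> \<Union>\<C>" "zero_set ds n F = zero_set ds n (\<Union>\<C>)"
          by (auto simp: good_def)
        obtain I where I: "I \<in> \<C>" "F \<subseteq> I"
          using finite_subset_Union_chain[OF F(1,2) \<C>] by blast
        have "zero_set ds n F = zero_set ds n I"
          using zero_set_antimono[OF I(2), of ds n] zero_set_antimono[of I "\<Union>\<C>" ds n] I(1) F(3) by blast
        then have "good I" using F(1) I(2) by (auto simp: good_def)
        then show False using I(1) sub by (auto simp: \<A>_def)
      qed
      ultimately show ?thesis by (simp add: \<A>_def)
    qed
    ultimately obtain M where M: "M \<in> \<A>" and max: "\<And>I. I \<in> \<A> \<Longrightarrow> M \<subseteq> I \<Longrightarrow> I = M"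
      using subset_Zorn_nonempty[of \<A>] by blast
    have rad: "radical_dideal ds n M" and D: "differential_ideal ds n M" and bad: "\<not> good M"
      using M by (auto simp: \<A>_def radical_dideal_def)
    note D' = differential_idealD[OF D]
    have larger: "good I" if "radical_dideal ds n I" "M \<subseteq> I" "a \<in> I" "a \<notin> M" for I a
      using max[of I] that by (auto simp: \<A>_def)
    have M_dpolys: "M \<subseteq> dpolys ds n" using D'(1) by blast
    have prime: "a \<in> M \<or> b \<in> M" if ab: "a \<in> dpolys ds n" "b \<in> dpolys ds n" "a * b \<in> M" for a b
    proof (rule ccontr)
      assume notin: "\<not> (a \<in> M \<or> b \<in> M)"
      \<comment> \<open>\<open>N1\<close> contains \<open>b\<close>, \<open>N2\<close> contains
        \<open>a\<close>, and products from \<open>N1\<close> and \<open>N2\<close> lie in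
        \<open>M\<close>. Both are strictly larger than \<open>M\<close>, hence good, and the
        products of their finite bases define the zero set of \<open>M\<close>.\<close>
      define N1 where "N1 = {p \<in> dpolys ds n. \<forall>x\<in>{a}. x * p \<in> M}"
      define N2 where "N2 = {p \<in> dpolys ds n. \<forall>x\<in>N1. x * p \<in> M}"
      have sub: "M \<subseteq> N1" "M \<subseteq> N2"
        using D'(4) ab(1) M_dpolys by (auto simp: N1_def N2_def)
      have "radical_dideal ds n N1"
        unfolding N1_def using ab(1) by (intro radical_dideal_colon[OF K rad]) simp
      then have "good N1"
        using sub(1) ab notin by (intro larger[of _ b]) (auto simp: N1_def)
      have "radical_dideal ds n N2"
        unfolding N2_def by (intro radical_dideal_colon[OF K rad]) (auto simp: N1_def)
      moreover have "a \<in> N2"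
        using ab(1) by (auto simp: N1_def N2_def mult.commute)
      ultimately have "good N2"
        using sub(2) notin by (intro larger[of _ a]) auto
      obtain F1 F2 where F: "finite F1" "F1 \<subseteq> N1" "zero_set ds n F1 = zero_set ds n N1"
        "finite F2" "F2 \<subseteq> N2" "zero_set ds n F2 = zero_set ds n N2"
        using \<open>good N1\<close> \<open>good N2\<close> by (auto simp: good_def)
      let ?F = "(\<lambda>(x, y). x * y) ` (F1 \<times> F2)"
      have F_sub: "?F \<subseteq> M"
        using F(2,5) by (auto simp: N2_def)
      have "zero_set ds n ?F \<subseteq> zero_set ds n F1 \<union> zero_set ds n F2"
      proof
        fix x assume "x \<in> zero_set ds n ?F"
        then have "length x = n" "\<And>p q. p \<in> F1 \<Longrightarrow> q \<in> F2 \<Longrightarrow> dpoly_eval ds p x = 0 \<or> dpoly_eval ds q x = 0"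
          by (auto simp: zero_set_def dpoly_eval_mult)
        then show "x \<in> zero_set ds n F1 \<union> zero_set ds n F2"
          unfolding zero_set_def by blast
      qed
      then have "zero_set ds n ?F = zero_set ds n M"
        using zero_set_antimono[OF sub(1), of ds n] zero_set_antimono[OF sub(2), of ds n]
          zero_set_antimono[OF F_sub, of ds n] F(3,6) by blast
      moreover have "finite ?F" using F(1,4) by simp
      ultimately show False using bad F_sub unfolding good_def by blast
    qed
    have "1 \<notin> M"
    proof
      assume one: "1 \<in> M"
      have "zero_set ds n {1} = {}" by (simp add: zero_set_def)
      then have "zero_set ds n {1} = zero_set ds n M"
        using zero_set_antimono[of "{1}" M ds n] one by blast
      moreover have "finite {1}" "{1} \<subseteq> M" using one by simp_all
      ultimately show False using bad unfolding good_def by blast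
    qed
    then have "prime_dideal ds n M"
      unfolding prime_dideal_def using D prime by blast
    then obtain h A where h: "finite A" "A \<subseteq> M" "h \<in> dpolys ds n - M"
      "\<forall>x. (\<forall>a\<in>A. dpoly_eval ds a x = 0) \<and> dpoly_eval ds h x \<noteq> 0 \<longrightarrow> (\<forall>p\<in>M. dpoly_eval ds p x = 0)"
      by (rule characteristic_pair[OF K])
    have hM: "insert h M \<subseteq> dpolys ds n" using h(3) M_dpolys by blast
    define U where "U = \<Union>{radical_hull ds n F |F. finite F \<and> F \<subseteq> insert h M}"
    note U = radical_hull_directed[OF K hM, folded U_def]
    have "good U"
      using U(1,2) h(3) by (intro larger[of _ h]) auto
    then obtain F where F: "finite F" "F \<subseteq> U" "zero_set ds n F = zero_set ds n U"
      by (auto simp: good_def)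
    obtain F' where F': "finite F'" "F' \<subseteq> insert h M" "F \<subseteq> radical_hull ds n F'"
      using U(3)[OF F(1,2)] by blast
    \<comment> \<open>A finite basis has to lie in \<open>M\<close>, so \<open>h\<close> itself is
      removed; where \<open>h\<close> vanishes, it is not missed.\<close>
    let ?F = "(F' - {h}) \<union> A"
    have "zero_set ds n ?F \<subseteq> zero_set ds n M"
    proof
      fix x assume x: "x \<in> zero_set ds n ?F"
      show "x \<in> zero_set ds n M"
      proof (cases "dpoly_eval ds h x = 0")
        case True
        then have "x \<in> zero_set ds n F'"
          using x by (auto simp: zero_set_def)
        also have "\<dots> \<subseteq> zero_set ds n F"
          using F'(2,3) hM by (intro zero_set_hull[OF K]) auto
        also have "\<dots> \<subseteq> zero_set ds n M"
          unfolding F(3) using U(2) by (intro zero_set_antimono) blast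
        finally show ?thesis .
      next
        case False
        moreover have "\<forall>a\<in>A. dpoly_eval ds a x = 0" "length x = n"
          using x by (simp_all add: zero_set_def)
        ultimately show ?thesis using h(4) unfolding zero_set_def by blast
      qed
    qed
    moreover have F_sub: "?F \<subseteq> M" using F'(2) h(2) by blast
    ultimately have "zero_set ds n ?F = zero_set ds n M"
      using zero_set_antimono[OF F_sub] by blast
    moreover have "finite ?F" using F'(1) h(1) by simp
    ultimately have "good M"
      unfolding good_def using F_sub by (intro exI[of _ ?F] conjI)
    then show False using bad by contradiction
  qed
  define U where "U = \<Union>{radical_hull ds n F |F. finite F \<and> F \<subseteq> E}"
  note U = radical_hull_directed[OF K E, folded U_def]
  obtain F where F: "finite F" "F \<subseteq> U" "zero_set ds n F = zero_set ds n U"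
    using all_good[OF U(1)] unfolding good_def by blast
  obtain F' where F': "finite F'" "F' \<subseteq> E" "F \<subseteq> radical_hull ds n F'"
    using U(3)[OF F(1,2)] by blast
  have "zero_set ds n F' \<subseteq> zero_set ds n F"
    using F'(2,3) E by (intro zero_set_hull[OF K]) auto
  also have "\<dots> \<subseteq> zero_set ds n E"
    unfolding F(3) by (rule zero_set_antimono[OF U(2)])
  finally have "zero_set ds n F' = zero_set ds n E"
    using zero_set_antimono[OF F'(2)] by blast
  then show ?thesis using F' by blast
qed

section \<open>Openness of projections\<close>

text \<open>The equations of \<open>P\<close> together with those fixing the first \<open>m\<close>
  coordinates to \<open>y\<close>, for all derivatives at once. As \<open>P\<close> is an ideal
  already, only the rule \<open>var\<close> carries a multiplier.\<close>

inductive_set fibre_ideal ::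
  "('a::field \<Rightarrow> 'a) list \<Rightarrow> nat \<Rightarrow> nat \<Rightarrow> 'a dpoly set \<Rightarrow> 'a list \<Rightarrow> 'a dpoly set"
  for ds m n P y where
  base: "p \<in> P \<Longrightarrow> p \<in> fibre_ideal ds m n P y"
| var: "r \<in> dpolys ds (m + n) \<Longrightarrow> v \<in> dvars (length ds) m \<Longrightarrow>
    r * (pvar v - pconst (dop ds (snd v) (y ! fst v))) \<in> fibre_ideal ds m n P y"
| add: "p \<in> fibre_ideal ds m n P y \<Longrightarrow> q \<in> fibre_ideal ds m n P y \<Longrightarrow> p + q \<in> fibre_ideal ds m n P y"

lemma dpoly_deriv_diff:
  fixes ds :: "('a::field \<Rightarrow> 'a) list"
  assumes "derivation (ds ! j)"
  shows "dpoly_deriv ds j (p - q) = dpoly_deriv ds j p - dpoly_deriv ds j q"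
  using dpoly_deriv_add[OF assms, of "p - q" q] by simp

text \<open>The derivative of the generator for \<open>v\<close> is the generator for
  \<open>shift j v\<close>, since \<open>dop\<close> obeys the same shift rule; this closes the
  plain ideal under the derivations.\<close>

lemma differential_fibre_ideal:
  fixes ds :: "('a::field \<Rightarrow> 'a) list"
  assumes K: "differential_field ds" and P: "differential_ideal ds (m + n) P"
  shows "differential_ideal ds (m + n) (fibre_ideal ds m n P y)"
proof -
  note P' = differential_idealD[OF P]
  have var_dpolys: "pvar v - pconst c \<in> dpolys ds (m + n)" if "v \<in> dvars (length ds) m" for v and c :: 'a
  proof -
    have "v \<in> dvars (length ds) (m + n)" using that by (auto simp: dvars_def)
    then show ?thesis by (intro dpolys_closed dpolys_var)
  qed
  have sub: "p \<in> dpolys ds (m + n)" if "p \<in> fibre_ideal ds m n P y" for p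
    using that by induction (auto intro: P'(1) dpolys_closed dpolys_mult var_dpolys)
  have mult: "q * p \<in> fibre_ideal ds m n P y" if "p \<in> fibre_ideal ds m n P y" "q \<in> dpolys ds (m + n)" for p q
    using that
  proof induction
    case (base p)
    then show ?case using P'(4) by (intro fibre_ideal.base)
  next
    case (var r v)
    then have "(q * r) * (pvar v - pconst (dop ds (snd v) (y ! fst v))) \<in> fibre_ideal ds m n P y"
      by (intro fibre_ideal.var dpolys_mult)
    then show ?case by (simp only: mult.assoc)
  next
    case (add p p')
    then show ?case unfolding distrib_left by (intro fibre_ideal.add)
  qed
  have deriv: "dpoly_deriv ds j p \<in> fibre_ideal ds m n P y"
    if "p \<in> fibre_ideal ds m n P y" and j: "j < length ds" for p j
    using that(1)
  proof induction
    case (base p)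
    then show ?case using P'(6)[OF j] by (intro fibre_ideal.base)
  next
    case (var r v)
    note d = differential_field_nth[OF K j]
    have "dpoly_deriv ds j (r * (pvar v - pconst (dop ds (snd v) (y ! fst v)))) =
        dpoly_deriv ds j r * (pvar v - pconst (dop ds (snd v) (y ! fst v))) +
        r * (pvar (shift j v) - pconst (dop ds (snd (shift j v)) (y ! fst (shift j v))))"
      unfolding dpoly_deriv_mult[OF d] dpoly_deriv_diff[OF d] dpoly_deriv_var[OF d] dpoly_deriv_const[OF d]
      by (simp add: shift_def dop_add_single[OF K j, unfolded One_nat_def])
    then show ?case
      using var shift_in_dvars[OF var(2) j] dpolys_deriv[OF K j]
      by (simp add: fibre_ideal.add fibre_ideal.var)
  next
    case (add p p')
    then show ?case
      unfolding dpoly_deriv_add[OF differential_field_nth[OF K j]] by (intro fibre_ideal.add)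
  qed
  show ?thesis
    unfolding differential_ideal_def
    using sub mult deriv P'(2) by (auto intro: fibre_ideal.base fibre_ideal.add)
qed

text \<open>The generators from \<open>var\<close> vanish under every assignment that agrees with
  the jet of \<open>y\<close>. The element \<open>q\<close> is the same for all these assignments,
  so its rank can be bounded before an assignment is extended.\<close>

lemma fibre_ideal_ac_eval:
  assumes "p \<in> fibre_ideal ds m n P y" "differential_ideal ds (m + n) P"
  shows "\<exists>q\<in>P. \<forall>\<sigma>. (\<forall>v\<in>dvars (length ds) m. \<sigma> v = jet ds y v) \<longrightarrow> ac_eval \<sigma> p = ac_eval \<sigma> q"
  using assms(1)
proof induction
  case (var r v)
  then have "\<forall>\<sigma>. (\<forall>v\<in>dvars (length ds) m. \<sigma> v = jet ds y v) \<longrightarrow>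
      ac_eval \<sigma> (r * (pvar v - pconst (dop ds (snd v) (y ! fst v)))) = ac_eval \<sigma> 0"
    by (auto simp: ac_eval_mult ac_eval_diff jet_def)
  then show ?case using differential_idealD(2)[OF assms(2)] by blast
next
  case (add p p')
  then obtain q q' where q: "q \<in> P" "q' \<in> P"
    "\<forall>\<sigma>. (\<forall>v\<in>dvars (length ds) m. \<sigma> v = jet ds y v) \<longrightarrow> ac_eval \<sigma> p = ac_eval \<sigma> q"
    "\<forall>\<sigma>. (\<forall>v\<in>dvars (length ds) m. \<sigma> v = jet ds y v) \<longrightarrow> ac_eval \<sigma> p' = ac_eval \<sigma> q'" by blast
  then have "q + q' \<in> P" using differential_idealD(3)[OF assms(2)] by blast
  then show ?case using q(3,4) by (intro bexI[of _ "q + q'"]) (simp_all add: ac_eval_add)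
qed blast

text \<open>The exceptional \<open>h\<close> depends on \<open>P\<close> alone, whereas
  \<open>c\<close> may depend on the zero \<open>z\<close> and on \<open>b\<close>. So
  \<open>h\<close> is available before the point at which openness is claimed is chosen.\<close>

lemma projection_open:
  fixes ds :: "('a::field_char_0 \<Rightarrow> 'a) list"
  assumes DF: "differential_field ds" "differentially_closed ds" and P: "prime_dideal ds (m + n) P"
  obtains h where "h \<in> dpolys ds (m + n) - P"
    "\<forall>z b. (\<forall>p\<in>P. dpoly_eval ds p z = 0) \<and> dpoly_eval ds h z \<noteq> 0 \<and>
       b \<in> dpolys ds (m + n) \<and> dpoly_eval ds b z \<noteq> 0 \<longrightarrow>
       (\<exists>c\<in>dpolys ds m. dpoly_eval ds c z \<noteq> 0 \<and>
         (\<forall>y. length y = m \<and> (\<forall>p\<in>P \<inter> dpolys ds m. dpoly_eval ds p y = 0) \<and> dpoly_eval ds c y \<noteq> 0 \<longrightarrow>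
           (\<exists>x. length x = n \<and> (\<forall>p\<in>P. dpoly_eval ds p (y @ x) = 0) \<and> dpoly_eval ds b (y @ x) \<noteq> 0)))"
proof -
  obtain \<rho> where "ranked_prime ds m n P \<rho>"
    using ranked_prime_exists[OF DF(1) P] by blast
  then interpret ranked_prime ds m n P \<rho> .
  obtain h A where h: "characteristic h A" by (rule characteristic_exists)
  have hP: "h \<in> dpolys ds (m + n) - P" using h by (simp add: characteristic_def)
  have main: "\<exists>c\<in>dpolys ds m. dpoly_eval ds c z \<noteq> 0 \<and>
         (\<forall>y. length y = m \<and> (\<forall>p\<in>P \<inter> dpolys ds m. dpoly_eval ds p y = 0) \<and> dpoly_eval ds c y \<noteq> 0 \<longrightarrow>
           (\<exists>x. length x = n \<and> (\<forall>p\<in>P. dpoly_eval ds p (y @ x) = 0) \<and> dpoly_eval ds b (y @ x) \<noteq> 0))"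
    if z: "\<forall>p\<in>P. dpoly_eval ds p z = 0" "dpoly_eval ds h z \<noteq> 0"
      and b: "b \<in> dpolys ds (m + n)" "dpoly_eval ds b z \<noteq> 0" for z b
  proof -
    \<comment> \<open>The factor \<open>h\<close> is carried along so that the lifted assignment can
      be extended to arbitrarily high ranks.\<close>
    let ?\<zeta> = "jet ds z" and ?bh = "b * h"
    obtain i0 i1 where i01: "b \<in> polys_in (seg i0)" "h \<in> polys_in (seg i1)"
      using polys_in_seg_exists[OF b(1)] polys_in_seg_exists[of h] hP by (metis DiffD1)
    define i where "i = max i0 i1"
    have bi: "b \<in> polys_in (seg i)" and hi: "h \<in> polys_in (seg i)"
      using i01 polys_in_mono[OF seg_mono[of i0 i]] polys_in_mono[OF seg_mono[of i1 i]]
      by (auto simp: i_def)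
    have bhi: "?bh \<in> polys_in (seg i)" by (rule polys_in_mult[OF bi hi])
    have "\<And>p. p \<in> P \<Longrightarrow> ac_eval ?\<zeta> p = 0" "ac_eval ?\<zeta> h \<noteq> 0" "ac_eval ?\<zeta> ?bh \<noteq> 0"
      using z b(2) by (simp_all add: ac_eval_jet dpoly_eval_mult)
    from kills_lift[OF h this(1,2) bhi this(3)] obtain c where c: "c \<in> dpolys ds m" "ac_eval ?\<zeta> c \<noteq> 0"
      "\<And>\<tau>. kills 0 \<tau> \<Longrightarrow> ac_eval \<tau> c \<noteq> 0 \<Longrightarrow>
        \<exists>\<sigma>. (\<forall>v\<in>dvars (length ds) m. \<sigma> v = \<tau> v) \<and> kills i \<sigma> \<and> ac_eval \<sigma> ?bh \<noteq> 0"
      by blast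
    have "\<exists>x. length x = n \<and> (\<forall>p\<in>P. dpoly_eval ds p (y @ x) = 0) \<and> dpoly_eval ds b (y @ x) \<noteq> 0"
      if y: "length y = m" "\<forall>p\<in>P \<inter> dpolys ds m. dpoly_eval ds p y = 0" "dpoly_eval ds c y \<noteq> 0" for y
    proof -
      have "kills 0 (jet ds y)" using y(2) by (simp add: kills_def seg_0 ac_eval_jet)
      then obtain \<sigma> where \<sigma>: "\<forall>v\<in>dvars (length ds) m. \<sigma> v = jet ds y v" "kills i \<sigma>" "ac_eval \<sigma> ?bh \<noteq> 0"
        using c(3)[of "jet ds y"] y(3) by (auto simp: ac_eval_jet)
      let ?J = "fibre_ideal ds m n P y"
      have J: "differential_ideal ds (m + n) ?J"
        by (rule differential_fibre_ideal[OF DF(1) ideal])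
      \<comment> \<open>A power in the fibre ideal would agree with some \<open>q\<close> in
        \<open>P\<close> on all assignments over \<open>y\<close>. After extending
        \<open>\<sigma>\<close> up to the rank of \<open>q\<close>, the value of \<open>q\<close> is
        zero, while that of the power is unchanged and nonzero.\<close>
      have "?bh ^ l \<notin> ?J" for l
      proof
        assume "?bh ^ l \<in> ?J"
        then obtain q where q: "q \<in> P"
          "\<And>\<sigma>. (\<forall>v\<in>dvars (length ds) m. \<sigma> v = jet ds y v) \<Longrightarrow> ac_eval \<sigma> (?bh ^ l) = ac_eval \<sigma> q"
          using fibre_ideal_ac_eval[OF _ ideal] by blast
        obtain i2 where "q \<in> polys_in (seg i2)"
          using polys_in_seg_exists idealD(1)[OF q(1)] by blast
        then have qi: "q \<in> polys_in (seg (max i i2))"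
          using polys_in_mono[OF seg_mono[of i2 "max i i2"]] by auto
        have "ac_eval \<sigma> h \<noteq> 0" using \<sigma>(3) by (simp add: ac_eval_mult)
        from kills_extend[OF h hi \<sigma>(2) this, of "max i i2"] obtain \<sigma>' where
          \<sigma>': "\<forall>v\<in>seg i. \<sigma>' v = \<sigma> v" "kills (max i i2) \<sigma>'" by auto
        have "\<forall>v\<in>dvars (length ds) m. \<sigma>' v = jet ds y v"
          using \<sigma>(1) \<sigma>'(1) by (simp add: seg_def)
        then have "ac_eval \<sigma>' (?bh ^ l) = ac_eval \<sigma>' q" by (rule q(2))
        also have "\<dots> = 0" using \<sigma>'(2) q(1) qi by (simp add: kills_def)
        finally have "ac_eval \<sigma>' ?bh = 0" by (simp add: ac_eval_power)
        moreover have "ac_eval \<sigma>' ?bh = ac_eval \<sigma> ?bh"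
          by (rule ac_eval_cong[OF bhi]) (use \<sigma>'(1) in simp)
        ultimately show False using \<sigma>(3) by simp
      qed
      moreover have bhd: "?bh \<in> dpolys ds (m + n)" using polys_in_seg[OF bhi] .
      ultimately obtain Q where Q: "prime_dideal ds (m + n) Q" "?J \<subseteq> Q" "?bh \<notin> Q"
        using prime_dideal_exists[OF DF(1) J bhd] by blast
      then have "?bh \<in> dpolys ds (m + n) - Q" using bhd by simp
      from nullstellensatz[OF DF Q(1) this] obtain w where w: "length w = m + n"
        "\<And>p. p \<in> Q \<Longrightarrow> dpoly_eval ds p w = 0" "dpoly_eval ds ?bh w \<noteq> 0"
        by blast
      have "take m w = y"
      proof (rule nth_equalityI)
        fix l assume "l < length (take m w)"
        then have l: "l < m" by simp
        \<comment> \<open>The derivative of order zero is the coordinate itself, so its generator in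
          \<open>Q\<close> fixes the corresponding coordinate of the zero \<open>w\<close>.\<close>
        then have "(l, 0) \<in> dvars (length ds) m" by (simp add: dvars_def)
        from fibre_ideal.var[OF dpolys_closed(6) this] have "pvar (l, 0) - pconst (dop ds 0 (y ! l)) \<in> ?J"
          by (simp only: fst_conv snd_conv mult_1_left)
        then have "pvar (l, 0) - pconst (dop ds 0 (y ! l)) \<in> Q" using Q(2) by blast
        from w(2)[OF this] have "dop ds 0 (w ! l) = dop ds 0 (y ! l)"
          by (simp add: dpoly_eval_diff dpoly_eval_var)
        then show "take m w ! l = y ! l" using l by simp
      qed (use w(1) y(1) in simp)
      then have "w = y @ drop m w" by (metis append_take_drop_id)
      moreover have "\<forall>p\<in>P. dpoly_eval ds p w = 0"
        using w(2) Q(2) fibre_ideal.base by blast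
      moreover have "dpoly_eval ds b w \<noteq> 0"
        using w(3) by (simp add: dpoly_eval_mult)
      moreover have "length (drop m w) = n" using w(1) by simp
      ultimately show ?thesis by metis
    qed
    moreover have "dpoly_eval ds c z \<noteq> 0" using c(2) by (simp add: ac_eval_jet)
    ultimately show ?thesis using c(1) by blast
  qed
  show thesis using main by (intro that[OF hP]) blast
qed

section \<open>The Kolchin topology and morphisms\<close>

lemma topspace_kolchin:
  fixes ds :: "('a::field \<Rightarrow> 'a) list"
  shows "Y \<subseteq> {x. length x = n} \<Longrightarrow> topspace (kolchin ds n Y) = Y"
  by (auto simp: kolchin_def)

lemma openin_kolchin_basic:
  fixes ds :: "('a::field \<Rightarrow> 'a) list"
  assumes "Y \<subseteq> {x. length x = n}" "p \<in> dpolys ds n"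
  shows "openin (kolchin ds n Y) {x \<in> Y. dpoly_eval ds p x \<noteq> 0}"
proof -
  have "{x \<in> Y. dpoly_eval ds p x \<noteq> 0} = ({x. length x = n} - zero_set ds n {p}) \<inter> Y"
    using assms(1) by (auto simp: zero_set_def)
  moreover have "openin (kolchin_space ds n) ({x. length x = n} - zero_set ds n {p})"
    unfolding openin_kolchin_space using assms(2) by blast
  ultimately show ?thesis
    unfolding kolchin_def openin_subtopology by blast
qed

lemma openin_kolchin_nbhd:
  fixes ds :: "('a::field \<Rightarrow> 'a) list"
  assumes Y: "Y \<subseteq> {x. length x = n}" and U: "openin (kolchin ds n Y) U" and x: "x \<in> U"
  obtains p where "p \<in> dpolys ds n" "dpoly_eval ds p x \<noteq> 0" "{y \<in> Y. dpoly_eval ds p y \<noteq> 0} \<subseteq> U"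
proof -
  obtain T where T: "openin (kolchin_space ds n) T" "U = T \<inter> Y"
    using U unfolding kolchin_def openin_subtopology by blast
  then obtain E where E: "E \<subseteq> dpolys ds n" "T = {x. length x = n} - zero_set ds n E"
    unfolding openin_kolchin_space by blast
  then have "x \<notin> zero_set ds n E" "length x = n" using x T(2) by auto
  then obtain p where p: "p \<in> E" "dpoly_eval ds p x \<noteq> 0"
    by (auto simp: zero_set_def)
  then have "{y \<in> Y. dpoly_eval ds p y \<noteq> 0} \<subseteq> U"
    using Y T(2) E(2) by (auto simp: zero_set_def)
  then show thesis using p E(1) by (intro that[of p]) auto
qed

section \<open>Quotients of differential polynomials and continuity of morphisms\<close>

text \<open>One numerator and one denominator for the whole of \<open>U\<close>, whereas
  \<open>regular_function\<close> may change them from point to point.\<close>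

definition quotient_on :: "('a::field \<Rightarrow> 'a) list \<Rightarrow> nat \<Rightarrow> 'a list set \<Rightarrow> ('a list \<Rightarrow> 'a) \<Rightarrow> bool" where
  "quotient_on ds n U f \<longleftrightarrow> (\<exists>P\<in>dpolys ds n. \<exists>Q\<in>dpolys ds n.
     \<forall>y\<in>U. dpoly_eval ds Q y \<noteq> 0 \<and> f y = dpoly_eval ds P y / dpoly_eval ds Q y)"

lemma regular_function_iff:
  "regular_function ds n Y f \<longleftrightarrow>
     (\<forall>x\<in>Y. \<exists>U. openin (kolchin ds n Y) U \<and> x \<in> U \<and> quotient_on ds n U f)"
  by (simp add: regular_function_def quotient_on_def)

lemma quotient_onI:
  "P \<in> dpolys ds n \<Longrightarrow> Q \<in> dpolys ds n \<Longrightarrow> (\<And>y. y \<in> U \<Longrightarrow> dpoly_eval ds Q y \<noteq> 0) \<Longrightarrow>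
    (\<And>y. y \<in> U \<Longrightarrow> f y = dpoly_eval ds P y / dpoly_eval ds Q y) \<Longrightarrow> quotient_on ds n U f"
  unfolding quotient_on_def by blast

lemma quotient_onE:
  assumes "quotient_on ds n U f"
  obtains P Q where "P \<in> dpolys ds n" "Q \<in> dpolys ds n" "\<forall>y\<in>U. dpoly_eval ds Q y \<noteq> 0"
    "\<forall>y\<in>U. f y = dpoly_eval ds P y / dpoly_eval ds Q y"
  using assms unfolding quotient_on_def by blast

lemma quotient_on_dpoly: "p \<in> dpolys ds n \<Longrightarrow> (\<And>y. y \<in> U \<Longrightarrow> f y = dpoly_eval ds p y) \<Longrightarrow> quotient_on ds n U f"
  by (rule quotient_onI[of p _ _ 1]) (simp_all add: dpolys_closed)

lemma quotient_on_subset: "quotient_on ds n U f \<Longrightarrow> V \<subseteq> U \<Longrightarrow> quotient_on ds n V f"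
  unfolding quotient_on_def by blast

lemma quotient_on_cong:
  assumes "quotient_on ds n U f" "\<And>x. x \<in> U \<Longrightarrow> f x = g x"
  shows "quotient_on ds n U g"
proof -
  obtain P Q where f: "P \<in> dpolys ds n" "Q \<in> dpolys ds n" "\<forall>y\<in>U. dpoly_eval ds Q y \<noteq> 0"
    "\<forall>y\<in>U. f y = dpoly_eval ds P y / dpoly_eval ds Q y" by (rule quotient_onE[OF assms(1)])
  show ?thesis
    by (rule quotient_onI[of P _ _ Q]) (use f assms(2) in auto)
qed

lemma quotient_on_add:
  assumes "quotient_on ds n U f" "quotient_on ds n U g"
  shows "quotient_on ds n U (\<lambda>x. f x + g x)"
proof -
  obtain P Q where f: "P \<in> dpolys ds n" "Q \<in> dpolys ds n" "\<forall>y\<in>U. dpoly_eval ds Q y \<noteq> 0"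
    "\<forall>y\<in>U. f y = dpoly_eval ds P y / dpoly_eval ds Q y" by (rule quotient_onE[OF assms(1)])
  obtain P' Q' where g: "P' \<in> dpolys ds n" "Q' \<in> dpolys ds n" "\<forall>y\<in>U. dpoly_eval ds Q' y \<noteq> 0"
    "\<forall>y\<in>U. g y = dpoly_eval ds P' y / dpoly_eval ds Q' y" by (rule quotient_onE[OF assms(2)])
  show ?thesis
    by (rule quotient_onI[of "P * Q' + P' * Q" _ _ "Q * Q'"])
      (use f g in \<open>simp_all add: dpolys_closed dpolys_mult dpoly_eval_add dpoly_eval_mult add_frac_eq\<close>)
qed

lemma quotient_on_mult:
  assumes "quotient_on ds n U f" "quotient_on ds n U g"
  shows "quotient_on ds n U (\<lambda>x. f x * g x)"
proof -
  obtain P Q where f: "P \<in> dpolys ds n" "Q \<in> dpolys ds n" "\<forall>y\<in>U. dpoly_eval ds Q y \<noteq> 0"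
    "\<forall>y\<in>U. f y = dpoly_eval ds P y / dpoly_eval ds Q y" by (rule quotient_onE[OF assms(1)])
  obtain P' Q' where g: "P' \<in> dpolys ds n" "Q' \<in> dpolys ds n" "\<forall>y\<in>U. dpoly_eval ds Q' y \<noteq> 0"
    "\<forall>y\<in>U. g y = dpoly_eval ds P' y / dpoly_eval ds Q' y" by (rule quotient_onE[OF assms(2)])
  show ?thesis
    by (rule quotient_onI[of "P * P'" _ _ "Q * Q'"])
      (use f g in \<open>simp_all add: dpolys_mult dpoly_eval_mult\<close>)
qed

lemma quotient_on_divide:
  assumes "quotient_on ds n U f" "quotient_on ds n U g" "\<And>x. x \<in> U \<Longrightarrow> g x \<noteq> 0"
  shows "quotient_on ds n U (\<lambda>x. f x / g x)"
proof -
  obtain P Q where f: "P \<in> dpolys ds n" "Q \<in> dpolys ds n" "\<forall>y\<in>U. dpoly_eval ds Q y \<noteq> 0"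
    "\<forall>y\<in>U. f y = dpoly_eval ds P y / dpoly_eval ds Q y" by (rule quotient_onE[OF assms(1)])
  obtain P' Q' where g: "P' \<in> dpolys ds n" "Q' \<in> dpolys ds n" "\<forall>y\<in>U. dpoly_eval ds Q' y \<noteq> 0"
    "\<forall>y\<in>U. g y = dpoly_eval ds P' y / dpoly_eval ds Q' y" by (rule quotient_onE[OF assms(2)])
  have "dpoly_eval ds P' y \<noteq> 0" if "y \<in> U" for y
    using assms(3)[OF that] g(4) that by auto
  then show ?thesis
    by (intro quotient_onI[of "P * Q'" _ _ "Q * P'"])
      (use f g in \<open>simp_all add: dpolys_mult dpoly_eval_mult\<close>)
qed

lemma derivation_divide:
  fixes p q :: "'a::field"
  assumes "derivation d" "q \<noteq> 0"
  shows "d (p / q) = (d p * q - p * d q) / (q * q)"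
proof -
  have "d (p / q * q) = d (p / q) * q + p / q * d q"
    using assms(1) by (simp only: derivation_def)
  then show ?thesis using assms(2) by (simp add: field_simps)
qed

lemma quotient_on_deriv:
  fixes ds :: "('a::field \<Rightarrow> 'a) list"
  assumes K: "differential_field ds" and f: "quotient_on ds n U f" and j: "j < length ds"
  shows "quotient_on ds n U (\<lambda>x. (ds ! j) (f x))"
proof -
  obtain P Q where f: "P \<in> dpolys ds n" "Q \<in> dpolys ds n" "\<forall>y\<in>U. dpoly_eval ds Q y \<noteq> 0"
    "\<forall>y\<in>U. f y = dpoly_eval ds P y / dpoly_eval ds Q y" by (rule quotient_onE[OF f])
  show ?thesis
    by (rule quotient_onI[of "dpoly_deriv ds j P * Q - P * dpoly_deriv ds j Q" _ _ "Q * Q"])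
      (use f in \<open>simp_all add: dpolys_closed dpolys_mult dpolys_deriv[OF K j] dpoly_eval_diff dpoly_eval_mult
        dpoly_eval_deriv[OF K j] derivation_divide[OF differential_field_nth[OF K j]]\<close>)
qed

lemma quotient_on_dop:
  fixes ds :: "('a::field \<Rightarrow> 'a) list"
  assumes K: "differential_field ds" and f: "quotient_on ds n U f"
  shows "quotient_on ds n U (\<lambda>x. dop ds \<theta> (f x))"
proof -
  have pow: "quotient_on ds n U (\<lambda>x. ((ds ! j) ^^ k) (g x))"
    if "j < length ds" "quotient_on ds n U g" for j g and k :: nat
    using that by (induction k) (simp_all add: quotient_on_deriv[OF K])
  have "quotient_on ds n U (\<lambda>x. foldr (\<lambda>j. (ds ! j) ^^ lookup \<theta> j) js (f x))"
    if "set js \<subseteq> {..<length ds}" for js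
    using that by (induction js) (simp_all add: f pow)
  from this[of "[0..<length ds]"] show ?thesis
    by (simp add: dop_def atLeast0LessThan)
qed

text \<open>By the quotient rule, derivatives of quotients are quotients with nonvanishing
  denominators, so substituting quotients into a differential polynomial gives one again.\<close>

lemma quotient_on_compose:
  fixes ds :: "('a::field \<Rightarrow> 'a) list"
  assumes K: "differential_field ds" and f: "\<And>i. i < m \<Longrightarrow> quotient_on ds n U (\<lambda>x. f x ! i)"
    and p: "p \<in> dpolys ds m"
  shows "quotient_on ds n U (\<lambda>x. dpoly_eval ds p (f x))"
  using p unfolding dpolys_eq
proof (induction rule: polys_in_induct)
  case (const c)
  then show ?case by (intro quotient_on_dpoly[of "pconst c"]) (simp_all add: dpolys_closed)
next
  case (var v)
  then show ?case
    using quotient_on_dop[OF K f] by (simp add: dpoly_eval_var dvars_def)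
next
  case (add p q)
  then show ?case by (simp add: dpoly_eval_add quotient_on_add)
next
  case (mult p q)
  then show ?case by (simp add: dpoly_eval_mult quotient_on_mult)
qed

lemma regular_functions_nbhd:
  fixes ds :: "('a::field \<Rightarrow> 'a) list" and m :: nat
  assumes Y: "Y \<subseteq> {x. length x = n}" and f: "\<And>i. i < m \<Longrightarrow> regular_function ds n Y (f i)" and x: "x \<in> Y"
  obtains U where "openin (kolchin ds n Y) U" "x \<in> U" "\<And>i. i < m \<Longrightarrow> quotient_on ds n U (f i)"
proof -
  have "\<exists>U. openin (kolchin ds n Y) U \<and> x \<in> U \<and> (\<forall>i<m. quotient_on ds n U (f i))"
    using f
  proof (induction m)
    case 0
    have "openin (kolchin ds n Y) Y"
      using openin_topspace[of "kolchin ds n Y"] topspace_kolchin[OF Y] by simp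
    then show ?case using x by blast
  next
    case (Suc m)
    then obtain U where U: "openin (kolchin ds n Y) U" "x \<in> U" "\<forall>i<m. quotient_on ds n U (f i)"
      by auto
    obtain V where V: "openin (kolchin ds n Y) V" "x \<in> V" "quotient_on ds n V (f m)"
      using Suc.prems[of m] x by (auto simp: regular_function_iff)
    have "quotient_on ds n (U \<inter> V) (f i)" if "i < Suc m" for i
    proof (cases "i = m")
      case True
      then show ?thesis using V(3) quotient_on_subset by blast
    next
      case False
      then show ?thesis using U(3) that quotient_on_subset[of ds n U "f i" "U \<inter> V"] by auto
    qed
    then show ?case using U(1,2) V(1,2) by (intro exI[of _ "U \<inter> V"]) auto
  qed
  then show thesis using that by blast
qed

text \<open>Continuity in the Kolchin topology: near a point, \<open>p\<close> composed with
  \<open>f\<close> is a quotient, which is nonzero exactly where its numerator is.\<close>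

lemma regular_preimage_open:
  fixes ds :: "('a::field \<Rightarrow> 'a) list"
  assumes K: "differential_field ds" and Y: "Y \<subseteq> {x. length x = n}" and Z: "Z \<subseteq> {x. length x = m}"
    and f: "f ` Y \<subseteq> Z" "\<And>i. i < m \<Longrightarrow> regular_function ds n Y (\<lambda>x. f x ! i)"
    and V: "openin (kolchin ds m Z) V"
  shows "openin (kolchin ds n Y) {x \<in> Y. f x \<in> V}"
proof (subst openin_subopen, intro ballI)
  fix x assume x: "x \<in> {x \<in> Y. f x \<in> V}"
  then have xY: "x \<in> Y" by simp
  obtain p where p: "p \<in> dpolys ds m" "dpoly_eval ds p (f x) \<noteq> 0" "{y \<in> Z. dpoly_eval ds p y \<noteq> 0} \<subseteq> V"
    using openin_kolchin_nbhd[OF Z V, of "f x"] x by blast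
  obtain U where U: "openin (kolchin ds n Y) U" "x \<in> U" "\<And>i. i < m \<Longrightarrow> quotient_on ds n U (\<lambda>x. f x ! i)"
    using regular_functions_nbhd[OF Y, where m = m and f = "\<lambda>i x. f x ! i", OF f(2) xY] by blast
  obtain P Q where PQ: "P \<in> dpolys ds n" "Q \<in> dpolys ds n" "\<forall>y\<in>U. dpoly_eval ds Q y \<noteq> 0"
    "\<forall>y\<in>U. dpoly_eval ds p (f y) = dpoly_eval ds P y / dpoly_eval ds Q y"
    by (rule quotient_onE[OF quotient_on_compose[OF K U(3) p(1)]])
  let ?W = "U \<inter> {y \<in> Y. dpoly_eval ds P y \<noteq> 0}"
  have "openin (kolchin ds n Y) ?W"
    using U(1) openin_kolchin_basic[OF Y PQ(1)] by (rule openin_Int)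
  moreover have "x \<in> ?W"
    using U(2) xY PQ(4) p(2) by auto
  moreover have "?W \<subseteq> {x \<in> Y. f x \<in> V}"
  proof
    fix y assume y: "y \<in> ?W"
    then have "dpoly_eval ds p (f y) \<noteq> 0" using PQ(3,4) by simp
    moreover have "f y \<in> Z" using y f(1) by blast
    ultimately show "y \<in> {x \<in> Y. f x \<in> V}" using p(3) y by blast
  qed
  ultimately show "\<exists>T. openin (kolchin ds n Y) T \<and> x \<in> T \<and> T \<subseteq> {x \<in> Y. f x \<in> V}" by blast
qed

lemma regular_function_compose:
  fixes ds :: "('a::field \<Rightarrow> 'a) list"
  assumes K: "differential_field ds" and Y: "Y \<subseteq> {x. length x = n}" and Z: "Z \<subseteq> {x. length x = m}"
    and f: "f ` Y \<subseteq> Z" "\<And>i. i < m \<Longrightarrow> regular_function ds n Y (\<lambda>x. f x ! i)"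
    and g: "regular_function ds m Z g"
  shows "regular_function ds n Y (\<lambda>x. g (f x))"
  unfolding regular_function_iff
proof
  fix x assume x: "x \<in> Y"
  then have "f x \<in> Z" using f(1) by blast
  then obtain V where V: "openin (kolchin ds m Z) V" "f x \<in> V" "quotient_on ds m V g"
    using g by (auto simp: regular_function_iff)
  obtain U where U: "openin (kolchin ds n Y) U" "x \<in> U" "\<And>i. i < m \<Longrightarrow> quotient_on ds n U (\<lambda>x. f x ! i)"
    using regular_functions_nbhd[OF Y, where m = m and f = "\<lambda>i x. f x ! i", OF f(2) x] by blast
  obtain P Q where PQ: "P \<in> dpolys ds m" "Q \<in> dpolys ds m" "\<forall>y\<in>V. dpoly_eval ds Q y \<noteq> 0"
    "\<forall>y\<in>V. g y = dpoly_eval ds P y / dpoly_eval ds Q y" by (rule quotient_onE[OF V(3)])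
  let ?W = "U \<inter> {x \<in> Y. f x \<in> V}"
  have "openin (kolchin ds n Y) ?W"
    using U(1) regular_preimage_open[OF K Y Z f V(1)] by (rule openin_Int)
  moreover have "x \<in> ?W" using U(2) V(2) x by simp
  moreover have "quotient_on ds n ?W (\<lambda>x. g (f x))"
  proof -
    have f_W: "quotient_on ds n ?W (\<lambda>x. f x ! i)" if "i < m" for i
      using U(3)[OF that] quotient_on_subset by blast
    have "quotient_on ds n ?W (\<lambda>x. dpoly_eval ds P (f x) / dpoly_eval ds Q (f x))"
      by (rule quotient_on_divide[OF quotient_on_compose[OF K f_W PQ(1)] quotient_on_compose[OF K f_W PQ(2)]])
        (use PQ(3) in auto)
    then show ?thesis
      by (rule quotient_on_cong) (use PQ(4) in simp)
  qed
  ultimately show "\<exists>U. openin (kolchin ds n Y) U \<and> x \<in> U \<and> quotient_on ds n U (\<lambda>x. g (f x))"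
    by blast
qed

lemma regular_function_quotient:
  fixes ds :: "('a::field \<Rightarrow> 'a) list"
  assumes "Y \<subseteq> {x. length x = n}" "quotient_on ds n Y f"
  shows "regular_function ds n Y f"
  using assms openin_topspace[of "kolchin ds n Y"] topspace_kolchin[OF assms(1)]
  unfolding regular_function_iff by metis

lemma quotient_on_coordinate:
  fixes ds :: "('a::field \<Rightarrow> 'a) list"
  shows "i < n \<Longrightarrow> quotient_on ds n U (\<lambda>x. x ! i)"
  by (rule quotient_on_dpoly[of "pvar (i, 0)"]) (simp_all add: dpolys_var dvars_def dpoly_eval_var)

lemma quotient_on_const:
  fixes ds :: "('a::field \<Rightarrow> 'a) list"
  shows "quotient_on ds n U (\<lambda>x. c)"
  by (rule quotient_on_dpoly[of "pconst c"]) (simp_all add: dpolys_closed)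

lemma dpolys_mono: "n \<le> n' \<Longrightarrow> dpolys ds n \<subseteq> dpolys ds n'"
  by (force simp: dpolys_def)

lemma dpoly_eval_append:
  fixes p :: "'a::field dpoly"
  assumes "p \<in> dpolys ds m" "length y = m"
  shows "dpoly_eval ds p (y @ x) = dpoly_eval ds p y"
  using assms(1) unfolding dpolys_eq
  by (induction rule: polys_in_induct)
    (simp_all add: dpoly_eval_add dpoly_eval_mult dpoly_eval_var dvars_def nth_append assms(2))

text \<open>Each indeterminate \<open>i\<close> is renamed to \<open>m + i\<close>; the values alone
  describe the result. In this way polynomials in \<open>x\<close> become polynomials on a graph
  with points \<open>y @ x\<close>.\<close>

lemma dpoly_raise_indices:
  fixes p :: "'a::field dpoly"
  assumes "p \<in> dpolys ds n"
  shows "\<exists>q\<in>dpolys ds (m + n). \<forall>y x. length y = m \<longrightarrow> dpoly_eval ds q (y @ x) = dpoly_eval ds p x"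
  using assms unfolding dpolys_eq[of ds n]
proof (induction rule: polys_in_induct)
  case (const c)
  then show ?case by (intro bexI[of _ "pconst c"]) (simp_all add: dpolys_closed)
next
  case (var v)
  then show ?case
    by (intro bexI[of _ "pvar (m + fst v, snd v)"])
      (auto simp: dpolys_var dvars_def dpoly_eval_var nth_append)
next
  case (add p p')
  then obtain q q' where "q \<in> dpolys ds (m + n)" "q' \<in> dpolys ds (m + n)"
    "\<forall>y x. length y = m \<longrightarrow> dpoly_eval ds q (y @ x) = dpoly_eval ds p x"
    "\<forall>y x. length y = m \<longrightarrow> dpoly_eval ds q' (y @ x) = dpoly_eval ds p' x" by blast
  then show ?case
    by (intro bexI[of _ "q + q'"]) (simp_all add: dpoly_eval_add dpolys_closed)
next
  case (mult p p')
  then obtain q q' where "q \<in> dpolys ds (m + n)" "q' \<in> dpolys ds (m + n)"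
    "\<forall>y x. length y = m \<longrightarrow> dpoly_eval ds q (y @ x) = dpoly_eval ds p x"
    "\<forall>y x. length y = m \<longrightarrow> dpoly_eval ds q' (y @ x) = dpoly_eval ds p' x" by blast
  then show ?case
    by (intro bexI[of _ "q * q'"]) (simp_all add: dpoly_eval_mult dpolys_mult)
qed

section \<open>Translations\<close>

lemma differential_variety_length: "differential_variety ds n Y \<Longrightarrow> Y \<subseteq> {x. length x = n}"
  by (auto simp: differential_variety_def zero_set_def)

text \<open>The image under translation by \<open>g\<close> is the preimage under translation by the
  inverse. The latter is regular, being the multiplication composed with the map that puts a
  constant first factor in front.\<close>

lemma translation_open:
  fixes ds :: "('a::field \<Rightarrow> 'a) list"
  assumes K: "differential_field ds" and G: "differential_algebraic_group ds n G"
    and g: "g \<in> carrier G" and U: "openin (kolchin ds n (carrier G)) U"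
  shows "openin (kolchin ds n (carrier G)) ((\<lambda>x. g \<otimes>\<^bsub>G\<^esub> x) ` U)"
proof -
  interpret group G using G by (simp add: differential_algebraic_group_def)
  let ?Y = "carrier G" and ?h = "inv\<^bsub>G\<^esub> g"
  let ?Z = "{x @ y |x y. x \<in> carrier G \<and> y \<in> carrier G}"
  have Y: "?Y \<subseteq> {x. length x = n}"
    using G differential_variety_length by (auto simp: differential_algebraic_group_def)
  then have len: "length x = n" if "x \<in> ?Y" for x using that by blast
  then have Z: "?Z \<subseteq> {x. length x = 2 * n}" by auto
  have h: "?h \<in> ?Y" "length ?h = n" using g len by auto
  have UY: "U \<subseteq> ?Y" using openin_subset[OF U] topspace_kolchin[OF Y] by simp
  have mult: "regular_function ds (2 * n) ?Z (\<lambda>z. (take n z \<otimes>\<^bsub>G\<^esub> drop n z) ! i)" if "i < n" for i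
    using G that by (auto simp: differential_algebraic_group_def differential_morphism_def)
  have coord: "regular_function ds n ?Y (\<lambda>x. (?h @ x) ! i)" if "i < 2 * n" for i
  proof (cases "i < n")
    case True
    then show ?thesis
      using h(2) quotient_on_const by (intro regular_function_quotient Y) (simp add: nth_append)
  next
    case False
    then show ?thesis
      using h(2) that by (intro regular_function_quotient Y) (simp add: nth_append quotient_on_coordinate)
  qed
  have "regular_function ds n ?Y (\<lambda>x. (take n (?h @ x) \<otimes>\<^bsub>G\<^esub> drop n (?h @ x)) ! i)" if "i < n" for i
    using h(1) by (intro regular_function_compose[OF K Y Z _ coord mult[OF that]]) auto
  then have "regular_function ds n ?Y (\<lambda>x. (?h \<otimes>\<^bsub>G\<^esub> x) ! i)" if "i < n" for i
    using that h(2) by simp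
  then have "openin (kolchin ds n ?Y) {x \<in> ?Y. ?h \<otimes>\<^bsub>G\<^esub> x \<in> U}"
    using h(1) by (intro regular_preimage_open[OF K Y Y _ _ U]) auto
  also have "{x \<in> ?Y. ?h \<otimes>\<^bsub>G\<^esub> x \<in> U} = (\<lambda>x. g \<otimes>\<^bsub>G\<^esub> x) ` U"
  proof (intro equalityI subsetI)
    fix x assume "x \<in> {x \<in> ?Y. ?h \<otimes>\<^bsub>G\<^esub> x \<in> U}"
    then show "x \<in> (\<lambda>x. g \<otimes>\<^bsub>G\<^esub> x) ` U"
      using g by (intro image_eqI[of _ _ "?h \<otimes>\<^bsub>G\<^esub> x"]) (simp_all add: m_assoc[symmetric])
  next
    fix x assume "x \<in> (\<lambda>x. g \<otimes>\<^bsub>G\<^esub> x) ` U"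
    then show "x \<in> {x \<in> ?Y. ?h \<otimes>\<^bsub>G\<^esub> x \<in> U}"
      using g UY by (auto simp: m_assoc[symmetric])
  qed
  finally show ?thesis .
qed

section \<open>Irreducible open subsets and finite covers by translates\<close>

text \<open>Among the nonempty basic open subsets one with maximal vanishing ideal is chosen.
  Shrinking it cannot enlarge the ideal, so each nonempty basic open part is dense in it, which is
  irreducibility. This replaces a decomposition of \<open>Y\<close> into components.\<close>

lemma irreducible_open_subset:
  fixes ds :: "('a::field_char_0 \<Rightarrow> 'a) list"
  assumes K: "differential_field ds" and Y: "Y \<subseteq> {x. length x = n}" "Y \<noteq> {}"
  obtains q where "q \<in> dpolys ds n" "{x \<in> Y. dpoly_eval ds q x \<noteq> 0} \<noteq> {}"
    "\<forall>r\<in>dpolys ds n. {x \<in> Y. dpoly_eval ds (q * r) x \<noteq> 0} \<noteq> {} \<longrightarrow>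
       vanishing ds n {x \<in> Y. dpoly_eval ds (q * r) x \<noteq> 0} = vanishing ds n {x \<in> Y. dpoly_eval ds q x \<noteq> 0}"
proof -
  let ?O = "\<lambda>q. {x \<in> Y. dpoly_eval ds q x \<noteq> 0}"
  define \<V> where "\<V> = {vanishing ds n (?O q) |q. q \<in> dpolys ds n \<and> ?O q \<noteq> {}}"
  have "vanishing ds n (?O 1) \<in> \<V>"
    unfolding \<V>_def using Y(2) dpolys_closed(6) by fastforce
  then have "\<V> \<noteq> {}" by blast
  moreover have "\<Union>\<C> \<in> \<V>" if \<C>: "\<C> \<noteq> {}" "subset.chain \<V> \<C>" for \<C>
  proof -
    have sub: "\<C> \<subseteq> \<V>" using \<C>(2) by (simp add: subset.chain_def)
    have "I \<subseteq> dpolys ds n" if "I \<in> \<V>" for I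
      using that unfolding \<V>_def vanishing_def by blast
    then have dp: "\<Union>\<C> \<subseteq> dpolys ds n" using sub by blast
    \<comment> \<open>A finite part of the union has the same zeros as the union and sits in one
      member of the chain, which therefore is the whole union.\<close>
    obtain F where F: "finite F" "F \<subseteq> \<Union>\<C>" "zero_set ds n F = zero_set ds n (\<Union>\<C>)"
      using zero_set_finite[OF K dp] by blast
    obtain I where I: "I \<in> \<C>" "F \<subseteq> I"
      using finite_subset_Union_chain[OF F(1,2) \<C>] by blast
    obtain q where q: "I = vanishing ds n (?O q)" using I(1) sub unfolding \<V>_def by blast
    have "p \<in> I" if "p \<in> \<Union>\<C>" for p
    proof -
      have "dpoly_eval ds p x = 0" if "x \<in> ?O q" for x
      proof -
        have "x \<in> zero_set ds n I"
          using that Y(1) by (auto simp: q zero_set_def vanishing_def)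
        then have "x \<in> zero_set ds n (\<Union>\<C>)"
          using zero_set_antimono[OF I(2)] F(3) by blast
        then show ?thesis using \<open>p \<in> \<Union>\<C>\<close> unfolding zero_set_def by blast
      qed
      then show ?thesis
        using that dp unfolding q vanishing_def by blast
    qed
    then have "\<Union>\<C> = I" using I(1) by blast
    then show ?thesis using I(1) sub by blast
  qed
  ultimately obtain M where M: "M \<in> \<V>" "\<And>I. I \<in> \<V> \<Longrightarrow> M \<subseteq> I \<Longrightarrow> I = M"
    using subset_Zorn_nonempty[of \<V>] by blast
  then obtain q where q: "q \<in> dpolys ds n" "?O q \<noteq> {}" "M = vanishing ds n (?O q)"
    unfolding \<V>_def by blast
  have "vanishing ds n (?O (q * r)) = vanishing ds n (?O q)"
    if r: "r \<in> dpolys ds n" "?O (q * r) \<noteq> {}" for r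
  proof -
    have "vanishing ds n (?O (q * r)) \<in> \<V>"
      unfolding \<V>_def using r dpolys_mult[OF q(1) r(1)] by blast
    moreover have "M \<subseteq> vanishing ds n (?O (q * r))"
      unfolding q(3) by (auto simp: vanishing_def dpoly_eval_mult)
    ultimately show ?thesis using M(2) q(3) by blast
  qed
  then show thesis using that[OF q(1,2)] by blast
qed

text \<open>If the open set is not inside \<open>C\<close>, its part outside \<open>C\<close> is
  open, nonempty and covered by the remaining sets.\<close>

lemma finite_closed_cover_interior:
  assumes "finite \<C>" "\<And>C. C \<in> \<C> \<Longrightarrow> closedin T C" "openin T U" "U \<noteq> {}" "U \<subseteq> \<Union>\<C>"
  shows "\<exists>C\<in>\<C>. \<exists>V. openin T V \<and> V \<noteq> {} \<and> V \<subseteq> C"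
  using assms
proof (induction arbitrary: U)
  case (insert C \<C>)
  show ?case
  proof (cases "U \<subseteq> C")
    case True
    then show ?thesis using insert.prems by blast
  next
    case False
    have "openin T (U - C)" using insert.prems by (intro openin_diff) auto
    moreover have "U - C \<noteq> {}" "U - C \<subseteq> \<Union>\<C>" using False insert.prems(4) by auto
    ultimately have "\<exists>C\<in>\<C>. \<exists>V. openin T V \<and> V \<noteq> {} \<and> V \<subseteq> C"
      using insert.prems(1) by (intro insert.IH) auto
    then show ?thesis by blast
  qed
qed simp

text \<open>Quasi-compactness. The basic open sets that fit into some translate of \<open>U\<close>
  cover \<open>G\<close>, so their polynomials and the equations of \<open>G\<close> have no common
  zero; then finitely many of them have none either.\<close>

lemma finite_translate_cover:
  fixes ds :: "('a::field_char_0 \<Rightarrow> 'a) list"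
  assumes K: "differential_field ds" and G: "differential_algebraic_group ds n G"
    and U: "openin (kolchin ds n (carrier G)) U" "U \<noteq> {}"
  obtains S where "finite S" "S \<subseteq> carrier G" "carrier G \<subseteq> (\<Union>g\<in>S. (\<lambda>x. g \<otimes>\<^bsub>G\<^esub> x) ` U)"
proof -
  interpret group G using G by (simp add: differential_algebraic_group_def)
  let ?Y = "carrier G"
  obtain I where I: "I \<subseteq> dpolys ds n" "?Y = zero_set ds n I"
    using G by (auto simp: differential_algebraic_group_def differential_variety_def differential_ideal_def)
  have Y: "?Y \<subseteq> {x. length x = n}" unfolding I(2) by (auto simp: zero_set_def)
  have UY: "U \<subseteq> ?Y" using openin_subset[OF U(1)] topspace_kolchin[OF Y] by simp
  obtain u where u: "u \<in> U" using U(2) by blast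
  define E where "E = {p \<in> dpolys ds n. \<exists>g\<in>?Y. {x \<in> ?Y. dpoly_eval ds p x \<noteq> 0} \<subseteq> (\<lambda>x. g \<otimes>\<^bsub>G\<^esub> x) ` U}"
  have "zero_set ds n (I \<union> E) = {}"
  proof (rule ccontr)
    assume "zero_set ds n (I \<union> E) \<noteq> {}"
    then obtain a where a: "a \<in> ?Y" "\<And>p. p \<in> E \<Longrightarrow> dpoly_eval ds p a = 0"
      unfolding I(2) by (auto simp: zero_set_def)
    let ?g = "a \<otimes>\<^bsub>G\<^esub> inv\<^bsub>G\<^esub> u"
    have uG: "u \<in> ?Y" using u UY by blast
    then have g: "?g \<in> ?Y" using a(1) by simp
    have "a = ?g \<otimes>\<^bsub>G\<^esub> u" using a(1) uG by (simp add: m_assoc)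
    then have "a \<in> (\<lambda>x. ?g \<otimes>\<^bsub>G\<^esub> x) ` U" using u by blast
    then obtain p where "p \<in> dpolys ds n" "dpoly_eval ds p a \<noteq> 0"
      "{x \<in> ?Y. dpoly_eval ds p x \<noteq> 0} \<subseteq> (\<lambda>x. ?g \<otimes>\<^bsub>G\<^esub> x) ` U"
      using openin_kolchin_nbhd[OF Y translation_open[OF K G g U(1)]] by blast
    then show False using a(2)[of p] g unfolding E_def by blast
  qed
  moreover have IE: "I \<union> E \<subseteq> dpolys ds n" using I(1) unfolding E_def by blast
  ultimately obtain F where F: "finite F" "F \<subseteq> I \<union> E" "zero_set ds n F = {}"
    using zero_set_finite[OF K IE] by auto
  have "\<forall>p\<in>F \<inter> E. \<exists>g. g \<in> ?Y \<and> {x \<in> ?Y. dpoly_eval ds p x \<noteq> 0} \<subseteq> (\<lambda>x. g \<otimes>\<^bsub>G\<^esub> x) ` U"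
    unfolding E_def by blast
  from bchoice[OF this] obtain t where t: "\<And>p. p \<in> F \<inter> E \<Longrightarrow> t p \<in> ?Y"
    "\<And>p. p \<in> F \<inter> E \<Longrightarrow> {x \<in> ?Y. dpoly_eval ds p x \<noteq> 0} \<subseteq> (\<lambda>x. t p \<otimes>\<^bsub>G\<^esub> x) ` U"
    by blast
  show thesis
  proof
    show "finite (t ` (F \<inter> E))" using F(1) by simp
    show "t ` (F \<inter> E) \<subseteq> ?Y" using t(1) by blast
    show "?Y \<subseteq> (\<Union>g\<in>t ` (F \<inter> E). (\<lambda>x. g \<otimes>\<^bsub>G\<^esub> x) ` U)"
    proof
      fix a assume a: "a \<in> ?Y"
      have "a \<notin> zero_set ds n F" using F(3) by simp
      then obtain p where p: "p \<in> F" "dpoly_eval ds p a \<noteq> 0"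
        using a Y by (auto simp: zero_set_def)
      then have "p \<notin> I" using a unfolding I(2) by (auto simp: zero_set_def)
      then have pE: "p \<in> F \<inter> E" using p(1) F(2) by blast
      then have "a \<in> (\<lambda>x. t p \<otimes>\<^bsub>G\<^esub> x) ` U" using t(2)[OF pE] a p(2) by blast
      then show "a \<in> (\<Union>g\<in>t ` (F \<inter> E). (\<lambda>x. g \<otimes>\<^bsub>G\<^esub> x) ` U)" using pE by blast
    qed
  qed
qed

section \<open>Homomorphisms\<close>

text \<open>On the graph a polynomial becomes a quotient in \<open>x\<close> alone with nonvanishing
  denominator. A product therefore vanishes on the graph only if the product of the numerators
  vanishes on \<open>U\<close>, where \<open>irr\<close> applies.\<close>

lemma prime_graph_ideal:
  fixes ds :: "('a::field \<Rightarrow> 'a) list"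
  assumes K: "differential_field ds"
    and irr: "\<And>a b. a \<in> dpolys ds n \<Longrightarrow> b \<in> dpolys ds n \<Longrightarrow> \<forall>x\<in>U. dpoly_eval ds (a * b) x = 0 \<Longrightarrow>
      (\<forall>x\<in>U. dpoly_eval ds a x = 0) \<or> (\<forall>x\<in>U. dpoly_eval ds b x = 0)"
    and U: "U \<noteq> {}" "\<And>x. x \<in> U \<Longrightarrow> length x = n"
    and f: "\<And>x. x \<in> U \<Longrightarrow> length (f x) = m" "\<And>i. i < m \<Longrightarrow> quotient_on ds n U (\<lambda>x. f x ! i)"
  shows "prime_dideal ds (m + n) (vanishing ds (m + n) ((\<lambda>x. f x @ x) ` U))"
proof -
  let ?P = "vanishing ds (m + n) ((\<lambda>x. f x @ x) ` U)"
  have D: "differential_ideal ds (m + n) ?P"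
    using radical_vanishing[OF K] by (simp add: radical_dideal_def)
  have one: "1 \<notin> ?P"
    using U(1) by (simp add: vanishing_def)
  have coord: "quotient_on ds n U (\<lambda>x. (f x @ x) ! i)" if i: "i < m + n" for i
  proof (cases "i < m")
    case True
    show ?thesis
      by (rule quotient_on_cong[OF f(2)[OF True]]) (simp add: nth_append f(1) True)
  next
    case False
    then have "quotient_on ds n U (\<lambda>x. x ! (i - m))"
      using i by (intro quotient_on_coordinate) simp
    then show ?thesis
      by (rule quotient_on_cong) (simp add: nth_append f(1) False)
  qed
  have "a \<in> ?P \<or> b \<in> ?P" if ab: "a \<in> dpolys ds (m + n)" "b \<in> dpolys ds (m + n)" "a * b \<in> ?P" for a b
  proof -
    obtain A A' where A: "A \<in> dpolys ds n" "A' \<in> dpolys ds n" "\<forall>x\<in>U. dpoly_eval ds A' x \<noteq> 0"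
      "\<forall>x\<in>U. dpoly_eval ds a (f x @ x) = dpoly_eval ds A x / dpoly_eval ds A' x"
      by (rule quotient_onE[OF quotient_on_compose[OF K coord ab(1)]])
    obtain B B' where B: "B \<in> dpolys ds n" "B' \<in> dpolys ds n" "\<forall>x\<in>U. dpoly_eval ds B' x \<noteq> 0"
      "\<forall>x\<in>U. dpoly_eval ds b (f x @ x) = dpoly_eval ds B x / dpoly_eval ds B' x"
      by (rule quotient_onE[OF quotient_on_compose[OF K coord ab(2)]])
    have "dpoly_eval ds (A * B) x = 0" if x: "x \<in> U" for x
    proof -
      have "dpoly_eval ds a (f x @ x) * dpoly_eval ds b (f x @ x) = 0"
        using ab(3) x by (simp add: vanishing_def dpoly_eval_mult)
      then show ?thesis using A(3,4) B(3,4) x by (simp add: dpoly_eval_mult)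
    qed
    then have "(\<forall>x\<in>U. dpoly_eval ds A x = 0) \<or> (\<forall>x\<in>U. dpoly_eval ds B x = 0)"
      using irr[OF A(1) B(1)] by blast
    then have "(\<forall>x\<in>U. dpoly_eval ds a (f x @ x) = 0) \<or> (\<forall>x\<in>U. dpoly_eval ds b (f x @ x) = 0)"
      using A(4) B(4) by fastforce
    then show ?thesis using ab(1,2) unfolding vanishing_def by blast
  qed
  then show ?thesis unfolding prime_dideal_def using D one by blast
qed

text \<open>
  On an irreducible open subset where the homomorphism is given by quotients, \<open>projection_open\<close> is applied
  to its graph. The closure \<open>Z\<close> of the image of this subset has interior points
  because finitely many of its translates cover \<open>H\<close>.
\<close>

lemma hom_open_at_point:
  fixes ds :: "('a::field_char_0 \<Rightarrow> 'a) list"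
  assumes K: "differential_field ds" and DC: "differentially_closed ds"
    and G: "differential_algebraic_group ds n G" and H: "differential_algebraic_group ds m H"
    and hom: "differential_group_hom ds n G m H \<phi>" and dom: "dominant ds (carrier G) m (carrier H) \<phi>"
  obtains x0 where "x0 \<in> carrier G"
    "\<And>W. openin (kolchin ds n (carrier G)) W \<Longrightarrow> x0 \<in> W \<Longrightarrow>
      \<exists>V. openin (kolchin ds m (carrier H)) V \<and> \<phi> x0 \<in> V \<and> V \<subseteq> \<phi> ` W"
proof -
  interpret G: group G using G by (simp add: differential_algebraic_group_def)
  interpret H: group H using H by (simp add: differential_algebraic_group_def)
  let ?X = "carrier G" and ?Y = "carrier H"
  let ?TX = "kolchin ds n ?X" and ?TY = "kolchin ds m ?Y"
  have hom_mult: "\<phi> (x \<otimes>\<^bsub>G\<^esub> y) = \<phi> x \<otimes>\<^bsub>H\<^esub> \<phi> y" if "x \<in> ?X" "y \<in> ?X" for x y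
    using hom that by (simp add: differential_group_hom_def hom_def)
  have hom_closed: "\<phi> x \<in> ?Y" if "x \<in> ?X" for x
    using hom that by (auto simp: differential_group_hom_def hom_def)
  obtain I where I: "I \<subseteq> dpolys ds n" "?X = zero_set ds n I"
    using G by (auto simp: differential_algebraic_group_def differential_variety_def differential_ideal_def)
  have X: "?X \<subseteq> {x. length x = n}" unfolding I(2) by (auto simp: zero_set_def)
  have Y: "?Y \<subseteq> {y. length y = m}"
    using H differential_variety_length by (auto simp: differential_algebraic_group_def)
  have lenX: "length x = n" if "x \<in> ?X" for x using that X by blast
  have lenY: "length y = m" if "y \<in> ?Y" for y using that Y by blast
  have reg: "regular_function ds n ?X (\<lambda>x. \<phi> x ! i)" if "i < m" for i
    using hom that by (simp add: differential_group_hom_def differential_morphism_def)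
  have "?X \<noteq> {}" using G.one_closed by blast
  obtain q0 where q0: "q0 \<in> dpolys ds n" "{x \<in> ?X. dpoly_eval ds q0 x \<noteq> 0} \<noteq> {}"
    "\<forall>r\<in>dpolys ds n. {x \<in> ?X. dpoly_eval ds (q0 * r) x \<noteq> 0} \<noteq> {} \<longrightarrow>
       vanishing ds n {x \<in> ?X. dpoly_eval ds (q0 * r) x \<noteq> 0} = vanishing ds n {x \<in> ?X. dpoly_eval ds q0 x \<noteq> 0}"
    by (rule irreducible_open_subset[OF K X \<open>?X \<noteq> {}\<close>])
  then obtain x1 where x1: "x1 \<in> ?X" "dpoly_eval ds q0 x1 \<noteq> 0" by blast
  obtain U1 where U1: "openin ?TX U1" "x1 \<in> U1" "\<And>i. i < m \<Longrightarrow> quotient_on ds n U1 (\<lambda>x. \<phi> x ! i)"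
    using regular_functions_nbhd[OF X, where m = m and f = "\<lambda>i x. \<phi> x ! i", OF reg x1(1)] by blast
  obtain r0 where r0: "r0 \<in> dpolys ds n" "dpoly_eval ds r0 x1 \<noteq> 0" "{x \<in> ?X. dpoly_eval ds r0 x \<noteq> 0} \<subseteq> U1"
    by (rule openin_kolchin_nbhd[OF X U1(1,2)])
  \<comment> \<open>\<open>r0\<close> shrinks the irreducible open set to one on which all
    coordinates of \<open>\<phi>\<close> are quotients; irreducibility is inherited.\<close>
  define q where "q = q0 * r0"
  define U where "U = {x \<in> ?X. dpoly_eval ds q x \<noteq> 0}"
  have q: "q \<in> dpolys ds n" using q0(1) r0(1) by (simp add: q_def dpolys_mult)
  have x1U: "x1 \<in> U" using x1 r0(2) by (simp add: U_def q_def dpoly_eval_mult)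
  have UX: "U \<subseteq> ?X" by (auto simp: U_def)
  have U_open: "openin ?TX U" unfolding U_def by (rule openin_kolchin_basic[OF X q])
  have "U \<subseteq> U1" using r0(3) by (auto simp: U_def q_def dpoly_eval_mult)
  then have quot: "quotient_on ds n U (\<lambda>x. \<phi> x ! i)" if "i < m" for i
    using U1(3)[OF that] quotient_on_subset by blast
  have irr: "(\<forall>x\<in>U. dpoly_eval ds a x = 0) \<or> (\<forall>x\<in>U. dpoly_eval ds b x = 0)"
    if ab: "a \<in> dpolys ds n" "b \<in> dpolys ds n" "\<forall>x\<in>U. dpoly_eval ds (a * b) x = 0" for a b
  proof (rule ccontr)
    assume "\<not> ?thesis"
    then obtain y where y: "y \<in> U" "dpoly_eval ds a y \<noteq> 0"
      and b: "\<not> (\<forall>x\<in>U. dpoly_eval ds b x = 0)" by blast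
    let ?O = "\<lambda>r. {x \<in> ?X. dpoly_eval ds (q0 * r) x \<noteq> 0}"
    \<comment> \<open>Both sets are nonempty basic open parts of the set given by \<open>q0\<close>,
      so they have the same vanishing ideal. As \<open>b\<close> vanishes where \<open>a\<close>
      does not, it then vanishes on all of \<open>U\<close>.\<close>
    have eq: "vanishing ds n (?O (r0 * a)) = vanishing ds n (?O r0)"
    proof -
      have "y \<in> ?O (r0 * a)" "x1 \<in> ?O r0"
        using y x1U by (auto simp: U_def q_def dpoly_eval_mult)
      then have "?O (r0 * a) \<noteq> {}" "?O r0 \<noteq> {}" by blast+
      then show ?thesis using q0(3) r0(1) ab(1) dpolys_mult by blast
    qed
    have "b \<in> vanishing ds n (?O (r0 * a))"
      using ab(2,3) by (auto simp: vanishing_def U_def q_def dpoly_eval_mult)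
    then have "b \<in> vanishing ds n (?O r0)" by (simp only: eq)
    then show False using b by (simp add: vanishing_def U_def q_def)
  qed
  define P where "P = vanishing ds (m + n) ((\<lambda>x. \<phi> x @ x) ` U)"
  have P_iff: "p \<in> P \<longleftrightarrow> p \<in> dpolys ds (m + n) \<and> (\<forall>x\<in>U. dpoly_eval ds p (\<phi> x @ x) = 0)" for p
    by (simp add: P_def vanishing_def)
  have prime: "prime_dideal ds (m + n) P"
    unfolding P_def using x1U lenX lenY hom_closed UX
    by (intro prime_graph_ideal[OF K irr _ _ _ quot]) auto
  obtain h where h: "h \<in> dpolys ds (m + n) - P"
    "\<forall>z b. (\<forall>p\<in>P. dpoly_eval ds p z = 0) \<and> dpoly_eval ds h z \<noteq> 0 \<and>
       b \<in> dpolys ds (m + n) \<and> dpoly_eval ds b z \<noteq> 0 \<longrightarrow>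
       (\<exists>c\<in>dpolys ds m. dpoly_eval ds c z \<noteq> 0 \<and>
         (\<forall>y. length y = m \<and> (\<forall>p\<in>P \<inter> dpolys ds m. dpoly_eval ds p y = 0) \<and> dpoly_eval ds c y \<noteq> 0 \<longrightarrow>
           (\<exists>x. length x = n \<and> (\<forall>p\<in>P. dpoly_eval ds p (y @ x) = 0) \<and> dpoly_eval ds b (y @ x) \<noteq> 0)))"
    by (rule projection_open[OF K DC prime])
  \<comment> \<open>This is the closure of the image of \<open>U\<close> because the elements of
    \<open>P\<close> without \<open>x\<close> are exactly the polynomials vanishing on that
    image.\<close>
  define Z where "Z = {y \<in> ?Y. \<forall>p\<in>P \<inter> dpolys ds m. dpoly_eval ds p y = 0}"
  have UZ: "\<phi> x \<in> Z" if x: "x \<in> U" for x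
  proof -
    have "dpoly_eval ds p (\<phi> x) = 0" if "p \<in> P \<inter> dpolys ds m" for p
    proof -
      have "length (\<phi> x) = m" using x UX lenY hom_closed by blast
      then have "dpoly_eval ds p (\<phi> x) = dpoly_eval ds p (\<phi> x @ x)"
        using that dpoly_eval_append[of p ds m "\<phi> x" x] by simp
      then show ?thesis using that x by (simp add: P_iff)
    qed
    then show ?thesis using x UX hom_closed by (auto simp: Z_def)
  qed
  have Z_open: "openin ?TY (?Y - Z)"
  proof -
    have "?Y - Z = (\<Union>p\<in>P \<inter> dpolys ds m. {y \<in> ?Y. dpoly_eval ds p y \<noteq> 0})"
      by (auto simp: Z_def)
    then show ?thesis using openin_kolchin_basic[OF Y] by auto
  qed
  obtain S where S: "finite S" "S \<subseteq> ?X" "?X \<subseteq> (\<Union>g\<in>S. (\<lambda>x. g \<otimes>\<^bsub>G\<^esub> x) ` U)"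
    using finite_translate_cover[OF K G U_open] x1U by blast
  let ?tr = "\<lambda>g. (\<lambda>y. g \<otimes>\<^bsub>H\<^esub> y) ` Z"
  have ZY: "Z \<subseteq> ?Y" by (auto simp: Z_def)
  have tr_closed: "closedin ?TY (?tr g)" if g: "g \<in> ?Y" for g
  proof -
    have "openin ?TY ((\<lambda>y. g \<otimes>\<^bsub>H\<^esub> y) ` (?Y - Z))"
      by (rule translation_open[OF K H g Z_open])
    moreover have "(\<lambda>y. g \<otimes>\<^bsub>H\<^esub> y) ` (?Y - Z) = ?Y - ?tr g"
    proof (intro equalityI subsetI)
      fix y assume "y \<in> (\<lambda>y. g \<otimes>\<^bsub>H\<^esub> y) ` (?Y - Z)"
      then obtain y' where y': "y' \<in> ?Y" "y' \<notin> Z" "y = g \<otimes>\<^bsub>H\<^esub> y'" by blast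
      have "y \<notin> ?tr g"
      proof
        assume "y \<in> ?tr g"
        then obtain z where z: "z \<in> Z" "y = g \<otimes>\<^bsub>H\<^esub> z" by (rule imageE)
        have zY: "z \<in> ?Y" using z(1) ZY by blast
        have "g \<otimes>\<^bsub>H\<^esub> y' = g \<otimes>\<^bsub>H\<^esub> z" by (rule trans[OF y'(3)[symmetric] z(2)])
        then have "y' = z" using H.l_cancel[of g y' z] g y'(1) zY by blast
        then show False using z(1) y'(2) by simp
      qed
      then show "y \<in> ?Y - ?tr g" using y' g by simp
    next
      fix y assume y: "y \<in> ?Y - ?tr g"
      let ?y = "inv\<^bsub>H\<^esub> g \<otimes>\<^bsub>H\<^esub> y"
      have eq: "y = g \<otimes>\<^bsub>H\<^esub> ?y" using y g by (simp add: H.m_assoc[symmetric])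
      moreover have "?y \<notin> Z" using eq y by blast
      ultimately show "y \<in> (\<lambda>y. g \<otimes>\<^bsub>H\<^esub> y) ` (?Y - Z)"
        using y g by (intro image_eqI[of _ _ ?y]) auto
    qed
    moreover have "?tr g \<subseteq> ?Y" using g ZY by auto
    ultimately show ?thesis
      unfolding closedin_def topspace_kolchin[OF Y] by simp
  qed
  let ?\<C> = "(\<lambda>g. ?tr (\<phi> g)) ` S"
  have cl: "closedin ?TY C" if "C \<in> ?\<C>" for C
    using that S(2) hom_closed tr_closed by auto
  have fin: "finite ?\<C>" using S(1) by simp
  have "\<phi> ` ?X \<subseteq> \<Union>?\<C>"
  proof (rule image_subsetI)
    fix x assume "x \<in> ?X"
    then obtain g u where gu: "g \<in> S" "u \<in> U" "x = g \<otimes>\<^bsub>G\<^esub> u" using S(3) by blast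
    then have "\<phi> x = \<phi> g \<otimes>\<^bsub>H\<^esub> \<phi> u" using S(2) UX hom_mult by blast
    then show "\<phi> x \<in> \<Union>?\<C>" using gu(1) UZ[OF gu(2)] by blast
  qed
  \<comment> \<open>Dominance enters through this inclusion: finitely many translates of
    \<open>Z\<close> form a closed set containing the image of \<open>G\<close>.\<close>
  then have "?TY closure_of (\<phi> ` ?X) \<subseteq> \<Union>?\<C>"
    by (rule closure_of_minimal) (rule closedin_Union[OF fin cl])
  then have cover: "?Y \<subseteq> \<Union>?\<C>" using dom by (simp add: dominant_def)
  have "openin ?TY ?Y"
    using openin_topspace[of ?TY] topspace_kolchin[OF Y] by simp
  moreover have "?Y \<noteq> {}" using H.one_closed by blast
  ultimately obtain C V where "C \<in> ?\<C>" "openin ?TY V" "V \<noteq> {}" "V \<subseteq> C"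
    using finite_closed_cover_interior[OF fin cl _ _ cover] by blast
  then obtain g where V: "g \<in> S" "openin ?TY V" "V \<noteq> {}" "V \<subseteq> ?tr (\<phi> g)" by blast
  have g: "\<phi> g \<in> ?Y" using V(1) S(2) hom_closed by blast
  let ?T = "(\<lambda>y. inv\<^bsub>H\<^esub> (\<phi> g) \<otimes>\<^bsub>H\<^esub> y) ` V"
  have T_open: "openin ?TY ?T"
    by (rule translation_open[OF K H H.inv_closed[OF g] V(2)])
  have TZ: "?T \<subseteq> Z"
  proof (rule image_subsetI)
    fix y assume "y \<in> V"
    then obtain z where z: "z \<in> Z" "y = \<phi> g \<otimes>\<^bsub>H\<^esub> z" using V(4) by blast
    then have "inv\<^bsub>H\<^esub> (\<phi> g) \<otimes>\<^bsub>H\<^esub> y = z"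
      using g ZY by (auto simp: H.m_assoc[symmetric])
    then show "inv\<^bsub>H\<^esub> (\<phi> g) \<otimes>\<^bsub>H\<^esub> y \<in> Z" using z(1) by simp
  qed
  obtain y0 where y0: "y0 \<in> ?T" using V(3) by blast
  \<comment> \<open>In \<open>H\<close>, the inequation for \<open>t\<close> forces membership in
    \<open>Z\<close>. As \<open>t\<close> is nonzero at a point of \<open>Z\<close>, it lies outside
    \<open>P\<close>, and so does \<open>h * t\<close>; a point of \<open>U\<close> over which the
    latter is nonzero serves as \<open>x0\<close>.\<close>
  obtain t where t: "t \<in> dpolys ds m" "dpoly_eval ds t y0 \<noteq> 0" "{y \<in> ?Y. dpoly_eval ds t y \<noteq> 0} \<subseteq> ?T"
    by (rule openin_kolchin_nbhd[OF Y T_open y0])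
  have t': "t \<in> dpolys ds (m + n)" using t(1) dpolys_mono[of m "m + n" ds] by auto
  have "t \<notin> P"
    using y0 TZ t(1,2) by (auto simp: Z_def)
  then have "h * t \<notin> P"
    using prime h(1) t' unfolding prime_dideal_def by blast
  moreover have "h * t \<in> dpolys ds (m + n)" using h(1) t' by (simp add: dpolys_mult)
  ultimately obtain x0 where x0: "x0 \<in> U" "dpoly_eval ds h (\<phi> x0 @ x0) \<noteq> 0" "dpoly_eval ds t (\<phi> x0 @ x0) \<noteq> 0"
    by (auto simp: P_iff dpoly_eval_mult)
  have x0X: "x0 \<in> ?X" using x0(1) UX by blast
  have "\<exists>V. openin ?TY V \<and> \<phi> x0 \<in> V \<and> V \<subseteq> \<phi> ` W" if W: "openin ?TX W" "x0 \<in> W" for W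
  proof -
    obtain w where w: "w \<in> dpolys ds n" "dpoly_eval ds w x0 \<noteq> 0" "{x \<in> ?X. dpoly_eval ds w x \<noteq> 0} \<subseteq> W"
      by (rule openin_kolchin_nbhd[OF X W])
    have raise: "\<exists>p'\<in>dpolys ds (m + n). \<forall>y x. length y = m \<longrightarrow> dpoly_eval ds p' (y @ x) = dpoly_eval ds p x"
      if "p \<in> dpolys ds n" for p
      by (rule dpoly_raise_indices[OF that])
    \<comment> \<open>The factor \<open>w\<close> will bring the lifted point into \<open>W\<close>,
      and \<open>q\<close> into the set \<open>U\<close>, where \<open>\<phi>\<close> is given by
      quotients.\<close>
    obtain b where b: "b \<in> dpolys ds (m + n)"
      "\<And>y x. length y = m \<Longrightarrow> dpoly_eval ds b (y @ x) = dpoly_eval ds (w * q) x"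
      using raise[OF dpolys_mult[OF w(1) q]] by blast
    have len0: "length (\<phi> x0) = m" using x0X lenY hom_closed by blast
    have "dpoly_eval ds b (\<phi> x0 @ x0) \<noteq> 0"
      using x0(1) w(2) by (simp add: b(2)[OF len0] dpoly_eval_mult U_def)
    moreover have "\<forall>p\<in>P. dpoly_eval ds p (\<phi> x0 @ x0) = 0" using x0(1) by (simp add: P_iff)
    ultimately obtain c where c: "c \<in> dpolys ds m" "dpoly_eval ds c (\<phi> x0 @ x0) \<noteq> 0"
      "\<And>y. length y = m \<Longrightarrow> \<forall>p\<in>P \<inter> dpolys ds m. dpoly_eval ds p y = 0 \<Longrightarrow> dpoly_eval ds c y \<noteq> 0 \<Longrightarrow>
           \<exists>x. length x = n \<and> (\<forall>p\<in>P. dpoly_eval ds p (y @ x) = 0) \<and> dpoly_eval ds b (y @ x) \<noteq> 0"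
      using h(2) x0(2) b(1) by blast
    \<comment> \<open>\<open>c\<close> makes the lifting succeed, and \<open>t\<close> keeps
      \<open>y\<close> inside \<open>Z\<close>, where its hypothesis holds.\<close>
    let ?V = "{y \<in> ?Y. dpoly_eval ds (c * t) y \<noteq> 0}"
    have "openin ?TY ?V"
      by (rule openin_kolchin_basic[OF Y dpolys_mult[OF c(1) t(1)]])
    moreover have "\<phi> x0 \<in> ?V"
      using c(2) x0(3) x0X hom_closed
      by (simp add: dpoly_eval_append[OF c(1) len0] dpoly_eval_append[OF t(1) len0] dpoly_eval_mult)
    moreover have "?V \<subseteq> \<phi> ` W"
    proof
      fix y assume "y \<in> ?V"
      then have y: "y \<in> ?Y" "dpoly_eval ds c y \<noteq> 0" "dpoly_eval ds t y \<noteq> 0"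
        by (auto simp: dpoly_eval_mult)
      then have "y \<in> Z" using t(3) TZ by blast
      then have "\<forall>p\<in>P \<inter> dpolys ds m. dpoly_eval ds p y = 0" by (simp add: Z_def)
      from c(3)[OF lenY[OF y(1)] this y(2)] obtain x where x: "length x = n"
        "\<forall>p\<in>P. dpoly_eval ds p (y @ x) = 0" "dpoly_eval ds b (y @ x) \<noteq> 0" by blast
      have leny: "length y = m" by (rule lenY[OF y(1)])
      have wq: "dpoly_eval ds w x \<noteq> 0" "dpoly_eval ds q x \<noteq> 0"
        using x(3) by (simp_all add: b(2)[OF leny] dpoly_eval_mult)
      \<comment> \<open>The lifted pair is so far only a zero of \<open>P\<close>. The equations of
        \<open>G\<close> in \<open>x\<close> vanish on the graph, hence belong to \<open>P\<close>
        and place \<open>x\<close> in \<open>G\<close>.\<close>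
      have "dpoly_eval ds p x = 0" if p: "p \<in> I" for p
      proof -
        obtain p' where p': "p' \<in> dpolys ds (m + n)"
          "\<And>y x. length y = m \<Longrightarrow> dpoly_eval ds p' (y @ x) = dpoly_eval ds p x"
          using raise[of p] p I(1) by blast
        have "dpoly_eval ds p' (\<phi> u @ u) = 0" if u: "u \<in> U" for u
        proof -
          have uX: "u \<in> ?X" using u UX by blast
          then have "dpoly_eval ds p u = 0" using p unfolding I(2) by (simp add: zero_set_def)
          then show ?thesis using p'(2)[OF lenY[OF hom_closed[OF uX]]] by simp
        qed
        then have "p' \<in> P" using p'(1) by (simp add: P_iff)
        then have "dpoly_eval ds p' (y @ x) = 0" using x(2) by blast
        then show ?thesis using p'(2)[OF leny] by simp
      qed
      then have xX: "x \<in> ?X" unfolding I(2) using x(1) by (simp add: zero_set_def)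
      then have xU: "x \<in> U" using wq(2) by (simp add: U_def)
      \<comment> \<open>Likewise the equation of the graph with its denominator cleared belongs to
        \<open>P\<close>. Since the denominator has no zero on \<open>U\<close>, the pair lies on
        the graph.\<close>
      have "y ! i = \<phi> x ! i" if i: "i < m" for i
      proof -
        obtain A B where A: "A \<in> dpolys ds n" "B \<in> dpolys ds n" "\<forall>x\<in>U. dpoly_eval ds B x \<noteq> 0"
          "\<forall>x\<in>U. \<phi> x ! i = dpoly_eval ds A x / dpoly_eval ds B x"
          by (rule quotient_onE[OF quot[OF i]])
        obtain A' where A': "A' \<in> dpolys ds (m + n)"
          "\<And>y x. length y = m \<Longrightarrow> dpoly_eval ds A' (y @ x) = dpoly_eval ds A x"
          using raise[OF A(1)] by blast
        obtain B' where B': "B' \<in> dpolys ds (m + n)"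
          "\<And>y x. length y = m \<Longrightarrow> dpoly_eval ds B' (y @ x) = dpoly_eval ds B x"
          using raise[OF A(2)] by blast
        have var: "(pvar (i, 0) :: 'a dpoly) \<in> dpolys ds (m + n)"
          using i by (intro dpolys_var) (simp add: dvars_def)
        have eval: "dpoly_eval ds (B' * pvar (i, 0) - A') (y @ x) = dpoly_eval ds B x * y ! i - dpoly_eval ds A x"
          if "length y = m" for y x
          using that i by (simp add: dpoly_eval_diff dpoly_eval_mult dpoly_eval_var A'(2) B'(2) nth_append)
        have "dpoly_eval ds (B' * pvar (i, 0) - A') (\<phi> u @ u) = 0" if u: "u \<in> U" for u
        proof -
          have uX: "u \<in> ?X" using u UX by blast
          show ?thesis
            unfolding eval[OF lenY[OF hom_closed[OF uX]]] using A(3,4) u by simp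
        qed
        then have "B' * pvar (i, 0) - A' \<in> P"
          using A'(1) B'(1) var by (simp add: P_iff dpolys_closed dpolys_mult)
        then have "dpoly_eval ds (B' * pvar (i, 0) - A') (y @ x) = 0" using x(2) by blast
        then have "dpoly_eval ds B x * y ! i = dpoly_eval ds A x" unfolding eval[OF leny] by simp
        moreover have "dpoly_eval ds B x \<noteq> 0" "\<phi> x ! i = dpoly_eval ds A x / dpoly_eval ds B x"
          using A(3,4) xU by blast+
        ultimately show ?thesis by (metis nonzero_mult_div_cancel_left)
      qed
      then have "y = \<phi> x"
        using leny lenY[OF hom_closed[OF xX]] by (intro nth_equalityI) simp_all
      moreover have "x \<in> W" using w(3) wq(1) xX by blast
      ultimately show "y \<in> \<phi> ` W" by blast
    qed
    ultimately show ?thesis by blast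
  qed
  then show thesis using that[OF x0X] by blast
qed

section \<open>Homogeneity: openness everywhere, and surjectivity\<close>

theorem theorem26:
  fixes ds :: "('a::field_char_0 \<Rightarrow> 'a) list"
    and n m :: nat
    and G H :: "'a list monoid"
    and \<phi> :: "'a list \<Rightarrow> 'a list"
  assumes "differential_field ds"
    and "differentially_closed ds"
    and "differential_algebraic_group ds n G"
    and "differential_algebraic_group ds m H"
    and "differential_group_hom ds n G m H \<phi>"
    and "dominant ds (carrier G) m (carrier H) \<phi>"
  shows "open_map (kolchin ds n (carrier G)) (kolchin ds m (carrier H)) \<phi> \<and>
    \<phi> ` carrier G = carrier H"
proof -
  note K = assms(1) and G = assms(3) and H = assms(4) and dom = assms(6)
  interpret G: group G using G by (simp add: differential_algebraic_group_def)
  interpret H: group H using H by (simp add: differential_algebraic_group_def)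
  let ?X = "carrier G" and ?Y = "carrier H"
  let ?TX = "kolchin ds n ?X" and ?TY = "kolchin ds m ?Y"
  have "\<phi> \<in> hom G H"
    using assms(5) by (simp add: differential_group_hom_def)
  then interpret group_hom G H \<phi>
    by (simp add: group_hom_def group_hom_axioms_def G.group_axioms H.group_axioms)
  have X: "?X \<subseteq> {x. length x = n}"
    using G differential_variety_length by (auto simp: differential_algebraic_group_def)
  have Y: "?Y \<subseteq> {y. length y = m}"
    using H differential_variety_length by (auto simp: differential_algebraic_group_def)
  obtain x0 where x0: "x0 \<in> ?X"
    "\<And>W. openin ?TX W \<Longrightarrow> x0 \<in> W \<Longrightarrow> \<exists>V. openin ?TY V \<and> \<phi> x0 \<in> V \<and> V \<subseteq> \<phi> ` W"
    using hom_open_at_point[OF assms] by blast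
  have "openin ?TY (\<phi> ` U)" if U: "openin ?TX U" for U
  proof (subst openin_subopen, intro ballI)
    fix y assume "y \<in> \<phi> ` U"
    then obtain x where x: "x \<in> U" "y = \<phi> x" by blast
    have UX: "U \<subseteq> ?X" using openin_subset[OF U] topspace_kolchin[OF X] by simp
    then have xX: "x \<in> ?X" using x(1) by blast
    \<comment> \<open>Translation by \<open>?g\<close> carries \<open>x0\<close> to
      \<open>x\<close>, so openness at \<open>x0\<close>, applied to \<open>U\<close> moved back by
      the inverse of \<open>?g\<close>, yields openness at \<open>x\<close>.\<close>
    let ?g = "x \<otimes>\<^bsub>G\<^esub> inv\<^bsub>G\<^esub> x0"
    have g: "?g \<in> ?X" "?g \<otimes>\<^bsub>G\<^esub> x0 = x"
      using xX x0(1) by (simp_all add: G.m_assoc)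
    let ?W = "(\<lambda>z. inv\<^bsub>G\<^esub> ?g \<otimes>\<^bsub>G\<^esub> z) ` U"
    have "openin ?TX ?W"
      by (rule translation_open[OF K G G.inv_closed[OF g(1)] U])
    moreover have "x0 \<in> ?W"
    proof (rule image_eqI[OF _ x(1)])
      have "inv\<^bsub>G\<^esub> ?g \<otimes>\<^bsub>G\<^esub> (?g \<otimes>\<^bsub>G\<^esub> x0) = x0"
        using g(1) x0(1) by (simp only: G.m_assoc[symmetric] G.inv_closed G.l_inv G.l_one)
      then show "x0 = inv\<^bsub>G\<^esub> ?g \<otimes>\<^bsub>G\<^esub> x" unfolding g(2) by simp
    qed
    ultimately obtain V where V: "openin ?TY V" "\<phi> x0 \<in> V" "V \<subseteq> \<phi> ` ?W"
      using x0(2) by blast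
    let ?V = "(\<lambda>z. \<phi> ?g \<otimes>\<^bsub>H\<^esub> z) ` V"
    have "openin ?TY ?V"
      by (rule translation_open[OF K H hom_closed[OF g(1)] V(1)])
    moreover have "y \<in> ?V"
    proof (rule image_eqI[OF _ V(2)])
      show "y = \<phi> ?g \<otimes>\<^bsub>H\<^esub> \<phi> x0"
        using hom_mult[OF g(1) x0(1)] x(2) unfolding g(2) by simp
    qed
    moreover have "?V \<subseteq> \<phi> ` U"
    proof (rule image_subsetI)
      fix v assume "v \<in> V"
      then obtain u where u: "u \<in> U" "v = \<phi> (inv\<^bsub>G\<^esub> ?g \<otimes>\<^bsub>G\<^esub> u)" using V(3) by blast
      have uX: "u \<in> ?X" using u(1) UX by blast
      have "\<phi> ?g \<otimes>\<^bsub>H\<^esub> v = \<phi> (?g \<otimes>\<^bsub>G\<^esub> (inv\<^bsub>G\<^esub> ?g \<otimes>\<^bsub>G\<^esub> u))"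
        unfolding u(2) using g(1) uX by (intro hom_mult[symmetric]) simp_all
      also have "?g \<otimes>\<^bsub>G\<^esub> (inv\<^bsub>G\<^esub> ?g \<otimes>\<^bsub>G\<^esub> u) = u"
        using g(1) uX by (simp only: G.m_assoc[symmetric] G.inv_closed G.r_inv G.l_one)
      finally show "\<phi> ?g \<otimes>\<^bsub>H\<^esub> v \<in> \<phi> ` U" using u(1) by simp
    qed
    ultimately show "\<exists>T. openin ?TY T \<and> y \<in> T \<and> T \<subseteq> \<phi> ` U" by blast
  qed
  then have om: "open_map ?TX ?TY \<phi>" by (simp add: open_map_def)
  have "openin ?TX ?X"
    using openin_topspace[of ?TX] topspace_kolchin[OF X] by simp
  then have img: "openin ?TY (\<phi> ` ?X)"
    using om by (simp add: open_map_def)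
  have "?Y \<subseteq> \<phi> ` ?X"
  proof
    fix y assume y: "y \<in> ?Y"
    \<comment> \<open>The coset of the image through \<open>y\<close> is open and nonempty, so the
      dense image meets it; the resulting equation \<open>y \<phi>(a) = \<phi>(b)\<close> exhibits
      \<open>y\<close> as an image.\<close>
    let ?W = "(\<lambda>z. y \<otimes>\<^bsub>H\<^esub> z) ` \<phi> ` ?X"
    have W: "openin ?TY ?W"
      by (rule translation_open[OF K H y img])
    have yW: "y \<in> ?W"
      using y by (intro image_eqI[of _ _ "\<phi> \<one>\<^bsub>G\<^esub>"] imageI) simp_all
    have "y \<in> ?TY closure_of (\<phi> ` ?X)" using dom y by (simp add: dominant_def)
    then have "\<exists>z. z \<in> \<phi> ` ?X \<and> z \<in> T" if "y \<in> T" "openin ?TY T" for T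
      using that unfolding in_closure_of by blast
    from this[OF yW W] obtain z where z: "z \<in> \<phi> ` ?X" "z \<in> ?W" by (elim exE conjE)
    obtain b where b: "b \<in> ?X" "z = \<phi> b" using z(1) by (elim imageE)
    obtain a where a: "a \<in> ?X" "z = y \<otimes>\<^bsub>H\<^esub> \<phi> a" using z(2) by (elim imageE) simp
    have ab: "a \<in> ?X" "b \<in> ?X" "y \<otimes>\<^bsub>H\<^esub> \<phi> a = \<phi> b" using a b by simp_all
    have "y = (y \<otimes>\<^bsub>H\<^esub> \<phi> a) \<otimes>\<^bsub>H\<^esub> inv\<^bsub>H\<^esub> \<phi> a"
      using y ab(1) by (simp add: H.m_assoc)
    also have "\<dots> = \<phi> (b \<otimes>\<^bsub>G\<^esub> inv\<^bsub>G\<^esub> a)"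
      unfolding ab(3) using ab(1,2) by simp
    finally show "y \<in> \<phi> ` ?X" using ab(1,2) by blast
  qed
  then have "\<phi> ` ?X = ?Y" using hom_closed by blast
  with om show ?thesis by blast
qed

end
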